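(* Let $n\ge 2$, $1<p<\infty$, let $\Omega\subset\mathbb{R}^n$ be a bounded domain, and let $D\subset\Omega$ be a nonempty open set with Lipschitz boundary. Let $\sigma_D\in L^\infty_+(D)$ and $\sigma(x)=1+\sigma_D(x)\chi_D(x)$ for $x\in\Omega$, where $\chi_D$ is the characteristic function of $D$. Fix $\rho,\rho^\perp\in\mathbb{R}^n$ with $|\rho|=|\rho^\perp|=1$ and $\rho\cdot\rho^\perp=0$, fix a Wolff profile $a$, and for $\tau>0$, $t\in\mathbb{R}$ let $u_0(x)=e^{\tau(x\cdot\rho-t)}a(\tau x\cdot\rho^\perp)$ be the corresponding Wolff solution. Let $$I_\rho(u_0,\tau,t)=\tau^{n-p}\,\big((\Lambda_\sigma-\Lambda_1)(u_0),u_0\big),\qquad h_D(\rho)=\sup_{x\in D}x\cdot\rho .$$ Then the following hold, where $c,C>0$ denote constants independent of $\tau$ (possibly different in each estimate). (1) If $t>h_D(\rho)$, then $\lim_{\tau\to\infty}|I_\rho(u_0,\tau,t)|=0$, and more precisely there are $C,c>0$ such that $|I_\rho(u_0,\tau,t)|\le Ce^{-c\tau}$ for all $\tau>0$. (2) If $t=h_D(\rho)$, then $\liminf_{\tau\to\infty}|I_\rho(u_0,\tau,h_D(\rho))|>0$, and more precisely there are $c,C>0$ such that $|I_\rho(u_0,\tau,h_D(\rho))|\le C\tau^n$ for all $\tau>0$ and $c\le|I_\rho(u_0,\tau,h_D(\rho))|$ for all sufficiently large $\tau$. (3) If $t<h_D(\rho)$, then $\lim_{\tau\to\infty}|I_\rho(u_0,\tau,t)|=\infty$,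 and more precisely there is $c>0$ such that $|I_\rho(u_0,\tau,t)|\ge ce^{c\tau}$ for all sufficiently large $\tau$.
   Context: All functions are real valued. For an open set $U$, $L^\infty_+(U)=\{\gamma\in L^\infty(U):\gamma>\varepsilon \text{ a.e. for some } \varepsilon>0\}$. Dirichlet-to-Neumann (DN) map: let $X=W^{1,p}(\Omega)/W^{1,p}_0(\Omega)$ with dual $X'$. For $\gamma\in L^\infty_+(\Omega)$ and $f\in W^{1,p}(\Omega)$ there is a unique weak solution $u\in W^{1,p}(\Omega)$ of $\mathrm{div}(\gamma|\nabla u|^{p-2}\nabla u)=0$ in $\Omega$ with $u-f\in W^{1,p}_0(\Omega)$. The nonlinear map $\Lambda_\gamma:X\to X'$ is defined by $$(\Lambda_\gamma f,g)=\int_\Omega\gamma|\nabla u|^{p-2}\nabla u\cdot\nabla v\,dx,$$ where $u$ is this solution and $v\in W^{1,p}(\Omega)$ is any function with $v-g\in W_0^{1,p}(\Omega)$. $\Lambda_1$ is the DN map of the constant conductivity $1$. $\Lambda_\gamma(u_0)$ means $\Lambda_\gamma$ applied to the class of $u_0|_\Omega$ in $X$, and $(\Lambda_\sigma-\Lambda_1)(u_0)=\Lambda_\sigma(u_0)-\Lambda_1(u_0)$. Wolff profile: a function $a\in C^\infty(\mathbb{R})$ solving $$a''+V(a,a')a=0,\qquad V(a,a')=\frac{(2p-3)(a')^2+(p-1)a^2}{(p-1)(a')^2+a^2},$$ with $(a(0),a'(0))=(a_0,b_0)\neq(0,0)$. It is known that for every such initial datum a solution exists which is periodic with some period $\lambda_p>0$,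 has $\int_0^{\lambda_p}a(s)\,ds=0$, and satisfies $0<c<a(s)^2+a'(s)^2<C$ for all $s\in\mathbb{R}$ with constants $c,C$; $a$ denotes such a solution. It is also known that the function $u_0$ is then $p$-harmonic in $\mathbb{R}^n$, i.e. $\mathrm{div}(|\nabla u_0|^{p-2}\nabla u_0)=0$. *)

theory Defs
  imports "HOL-Analysis.Analysis"
begin

section \<open>Smooth functions and test functions\<close>

definition grad :: "('a::real_inner \<Rightarrow> real) \<Rightarrow> 'a \<Rightarrow> 'a" where
  "grad f x = (THE G. GDERIV f x :> G)"

primrec C_diff :: "nat \<Rightarrow> ('a::euclidean_space \<Rightarrow> real) \<Rightarrow> bool" where
  "C_diff 0 f \<longleftrightarrow> continuous_on UNIV f"
| "C_diff (Suc k) f \<longleftrightarrow>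
     (\<forall>x. f differentiable at x) \<and> (\<forall>b\<in>Basis. C_diff k (\<lambda>x. grad f x \<bullet> b))"

definition smooth :: "('a::euclidean_space \<Rightarrow> real) \<Rightarrow> bool" where
  "smooth f \<longleftrightarrow> (\<forall>k. C_diff k f)"

text \<open>Smooth functions with compact support in \<^term>\<open>U\<close>, extended by zero to the whole space.\<close>

definition test_functions :: "'a::euclidean_space set \<Rightarrow> ('a \<Rightarrow> real) set" where
  "test_functions U = {\<phi>. smooth \<phi> \<and>
     compact (closure {x. \<phi> x \<noteq> 0}) \<and> closure {x. \<phi> x \<noteq> 0} \<subseteq> U}"


section \<open>Lebesgue and Sobolev spaces\<close>

text \<open>
  Elements of the function spaces on an open set \<^term>\<open>U\<close> are represented by total functions;
  no equality-almost-everywhere quotient is taken, and values outside \<^term>\<open>U\<close> are irrelevant.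
\<close>

definition Lp_on :: "real \<Rightarrow> 'a::euclidean_space set \<Rightarrow> ('a \<Rightarrow> 'b::euclidean_space) set" where
  "Lp_on p U = {f. f \<in> borel_measurable (lebesgue_on U) \<and>
     integrable (lebesgue_on U) (\<lambda>x. norm (f x) powr p)}"

definition Linfty_pos :: "'a::euclidean_space set \<Rightarrow> ('a \<Rightarrow> real) set" where
  "Linfty_pos U = {\<gamma>. \<gamma> \<in> borel_measurable (lebesgue_on U) \<and>
     (\<exists>M. AE x in lebesgue_on U. \<bar>\<gamma> x\<bar> \<le> M) \<and>
     (\<exists>\<epsilon>>0. AE x in lebesgue_on U. \<epsilon> < \<gamma> x)}"

definition locally_integrable ::
    "'a::euclidean_space set \<Rightarrow> ('a \<Rightarrow> 'b::euclidean_space) \<Rightarrow> bool" where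
  "locally_integrable U f \<longleftrightarrow> (\<forall>K. compact K \<and> K \<subseteq> U \<longrightarrow> f absolutely_integrable_on K)"

definition has_weak_gradient ::
    "'a::euclidean_space set \<Rightarrow> ('a \<Rightarrow> real) \<Rightarrow> ('a \<Rightarrow> 'a) \<Rightarrow> bool" where
  "has_weak_gradient U u G \<longleftrightarrow> locally_integrable U u \<and> locally_integrable U G \<and>
     (\<forall>\<phi>\<in>test_functions U.
        (LINT x|lebesgue_on U. u x *\<^sub>R grad \<phi> x) = - (LINT x|lebesgue_on U. \<phi> x *\<^sub>R G x))"

text \<open>The weak gradient is determined almost everywhere; one representative is chosen.\<close>

definition weak_grad :: "'a::euclidean_space set \<Rightarrow> ('a \<Rightarrow> real) \<Rightarrow> 'a \<Rightarrow> 'a" where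
  "weak_grad U u = (SOME G. has_weak_gradient U u G)"

definition W1p :: "real \<Rightarrow> 'a::euclidean_space set \<Rightarrow> ('a \<Rightarrow> real) set" where
  "W1p p U = {u \<in> Lp_on p U. \<exists>G. has_weak_gradient U u G \<and> G \<in> Lp_on p U}"

definition W1p_norm :: "real \<Rightarrow> 'a::euclidean_space set \<Rightarrow> ('a \<Rightarrow> real) \<Rightarrow> real" where
  "W1p_norm p U u =
     ((LINT x|lebesgue_on U. \<bar>u x\<bar> powr p) +
      (LINT x|lebesgue_on U. norm (weak_grad U u x) powr p)) powr (1 / p)"

definition W1p0 :: "real \<Rightarrow> 'a::euclidean_space set \<Rightarrow> ('a \<Rightarrow> real) set" where
  "W1p0 p U = {u \<in> W1p p U. \<exists>\<phi>. (\<forall>k::nat. \<phi> k \<in> test_functions U) \<and>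
     (\<lambda>k. W1p_norm p U (\<lambda>x. u x - \<phi> k x)) \<longlonglongrightarrow> 0}"


section \<open>The Dirichlet-to-Neumann map\<close>

definition trace_rel ::
    "real \<Rightarrow> 'a::euclidean_space set \<Rightarrow> (('a \<Rightarrow> real) \<times> ('a \<Rightarrow> real)) set" where
  "trace_rel p U = {(f, g). f \<in> W1p p U \<and> g \<in> W1p p U \<and> (\<lambda>x. f x - g x) \<in> W1p0 p U}"

text \<open>
  The class of \<^term>\<open>f\<close> in \<open>X = W1p p U // trace_rel p U\<close>. Being a set of functions, it is
  exactly the set of all Sobolev functions with the boundary values of \<^term>\<open>f\<close>.
\<close>

definition trace_class ::
    "real \<Rightarrow> 'a::euclidean_space set \<Rightarrow> ('a \<Rightarrow> real) \<Rightarrow> ('a \<Rightarrow> real) set" where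
  "trace_class p U f = trace_rel p U `` {f}"

text \<open>
  The factor \<open>|v| powr (p - 2)\<close> is \<open>0\<close> at \<open>v = 0\<close>, so the flux \<open>|v| powr (p - 2) v\<close> has its usual
  value \<open>0\<close> there, also for \<open>p < 2\<close>.
\<close>

definition p_flux :: "real \<Rightarrow> 'a::euclidean_space \<Rightarrow> 'a" where
  "p_flux p v = (norm v powr (p - 2)) *\<^sub>R v"

definition weak_solution ::
    "real \<Rightarrow> 'a::euclidean_space set \<Rightarrow> ('a \<Rightarrow> real) \<Rightarrow> ('a \<Rightarrow> real) \<Rightarrow> bool" where
  "weak_solution p U \<gamma> u \<longleftrightarrow> u \<in> W1p p U \<and>
     (\<forall>\<phi>\<in>test_functions U.
        (LINT x|lebesgue_on U. \<gamma> x * (p_flux p (weak_grad U u x) \<bullet> grad \<phi> x)) = 0)"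

text \<open>
  The pairing of \<open>\<Lambda>\<^sub>\<gamma> F\<close> with \<open>G\<close>, for classes \<open>F, G \<in> X\<close>. The choices are immaterial: the solution
  \<open>u\<close> in the class \<open>F\<close> is unique up to null sets, and the value is the same for every \<open>v \<in> G\<close>.
\<close>

definition DN_map ::
    "real \<Rightarrow> 'a::euclidean_space set \<Rightarrow> ('a \<Rightarrow> real) \<Rightarrow> ('a \<Rightarrow> real) set \<Rightarrow> (('a \<Rightarrow> real) set \<Rightarrow> real)" where
  "DN_map p U \<gamma> F = (\<lambda>G.
     let u = (SOME u. u \<in> F \<and> weak_solution p U \<gamma> u); v = (SOME v. v \<in> G)
     in LINT x|lebesgue_on U. \<gamma> x * (p_flux p (weak_grad U u x) \<bullet> weak_grad U v x))"


section \<open>Lipschitz boundary\<close>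

text \<open>
  Near each boundary point, \<^term>\<open>D\<close> is the strict epigraph, in some direction \<open>e\<close>, of a Lipschitz
  function of the component orthogonal to \<open>e\<close>.
\<close>

definition lipschitz_boundary :: "'a::euclidean_space set \<Rightarrow> bool" where
  "lipschitz_boundary D \<longleftrightarrow>
     (\<forall>z\<in>frontier D. \<exists>r>0. \<exists>e. norm e = 1 \<and>
        (\<exists>(\<phi>::'a \<Rightarrow> real) L. L-lipschitz_on {y. y \<bullet> e = 0} \<phi> \<and>
           D \<inter> ball z r = {x \<in> ball z r. \<phi> (x - (x \<bullet> e) *\<^sub>R e) < x \<bullet> e}))"


section \<open>Wolff solutions and the indicator function\<close>

definition wolff_V :: "real \<Rightarrow> real \<Rightarrow> real \<Rightarrow> real" where
  "wolff_V p a b =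
     ((2 * p - 3) * b\<^sup>2 + (p - 1) * a\<^sup>2) / ((p - 1) * b\<^sup>2 + a\<^sup>2)"

definition wolff_profile :: "real \<Rightarrow> (real \<Rightarrow> real) \<Rightarrow> bool" where
  "wolff_profile p a \<longleftrightarrow> smooth a \<and>
     (\<forall>s. deriv (deriv a) s + wolff_V p (a s) (deriv a s) * a s = 0) \<and>
     (a 0, deriv a 0) \<noteq> (0, 0) \<and>
     (\<exists>l>0. (\<forall>s. a (s + l) = a s) \<and> integral {0..l} a = 0) \<and>
     (\<exists>c C. 0 < c \<and> (\<forall>s. c < (a s)\<^sup>2 + (deriv a s)\<^sup>2 \<and> (a s)\<^sup>2 + (deriv a s)\<^sup>2 < C))"

definition wolff_solution ::
    "(real \<Rightarrow> real) \<Rightarrow> 'a::euclidean_space \<Rightarrow> 'a \<Rightarrow> real \<Rightarrow> real \<Rightarrow> 'a \<Rightarrow> real" where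
  "wolff_solution a \<rho> \<rho>' \<tau> t x = exp (\<tau> * (x \<bullet> \<rho> - t)) * a (\<tau> * (x \<bullet> \<rho>'))"

definition indicator_fun ::
    "real \<Rightarrow> 'a::euclidean_space set \<Rightarrow> ('a \<Rightarrow> real) \<Rightarrow> (real \<Rightarrow> real) \<Rightarrow> 'a \<Rightarrow> 'a
       \<Rightarrow> real \<Rightarrow> real \<Rightarrow> real" where
  "indicator_fun p U \<sigma> a \<rho> \<rho>' \<tau> t =
     (let F = trace_class p U (wolff_solution a \<rho> \<rho>' \<tau> t)
      in \<tau> powr (real DIM('a) - p) * (DN_map p U \<sigma> F F - DN_map p U (\<lambda>x. 1) F F))"

definition support_fun :: "'a::euclidean_space set \<Rightarrow> 'a \<Rightarrow> real" where
  "support_fun D \<rho> = (SUP x\<in>D. x \<bullet> \<rho>)"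

end

theory Submission
  imports Defs "HOL-Real_Asymp.Real_Asymp"
begin

text \<open>
  Both the \<open>\<sigma>\<close>-harmonic and the \<open>1\<close>-harmonic function with the boundary values of \<open>u\<^sub>0\<close> minimize
  their energies, and the quadratic form of the Dirichlet-to-Neumann map is the minimal energy.
  Testing the first minimum with \<open>u\<^sub>0\<close> itself, and using Young's inequality in the other
  direction, one gets
  \<open>(p - 1) \<integral> (1 - \<sigma> powr (- 1 / (p - 1))) |\<nabla>u\<^sub>0|\<^sup>p \<le> ((\<Lambda>\<^sub>\<sigma> - \<Lambda>\<^sub>1) u\<^sub>0, u\<^sub>0) \<le> \<integral> (\<sigma> - 1) |\<nabla>u\<^sub>0|\<^sup>p\<close>.
  For a Wolff solution \<open>|\<nabla>u\<^sub>0|\<^sup>p\<close> is comparable to \<open>\<tau>\<^sup>p exp (p \<tau> (x \<bullet> \<rho> - t))\<close>, so the indicator function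
  is comparable to \<open>\<tau>\<^sup>n\<close> times the integral of this exponential over \<open>D\<close>. A boundary point of \<open>D\<close> at
  which \<open>x \<bullet> \<rho>\<close> is maximal is the vertex of a cone inside \<open>D\<close>, which gives the lower bound at
  \<open>t = h\<^sub>D(\<rho>)\<close>.

  Existence of minimizers does not use weak compactness: by uniform convexity the gradients of a
  minimizing sequence converge strongly in \<open>L\<^sup>p\<close>.
\<close>


section \<open>Elementary inequalities for powers of the norm\<close>

text \<open>\<open>weak_grad\<close> and \<open>DN_map\<close> select representatives with
  \<open>SOME\<close>, so nothing can be computed from them until weak gradients are known to be
  unique almost everywhere and the Dirichlet problem is known to have a solution; most of the
  development serves these two facts. Solutions with the same boundary values are compared only
  through their energies, each being minimal.

  Young's inequality is weighted so that the energy of the \<open>\<sigma>\<close>-solution appears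
  with exactly the weight \<open>\<sigma>\<close>; this produces the factor
  \<open>\<sigma> powr (- (1 / (p - 1)))\<close> on the other side. Since \<open>\<sigma>\<close> is
  1 off \<open>D\<close> and exceeds 1 by a fixed amount on \<open>D\<close>, both integrands live
  on \<open>D\<close> and have constant bounds there relative to the p-th power of the gradient of
  \<open>u\<^sub>0\<close>.

  The normalization by the power n - p of \<open>\<tau>\<close> leaves exactly the power n. It fits
  a cone: at the critical \<open>t\<close>, a ball at distance 1 / \<open>\<tau>\<close> from the
  vertex has volume of order 1 / \<open>\<tau> ^ n\<close>, and the exponential is bounded below on
  it, so the product stays away from 0.\<close>

lemma grad_eqI: "GDERIV f x :> G \<Longrightarrow> grad f x = G"
proof (unfold grad_def, rule the_equality)
  fix H assume "GDERIV f x :> G" "GDERIV f x :> H"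
  then have "(\<lambda>h. h \<bullet> G) = (\<lambda>h. h \<bullet> H)"
    unfolding gderiv_def by (rule has_derivative_unique)
  then show "H = G"
    by (metis vector_eq_rdot inner_commute)
qed

lemma GDERIV_grad:
  fixes f :: "'a::euclidean_space \<Rightarrow> real"
  assumes "f differentiable at x"
  shows "GDERIV f x :> grad f x"
proof -
  from assms obtain f' where f': "(f has_derivative f') (at x)"
    by (auto simp: differentiable_def)
  interpret linear f' using f' by (rule has_derivative_linear)
  have "f' h = h \<bullet> adjoint f' 1" for h
    using adjoint_works[OF linear_axioms, of h 1] by simp
  then have "f' = (\<lambda>h. h \<bullet> adjoint f' 1)" by auto
  then have "GDERIV f x :> adjoint f' 1" using f' unfolding gderiv_def by metis
  then show ?thesis using grad_eqI by metis
qed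

lemma has_derivative_grad:
  fixes f :: "'a::euclidean_space \<Rightarrow> real"
  assumes "f differentiable at x"
  shows "(f has_derivative (\<lambda>h. h \<bullet> grad f x)) (at x)"
  using GDERIV_grad[OF assms] by (simp add: gderiv_def)

text \<open>After division by \<open>s powr p\<close> only \<open>w = t / s\<close> remains, and
  \<open>w powr p - p * w\<close> has its strict minimum at \<open>w = 1\<close>, by the mean value
  theorem on either side. Strictness is what later makes the midpoint inequality strict.\<close>

lemma Young_powr_strict:
  fixes p s t :: real
  assumes p: "1 < p" and s: "0 \<le> s" and t: "0 \<le> t" and ne: "s \<noteq> t"
  shows "p * s powr (p - 1) * t < (p - 1) * s powr p + t powr p"
proof (cases "s = 0")
  case True
  then show ?thesis using p t ne by simp
next
  case False
  with s have s: "s > 0" by simp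
  have W: "p * w < (p - 1) + w powr p" if w: "0 \<le> w" "w \<noteq> 1" for w
  proof (cases "w = 0")
    case True then show ?thesis using p by simp
  next
    case False
    with w have w: "w > 0" "w \<noteq> 1" by auto
    let ?f = "\<lambda>x. x powr p - p * x"
    have D: "DERIV ?f x :> p * (x powr (p - 1) - 1)" if "x > 0" for x
      using that by (auto intro!: derivative_eq_intros simp: algebra_simps)
    consider "w < 1" | "w > 1" using w by linarith
    then have "?f w > ?f 1"
    proof cases
      case 1
      have "\<exists>z. w < z \<and> z < 1 \<and> ?f 1 - ?f w = (1 - w) * (p * (z powr (p - 1) - 1))"
        by (rule MVT2) (use 1 w in \<open>auto intro!: D\<close>)
      then obtain z where z: "w < z" "z < 1" "?f 1 - ?f w = (1 - w) * (p * (z powr (p - 1) - 1))"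
        by blast
      have "z powr (p - 1) < 1" using z w p powr_less_mono2[of "p - 1" z 1] by simp
      then have "(1 - w) * (p * (z powr (p - 1) - 1)) < 0" using 1 p by (simp add: mult_pos_neg)
      with z show ?thesis by linarith
    next
      case 2
      have "\<exists>z. 1 < z \<and> z < w \<and> ?f w - ?f 1 = (w - 1) * (p * (z powr (p - 1) - 1))"
        by (rule MVT2) (use 2 in \<open>auto intro!: D\<close>)
      then obtain z where z: "1 < z" "z < w" "?f w - ?f 1 = (w - 1) * (p * (z powr (p - 1) - 1))"
        by blast
      have "z powr (p - 1) > 1" using z p by simp
      then have "(w - 1) * (p * (z powr (p - 1) - 1)) > 0" using 2 p by simp
      with z show ?thesis by linarith
    qed
    then show ?thesis using p by simp
  qed
  have "p * (t / s) < (p - 1) + (t / s) powr p" using W[of "t / s"] s t ne by auto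
  then have "s powr p * (p * (t / s)) < s powr p * ((p - 1) + (t / s) powr p)"
    using s by (intro mult_strict_left_mono) auto
  moreover have "s powr p = s powr (p - 1) * s" using s by (simp add: powr_diff)
  moreover have "s powr p * (t / s) powr p = t powr p"
    using s t by (simp add: powr_divide)
  ultimately show ?thesis using s by (simp add: algebra_simps)
qed

lemma Young_powr:
  fixes p s t :: real
  assumes "1 < p" "0 \<le> s" "0 \<le> t"
  shows "p * s powr (p - 1) * t \<le> (p - 1) * s powr p + t powr p"
proof (cases "s = t")
  case True
  have "t powr p = t powr (p - 1) * t" using assms by (cases "t = 0") (auto simp: powr_diff)
  then show ?thesis using True by (simp add: algebra_simps)
next
  case False
  then show ?thesis using Young_powr_strict[OF assms] by simp
qed

text \<open>Young's inequality for rescaled arguments: the powers of \<open>\<sigma>\<close> cancel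
  in \<open>?s powr (p - 1) * ?t\<close>, while \<open>t powr p\<close> receives the weight
  \<open>\<sigma>\<close>. This forces the exponent \<open>- (1 / (p - 1))\<close> on the other
  term.\<close>

lemma Young_powr_weighted:
  fixes p s t \<sigma> :: real
  assumes p: "1 < p" and s: "0 \<le> s" and t: "0 \<le> t" and \<sigma>: "0 < \<sigma>"
  shows "p * s powr (p - 1) * t \<le> (p - 1) * \<sigma> powr (- (1 / (p - 1))) * s powr p + \<sigma> * t powr p"
proof -
  let ?s = "\<sigma> powr (- 1 / (p * (p - 1))) * s" and ?t = "\<sigma> powr (1 / p) * t"
  have "?s powr (p - 1) = \<sigma> powr (- 1 / p) * s powr (p - 1)"
    using p s \<sigma> by (simp add: powr_mult powr_powr)
  then have 1: "?s powr (p - 1) * ?t = s powr (p - 1) * t"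
    using \<sigma> by (simp add: powr_minus_divide)
  have 2: "?s powr p = \<sigma> powr (- (1 / (p - 1))) * s powr p"
    using p s \<sigma> by (simp add: powr_mult powr_powr)
  have 3: "?t powr p = \<sigma> * t powr p"
    using p t \<sigma> by (simp add: powr_mult powr_powr)
  have "p * ?s powr (p - 1) * ?t \<le> (p - 1) * ?s powr p + ?t powr p"
    using p s t \<sigma> by (intro Young_powr) auto
  then have "p * (?s powr (p - 1) * ?t) \<le> (p - 1) * ?s powr p + ?t powr p" by (simp only: mult.assoc)
  then show ?thesis unfolding 1 2 3 by (simp add: mult.assoc)
qed

text \<open>The smaller of \<open>t\<close> and \<open>\<epsilon> * s\<close> is replaced by the
  larger. The free parameter permits absorption of one term in the Poincare inequality and the limit
  \<open>\<epsilon> \<rightarrow> 0\<close> in density arguments.\<close>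

lemma powr_mult_le_eps:
  fixes p s t \<epsilon> :: real
  assumes p: "1 < p" and s: "0 \<le> s" and t: "0 \<le> t" and e: "0 < \<epsilon>"
  shows "s powr (p - 1) * t \<le> \<epsilon> * s powr p + \<epsilon> powr (1 - p) * t powr p"
proof (cases "t \<le> \<epsilon> * s")
  case True
  have "s powr (p - 1) * t \<le> s powr (p - 1) * (\<epsilon> * s)" using True by (intro mult_left_mono) auto
  also have "\<dots> = \<epsilon> * s powr p" using s by (cases "s = 0") (auto simp: powr_diff)
  finally show ?thesis by (simp add: add_increasing2)
next
  case False
  then have "s \<le> t / \<epsilon>" using e by (simp add: field_simps)
  then have "s powr (p - 1) * t \<le> (t / \<epsilon>) powr (p - 1) * t"
    using p s t by (intro mult_right_mono powr_mono2) auto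
  also have "\<dots> = \<epsilon> powr (1 - p) * t powr p"
    using e t by (cases "t = 0") (auto simp: powr_diff powr_divide field_simps)
  finally show ?thesis using e by (simp add: add_increasing)
qed

text \<open>On a set of finite measure this plays the part of Hoelder's inequality: integrated, it
  bounds an L^1 norm by a small constant plus a multiple of the integral of the p-th power.\<close>

lemma le_eps_plus_powr:
  fixes p x \<epsilon> :: real
  assumes p: "1 \<le> p" and x: "0 \<le> x" and e: "0 < \<epsilon>"
  shows "x \<le> \<epsilon> + \<epsilon> powr (1 - p) * x powr p"
proof (cases "x \<le> \<epsilon>")
  case True then show ?thesis by (simp add: add_increasing2)
next
  case False
  then have "x = x powr (1 - p) * x powr p" using e by (simp flip: powr_add)
  also have "\<dots> \<le> \<epsilon> powr (1 - p) * x powr p"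
    using False e p by (intro mult_right_mono powr_mono2') auto
  finally show ?thesis using e by simp
qed

text \<open>Convexity of the p-th power, with \<open>x + y\<close> seen as the combination of
  \<open>x / (1 - t)\<close> and \<open>y / t\<close> with weights \<open>1 - t\<close> and
  \<open>t\<close>. The factor of \<open>norm x powr p\<close> tends to 1 as \<open>t\<close> tends
  to 0, which later gives continuity of the energy.\<close>

lemma norm_add_powr_le:
  fixes x y :: "'a::real_normed_vector"
  assumes p: "1 < p" and t: "0 < t" "t < 1"
  shows "norm (x + y) powr p \<le> (1 - t) powr (1 - p) * norm x powr p + t powr (1 - p) * norm y powr p"
proof -
  define z where "z = norm (x + y)"
  define a where "a = norm x / (1 - t)"
  define b where "b = norm y / t"
  have ab: "0 \<le> a" "0 \<le> b" "0 \<le> z" using t by (auto simp: a_def b_def z_def)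
  have "z \<le> (1 - t) * a + t * b" using norm_triangle_ineq[of x y] t by (simp add: z_def a_def b_def)
  then have "p * z powr (p - 1) * z \<le> p * z powr (p - 1) * ((1 - t) * a + t * b)"
    using p by (intro mult_left_mono) auto
  also have "\<dots> = (1 - t) * (p * z powr (p - 1) * a) + t * (p * z powr (p - 1) * b)"
    by (simp add: algebra_simps)
  also have "\<dots> \<le> (1 - t) * ((p - 1) * z powr p + a powr p) + t * ((p - 1) * z powr p + b powr p)"
    using t Young_powr[OF p ab(3) ab(1)] Young_powr[OF p ab(3) ab(2)]
    by (intro add_mono mult_left_mono) auto
  finally have "p * (z powr (p - 1) * z) \<le> (p - 1) * z powr p + (1 - t) * a powr p + t * b powr p"
    by (simp add: algebra_simps)
  moreover have "z powr (p - 1) * z = z powr p" using ab by (cases "z = 0") (auto simp: powr_diff)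
  ultimately have "z powr p \<le> (1 - t) * a powr p + t * b powr p" by (simp add: algebra_simps)
  also have "(1 - t) * a powr p = (1 - t) powr (1 - p) * norm x powr p"
    using t by (simp add: a_def powr_divide powr_diff)
  also have "t * b powr p = t powr (1 - p) * norm y powr p"
    using t by (simp add: b_def powr_divide powr_diff)
  finally show ?thesis by (simp add: z_def)
qed

lemma norm_add_powr_le2:
  fixes x y :: "'a::real_normed_vector"
  assumes p: "1 < p"
  shows "norm (x + y) powr p \<le> 2 powr p * (norm x powr p + norm y powr p)"
proof -
  have *: "(1 / 2::real) powr (1 - p) \<le> 2 powr p"
    by (simp add: powr_divide powr_diff)
  have "norm (x + y) powr p \<le> (1 / 2) powr (1 - p) * (norm x powr p + norm y powr p)"
    using norm_add_powr_le[OF p, of "1/2" x y] by (simp add: algebra_simps)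
  also have "\<dots> \<le> 2 powr p * (norm x powr p + norm y powr p)"
    using * by (intro mult_right_mono) auto
  finally show ?thesis .
qed

section \<open>Continuity and pairing estimates for the p-flux\<close>

lemma continuous_on_norm_powr [continuous_intros]:
  "0 < p \<Longrightarrow> continuous_on S f \<Longrightarrow> continuous_on S (\<lambda>x. norm (f x :: 'a::real_normed_vector) powr p)"
  by (intro continuous_on_powr' continuous_intros) auto

lemma norm_p_flux: "norm (p_flux p v) = norm v powr (p - 1)"
  by (cases "v = 0") (auto simp: p_flux_def powr_diff power2_eq_square)

lemma p_flux_inner_self: "p_flux p v \<bullet> v = norm v powr p"
  by (cases "v = 0") (auto simp: p_flux_def powr_diff power2_norm_eq_inner[symmetric])

lemma isCont_p_flux:
  fixes v :: "'a::euclidean_space"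
  assumes p: "1 < p"
  shows "isCont (p_flux p) v"
proof (cases "v = 0")
  case True
  have "((\<lambda>x::'a. norm x powr (p - 1)) \<longlongrightarrow> 0 powr (p - 1)) (at 0)"
    using p by (intro tendsto_powr' tendsto_eq_intros) auto
  then have "((\<lambda>x. norm (p_flux p x)) \<longlongrightarrow> 0) (at (0::'a))"
    by (simp add: norm_p_flux)
  then have "(p_flux p \<longlongrightarrow> 0) (at (0::'a))" by (rule tendsto_norm_zero_cancel)
  moreover have "p_flux p (0::'a) = 0" by (simp add: p_flux_def)
  ultimately show ?thesis using True by (simp add: isCont_def)
next
  case False
  then show ?thesis unfolding p_flux_def
    by (intro continuous_intros) auto
qed

lemma continuous_on_p_flux: "1 < p \<Longrightarrow> continuous_on S (p_flux p)"
  by (meson isCont_p_flux continuous_at_imp_continuous_on)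

lemma abs_p_flux_inner_le: "\<bar>p_flux p x \<bullet> y\<bar> \<le> norm x powr (p - 1) * norm y"
  using Cauchy_Schwarz_ineq2[of "p_flux p x" y] by (simp add: norm_p_flux)

text \<open>The tangent inequality at \<open>x\<close> for the convex function |y|^p, with
  \<open>p_flux p x \<bullet> x = norm x powr p\<close> already inserted. It yields the minimality
  of weak solutions and, based at a perturbed point, the Euler-Lagrange equation.\<close>

lemma p_flux_inner_le:
  assumes "1 < p"
  shows "p * (p_flux p x \<bullet> y) \<le> (p - 1) * norm x powr p + norm y powr p"
proof -
  have "p * (p_flux p x \<bullet> y) \<le> p * (norm x powr (p - 1) * norm y)"
    using abs_p_flux_inner_le[of p x y] assms by (intro mult_left_mono) auto
  also have "\<dots> \<le> (p - 1) * norm x powr p + norm y powr p"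
    using Young_powr[OF assms, of "norm x" "norm y"] by (simp add: mult.assoc)
  finally show ?thesis .
qed

text \<open>The strict convexity of \<open>|x|\<^sup>p\<close> becomes uniform by compactness and homogeneity; this
  replaces Clarkson's inequalities and treats all exponents \<open>p > 1\<close> at once.\<close>

lemma norm_powr_midpoint:
  fixes a b :: "'a::real_inner"
  assumes p: "1 < p"
  shows "norm ((1/2) *\<^sub>R (a + b)) powr p \<le> (norm a powr p + norm b powr p) / 2"
    and "a \<noteq> b \<Longrightarrow> norm ((1/2) *\<^sub>R (a + b)) powr p < (norm a powr p + norm b powr p) / 2"
proof -
  define s where "s = norm ((1/2) *\<^sub>R (a + b))"
  have s: "0 \<le> s" "2 * s \<le> norm a + norm b"
    using norm_triangle_ineq[of a b] by (auto simp: s_def)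
  have sp: "s powr (p - 1) * s = s powr p" using s by (cases "s = 0") (auto simp: powr_diff)
  have "p * s powr (p - 1) * (2 * s) \<le> p * s powr (p - 1) * (norm a + norm b)"
    using s p by (intro mult_left_mono) auto
  then have 1: "2 * p * s powr p \<le> p * s powr (p - 1) * norm a + p * s powr (p - 1) * norm b"
    unfolding sp[symmetric] by (simp add: algebra_simps)
  have 2: "p * s powr (p - 1) * norm a \<le> (p - 1) * s powr p + norm a powr p"
          "p * s powr (p - 1) * norm b \<le> (p - 1) * s powr p + norm b powr p"
    using s p by (auto intro!: Young_powr)
  show "norm ((1/2) *\<^sub>R (a + b)) powr p \<le> (norm a powr p + norm b powr p) / 2"
    unfolding s_def[symmetric] using 1 2 by (simp add: algebra_simps)
  assume "a \<noteq> b"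
  show "norm ((1/2) *\<^sub>R (a + b)) powr p < (norm a powr p + norm b powr p) / 2"
  \<comment> \<open>Strict Young is available as soon as one of the two norms differs from
    \<open>s\<close>. If all three agree, the parallelogram law forces \<open>a = b\<close>.\<close>
  proof (cases "s = norm a \<and> s = norm b")
    case True
    have "(norm (a - b))\<^sup>2 + (norm (a + b))\<^sup>2 = 2 * (norm a)\<^sup>2 + 2 * (norm b)\<^sup>2"
      by (simp add: power2_norm_eq_inner inner_add inner_diff inner_commute algebra_simps)
    moreover have "norm (a + b) = 2 * s" by (simp add: s_def)
    moreover have "norm a = s" "norm b = s" using True by auto
    ultimately have "(norm (a - b))\<^sup>2 = 0" by (simp add: power2_eq_square)
    with \<open>a \<noteq> b\<close> show ?thesis by simp
  next
    case False
    then have "p * s powr (p - 1) * norm a + p * s powr (p - 1) * norm b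
        < ((p - 1) * s powr p + norm a powr p) + ((p - 1) * s powr p + norm b powr p)"
      using Young_powr_strict[OF p s(1), of "norm a"] Young_powr_strict[OF p s(1), of "norm b"] 2
      by (meson add_le_less_mono add_less_le_mono norm_ge_zero)
    then show ?thesis unfolding s_def[symmetric] using 1 by (simp add: algebra_simps)
  qed
qed

lemma norm_powr_uniformly_convex:
  fixes p \<epsilon> :: real
  assumes p: "1 < p" and e: "0 < \<epsilon>"
  shows "\<exists>C>0. \<forall>a b :: 'a::euclidean_space. norm (a - b) powr p \<le>
     \<epsilon> * (norm a powr p + norm b powr p) +
     C * ((norm a powr p + norm b powr p) / 2 - norm ((1/2) *\<^sub>R (a + b)) powr p)"
proof -
  \<comment> \<open>\<open>K\<close> holds the normalized pairs that the \<open>\<epsilon>\<close>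
    term need not cover by itself. It is compact and avoids the diagonal, so the convexity deficit
    \<open>F\<close> has a positive lower bound \<open>m\<close> on it.\<close>
  define K :: "('a \<times> 'a) set" where
    "K = {z. norm (fst z) powr p + norm (snd z) powr p = 1} \<inter> {z. \<epsilon> \<le> norm (fst z - snd z) powr p}"
  define F :: "'a \<times> 'a \<Rightarrow> real" where
    "F z = (norm (fst z) powr p + norm (snd z) powr p) / 2 - norm ((1/2) *\<^sub>R (fst z + snd z)) powr p" for z
  have F0: "0 \<le> F z" for z
    using norm_powr_midpoint(1)[OF p, of "fst z" "snd z"] by (simp add: F_def)
  have Kp: "0 < F z" if "z \<in> K" for z
  proof -
    have "fst z \<noteq> snd z" using that e p by (auto simp: K_def)
    then show ?thesis using norm_powr_midpoint(2)[OF p, of "fst z" "snd z"] by (simp add: F_def)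
  qed
  have "closed K"
    unfolding K_def using p
    by (intro closed_Int closed_Collect_eq closed_Collect_le continuous_intros) auto
  moreover have "bounded K"
  proof (rule boundedI[where B = 2])
    fix z assume "z \<in> K"
    then have "norm (fst z) powr p + norm (snd z) powr p = 1" by (simp add: K_def)
    then have "norm (fst z) powr p \<le> 1 powr p" "norm (snd z) powr p \<le> 1 powr p"
      using powr_ge_zero[of "norm (fst z)" p] powr_ge_zero[of "norm (snd z)" p] unfolding powr_one_eq_one by linarith+
    then have "norm (fst z) \<le> 1" "norm (snd z) \<le> 1"
      using p powr_mono2[of "1 / p" "norm (fst z) powr p" 1] powr_mono2[of "1 / p" "norm (snd z) powr p" 1]
      by (auto simp: powr_powr)
    then show "norm z \<le> 2" using norm_Pair_le[of "fst z" "snd z"] by simp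
  qed
  ultimately have K: "compact K" by (simp add: compact_eq_bounded_closed)
  have "\<exists>m>0. \<forall>z\<in>K. m \<le> F z"
  proof (cases "K = {}")
    case True then show ?thesis by (auto intro: exI[of _ 1])
  next
    case False
    have "continuous_on K F" unfolding F_def using p by (intro continuous_intros) auto
    from continuous_attains_inf[OF K False this] Kp show ?thesis by metis
  qed
  then obtain m where m: "m > 0" "\<And>z. z \<in> K \<Longrightarrow> m \<le> F z" by auto
  show ?thesis
  \<comment> \<open>For a pair that scales into \<open>K\<close>, the bound
    \<open>m \<le> F (a, b) / r\<close> and the crude estimate
    \<open>norm (a - b) powr p \<le> 2 powr p * r\<close> combine to this constant.\<close>
  proof (intro exI[of _ "2 powr p / m"] conjI allI)
    show "2 powr p / m > 0" using m by simp
    fix a b :: 'a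
    define r where "r = norm a powr p + norm b powr p"
    have r0: "0 \<le> r" by (simp add: r_def)
    have goal: "norm (a - b) powr p \<le> \<epsilon> * r + 2 powr p / m * F (a, b)"
    proof (cases "r = 0")
      case True
      then have "norm a powr p = 0" "norm b powr p = 0"
        unfolding r_def using powr_ge_zero[of "norm a" p] powr_ge_zero[of "norm b" p] by linarith+
      then have "a = 0" "b = 0" by auto
      then show ?thesis using True F0[of "(a, b)"] m by simp
    next
      case False
      with r0 have r: "0 < r" by simp
      \<comment> \<open>Scaling by \<open>k\<close> makes the p-th powers of the two norms add up to
        1. All terms of the claim are homogeneous of degree \<open>p\<close>, so nothing is
        lost.\<close>
      define k where "k = r powr (- (1 / p))"
      have k: "k > 0" using r by (simp add: k_def)
      have kp: "k powr p = 1 / r" unfolding k_def powr_powr using r p by (simp add: powr_minus_divide)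
      have sc: "norm (k *\<^sub>R x) powr p = norm x powr p / r" for x :: 'a
        using k kp by (simp add: powr_mult)
      have sF: "F (k *\<^sub>R a, k *\<^sub>R b) = F (a, b) / r"
      proof -
        have "norm ((1/2) *\<^sub>R (k *\<^sub>R a + k *\<^sub>R b)) powr p = norm (k *\<^sub>R ((1/2) *\<^sub>R (a + b))) powr p"
          by (simp add: algebra_simps)
        then show ?thesis unfolding F_def fst_conv snd_conv sc by (simp only: sc diff_divide_distrib add_divide_distrib) (simp add: field_simps)
      qed
      show ?thesis
      proof (cases "\<epsilon> * r \<le> norm (a - b) powr p")
        case True
        have "norm (k *\<^sub>R a) powr p + norm (k *\<^sub>R b) powr p = 1"
          unfolding sc using r by (simp add: r_def flip: add_divide_distrib)
        moreover have "\<epsilon> \<le> norm (k *\<^sub>R a - k *\<^sub>R b) powr p"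
          using True r sc[of "a - b"] by (simp add: scaleR_diff_right pos_le_divide_eq)
        ultimately have "(k *\<^sub>R a, k *\<^sub>R b) \<in> K" by (simp add: K_def)
        then have "m \<le> F (a, b) / r" using m sF by metis
        then have 1: "r \<le> F (a, b) / m" using r m by (simp add: field_simps)
        have "norm (a - b) powr p \<le> 2 powr p * r"
          using norm_add_powr_le2[OF p, of a "- b"] by (simp add: r_def)
        also have "\<dots> \<le> 2 powr p * (F (a, b) / m)" using 1 by (intro mult_left_mono) auto
        finally show ?thesis using e r by (simp add: add_increasing)
      next
        case False
        then show ?thesis using F0[of "(a, b)"] m by (simp add: add_increasing2)
      qed
    qed
    then show "norm (a - b) powr p \<le> \<epsilon> * (norm a powr p + norm b powr p) +
     2 powr p / m * ((norm a powr p + norm b powr p) / 2 - norm ((1/2) *\<^sub>R (a + b)) powr p)"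
      by (simp add: r_def F_def)
  qed
qed


section \<open>Smooth functions and test functions\<close>

lemma C_diff_Suc_imp: "C_diff (Suc k) f \<Longrightarrow> C_diff k f"
proof (induction k arbitrary: f)
  case 0
  then show ?case
    by (auto intro!: continuous_at_imp_continuous_on differentiable_imp_continuous_within)
next
  case (Suc k)
  show ?case unfolding C_diff.simps(2)[of k f]
    using Suc.prems Suc.IH unfolding C_diff.simps(2)[of "Suc k" f] by blast
qed

lemma C_diff_const: "C_diff k (\<lambda>_. c)"
proof (induction k arbitrary: c)
  case (Suc k)
  have "grad (\<lambda>_::'a. c) x = 0" for x by (intro grad_eqI GDERIV_const)
  then show ?case using Suc by simp
qed simp

lemma C_diff_add: "C_diff k f \<Longrightarrow> C_diff k g \<Longrightarrow> C_diff k (\<lambda>x. f x + g x)"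
proof (induction k arbitrary: f g)
  case (Suc k)
  then have "grad (\<lambda>x. f x + g x) x = grad f x + grad g x" for x
    by (intro grad_eqI GDERIV_add GDERIV_grad) auto
  then show ?case using Suc by (auto simp: inner_add_left)
qed (auto intro: continuous_intros)

lemma C_diff_mult: "C_diff k f \<Longrightarrow> C_diff k g \<Longrightarrow> C_diff k (\<lambda>x. f x * g x)"
proof (induction k arbitrary: f g)
  case (Suc k)
  then have D: "f differentiable at x" "g differentiable at x" for x by auto
  have G: "grad (\<lambda>x. f x * g x) x = f x *\<^sub>R grad g x + g x *\<^sub>R grad f x" for x
    by (intro grad_eqI GDERIV_mult GDERIV_grad D)
  have "C_diff k f" "C_diff k g" using Suc.prems C_diff_Suc_imp by auto
  then have "C_diff k (\<lambda>x. f x * (grad g x \<bullet> b) + g x * (grad f x \<bullet> b))" if "b \<in> Basis" for b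
    using Suc that by (intro C_diff_add Suc.IH) auto
  then show ?case using D by (auto simp: G inner_add_left intro: differentiable_mult)
qed (auto intro: continuous_intros)

lemma C_diff_prod: "finite A \<Longrightarrow> (\<And>i. i \<in> A \<Longrightarrow> C_diff k (f i)) \<Longrightarrow> C_diff k (\<lambda>x. \<Prod>i\<in>A. f i x)"
  by (induction A rule: finite_induct) (auto intro: C_diff_const C_diff_mult)

lemma smoothD:
  assumes "smooth f"
  shows "f differentiable at x" "continuous_on S f" "continuous_on S (grad f)"
    "b \<in> Basis \<Longrightarrow> smooth (\<lambda>x. grad f x \<bullet> b)"
proof -
  have *: "C_diff k f" for k using assms by (simp add: smooth_def)
  show "f differentiable at x" using *[of 1] by simp
  show "continuous_on S f" using *[of 0] continuous_on_subset by auto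
  show "b \<in> Basis \<Longrightarrow> smooth (\<lambda>x. grad f x \<bullet> b)" using *[of "Suc k" for k] by (simp add: smooth_def)
  show "continuous_on S (grad f)"
    using *[of "Suc 0"] by (subst continuous_on_componentwise) (auto intro: continuous_on_subset)
qed

text \<open>The powers in the denominator make the family closed under differentiation: the
  derivative of one member is a combination of the next two, so smoothness is a single induction,
  for all \<open>m\<close> at once.\<close>

definition flat_exp :: "nat \<Rightarrow> real \<Rightarrow> real" where
  "flat_exp m s = (if 0 < s then exp (- 1 / s) / s ^ m else 0)"

lemma flat_exp_tendsto_0: "(flat_exp m \<longlongrightarrow> 0) (at 0)"
proof -
  have "((\<lambda>x. inverse x ^ m / exp (inverse x)) \<longlongrightarrow> 0) (at_right (0::real))"
    by (rule filterlim_compose[OF tendsto_power_div_exp_0 filterlim_inverse_at_top_right])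
  then have "(flat_exp m \<longlongrightarrow> 0) (at_right 0)"
    by (rule Lim_transform_eventually)
      (auto simp: flat_exp_def eventually_at_filter exp_minus field_simps intro!: always_eventually)
  moreover have "(flat_exp m \<longlongrightarrow> 0) (at_left 0)"
    by (rule Lim_transform_eventually[OF tendsto_const])
      (auto simp: flat_exp_def eventually_at_filter intro!: always_eventually)
  ultimately show ?thesis by (simp add: filterlim_split_at)
qed

lemma DERIV_flat_exp:
  "DERIV (flat_exp m) s :> flat_exp (m + 2) s - real m * flat_exp (m + 1) s"
proof -
  consider "s > 0" | "s < 0" | "s = 0" by linarith
  then show ?thesis
  proof cases
    case 1
    have P: "DERIV (\<lambda>s. s ^ m) s :> real m * s ^ m / s"
      using DERIV_power[OF DERIV_ident, of m s UNIV] 1 by (cases m) auto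
    have "DERIV (\<lambda>s. exp (- 1 / s)) s :> exp (- 1 / s) / s\<^sup>2"
      using 1 by (auto intro!: derivative_eq_intros simp: power2_eq_square)
    from DERIV_divide[OF this P]
    have "DERIV (\<lambda>s. exp (- 1 / s) / s ^ m) s :> flat_exp (m + 2) s - real m * flat_exp (m + 1) s"
      by (rule DERIV_cong) (use 1 in \<open>auto simp: flat_exp_def field_simps power2_eq_square\<close>)
    then show ?thesis
      by (rule has_field_derivative_transform_within_open[where S = "{0<..}"])
        (use 1 in \<open>auto simp: flat_exp_def\<close>)
  next
    case 2
    have "DERIV (\<lambda>_. 0) s :> flat_exp (m + 2) s - real m * flat_exp (m + 1) s"
      using 2 by (simp add: flat_exp_def)
    then show ?thesis
      by (rule has_field_derivative_transform_within_open[where S = "{..<0}"])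
        (use 2 in \<open>auto simp: flat_exp_def\<close>)
  next
    case 3
    \<comment> \<open>For nonzero \<open>h\<close> this quotient is
      \<open>flat_exp (Suc m) h\<close>, so the limit at 0 of the next member of the family
      applies.\<close>
    have "((\<lambda>h. (flat_exp m (0 + h) - flat_exp m 0) / h) \<longlongrightarrow> 0) (at 0)"
      by (rule Lim_transform_eventually[OF flat_exp_tendsto_0[of "Suc m"]])
        (auto simp: flat_exp_def eventually_at_filter intro!: always_eventually)
    then show ?thesis using 3 by (simp add: DERIV_def flat_exp_def)
  qed
qed

lemma C_diff_flat_exp: "C_diff k (\<lambda>x::'a::euclidean_space. flat_exp m (x \<bullet> v + c))"
proof (induction k arbitrary: m)
  case 0
  have "continuous_on UNIV (flat_exp m)"
    by (meson DERIV_flat_exp DERIV_isCont continuous_at_imp_continuous_on)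
  then have "continuous_on UNIV (\<lambda>x::'a. flat_exp m (x \<bullet> v + c))"
    by (rule continuous_on_compose2) (auto intro!: continuous_intros)
  then show ?case by simp
next
  case (Suc k)
  let ?d = "\<lambda>s. flat_exp (m + 2) s - real m * flat_exp (m + 1) s"
  have "GDERIV (\<lambda>x::'a. x \<bullet> v + c) x :> v" for x
    unfolding gderiv_def by (auto intro!: derivative_eq_intros)
  then have G: "GDERIV (\<lambda>x::'a. flat_exp m (x \<bullet> v + c)) x :> ?d (x \<bullet> v + c) *\<^sub>R v" for x
    by (rule GDERIV_DERIV_compose) (rule DERIV_flat_exp)
  have "C_diff k (\<lambda>x::'a. (flat_exp (m + 2) (x \<bullet> v + c) + (- real m) * flat_exp (m + 1) (x \<bullet> v + c)) * (v \<bullet> b))" for b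
    by (intro C_diff_mult C_diff_add C_diff_const Suc.IH)
  moreover have "(\<lambda>x::'a. flat_exp m (x \<bullet> v + c)) differentiable (at x)" for x
    using G[of x] by (auto simp: gderiv_def differentiable_def)
  ultimately show ?case by (simp add: grad_eqI[OF G])
qed

lemma test_functions_iff:
  "\<phi> \<in> test_functions U \<longleftrightarrow> smooth \<phi> \<and> (\<exists>K. compact K \<and> K \<subseteq> U \<and> (\<forall>x. x \<notin> K \<longrightarrow> \<phi> x = 0))"
proof
  assume "\<phi> \<in> test_functions U"
  then show "smooth \<phi> \<and> (\<exists>K. compact K \<and> K \<subseteq> U \<and> (\<forall>x. x \<notin> K \<longrightarrow> \<phi> x = 0))"
    unfolding test_functions_def using closure_subset[of "{x. \<phi> x \<noteq> 0}"] by blast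
next
  assume "smooth \<phi> \<and> (\<exists>K. compact K \<and> K \<subseteq> U \<and> (\<forall>x. x \<notin> K \<longrightarrow> \<phi> x = 0))"
  then obtain K where K: "smooth \<phi>" "compact K" "K \<subseteq> U" "\<And>x. x \<notin> K \<Longrightarrow> \<phi> x = 0" by blast
  then have "{x. \<phi> x \<noteq> 0} \<subseteq> K" by blast
  then have c: "closure {x. \<phi> x \<noteq> 0} \<subseteq> K" using K(2) by (simp add: closure_minimal compact_imp_closed)
  then have "compact (closure {x. \<phi> x \<noteq> 0})"
    using K(2) by (metis closed_closure compact_Int_closed inf.absorb_iff2)
  then show "\<phi> \<in> test_functions U" using K c by (auto simp: test_functions_def)
qed

lemma test_functions_lincomb:
  assumes "\<phi> \<in> test_functions U" "\<psi> \<in> test_functions U"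
  shows "(\<lambda>x. c * \<phi> x + d * \<psi> x) \<in> test_functions U"
proof -
  from assms obtain K L where "compact K" "K \<subseteq> U" "\<And>x. x \<notin> K \<Longrightarrow> \<phi> x = 0"
    "compact L" "L \<subseteq> U" "\<And>x. x \<notin> L \<Longrightarrow> \<psi> x = 0" unfolding test_functions_iff by metis
  then have "compact (K \<union> L) \<and> K \<union> L \<subseteq> U \<and> (\<forall>x. x \<notin> K \<union> L \<longrightarrow> c * \<phi> x + d * \<psi> x = 0)" by auto
  moreover have "smooth (\<lambda>x. c * \<phi> x + d * \<psi> x)" using assms unfolding test_functions_iff smooth_def
    by (intro allI C_diff_add C_diff_mult C_diff_const) auto
  ultimately show ?thesis unfolding test_functions_iff by blast
qed

lemma grad_lincomb:
  fixes f g :: "'a::euclidean_space \<Rightarrow> real"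
  assumes "f differentiable at x" "g differentiable at x"
  shows "grad (\<lambda>x. c * f x + d * g x) x = c *\<^sub>R grad f x + d *\<^sub>R grad g x"
proof (rule grad_eqI)
  have "GDERIV (\<lambda>x. c * f x + d * g x) x :> (c *\<^sub>R grad f x + f x *\<^sub>R 0) + (d *\<^sub>R grad g x + g x *\<^sub>R 0)"
    by (intro GDERIV_add GDERIV_mult GDERIV_const GDERIV_grad assms)
  then show "GDERIV (\<lambda>x. c * f x + d * g x) x :> c *\<^sub>R grad f x + d *\<^sub>R grad g x" by simp
qed

lemma zero_test_function: "(\<lambda>_. 0) \<in> test_functions U"
  unfolding test_functions_iff smooth_def using C_diff_const by blast

lemma test_functionD:
  assumes "\<phi> \<in> test_functions U"
  obtains K where "smooth \<phi>" "compact K" "K \<subseteq> U" "\<And>x. x \<notin> K \<Longrightarrow> \<phi> x = 0" "\<And>x. x \<notin> K \<Longrightarrow> grad \<phi> x = 0"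
proof -
  from assms obtain K where K: "smooth \<phi>" "compact K" "K \<subseteq> U" "\<And>x. x \<notin> K \<Longrightarrow> \<phi> x = 0"
    unfolding test_functions_iff by metis
  have "grad \<phi> x = 0" if "x \<notin> K" for x
  proof (rule grad_eqI)
    have "((\<lambda>_. 0) has_derivative (\<lambda>h. h \<bullet> 0)) (at x)" by simp
    then show "GDERIV \<phi> x :> 0" unfolding gderiv_def
      by (rule has_derivative_transform_within_open[where s = "- K"])
        (use K that compact_imp_closed in auto)
  qed
  with K that show thesis by blast
qed

text \<open>A product of flat exponentials of the signed distances to all faces, multiplied by
  \<open>Suc k\<close>: a factor is 0 when its distance is not positive, and tends to 1 as
  \<open>k\<close> grows otherwise.\<close>

lemma box_indicator_approximation:
  fixes c d :: "'a::euclidean_space"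
  assumes "cbox c d \<subseteq> U"
  obtains \<phi> where "\<And>k::nat. \<phi> k \<in> test_functions U" "\<And>k x. \<bar>\<phi> k x\<bar> \<le> 1"
    "\<And>k x. x \<notin> box c d \<Longrightarrow> \<phi> k x = 0" "\<And>x. (\<lambda>k. \<phi> k x) \<longlonglongrightarrow> indicator (box c d) x"
proof
  \<comment> \<open>The sign \<open>s\<close> selects the lower face for 1 and the upper face for
    -1. The affine argument is written in the shape that \<open>C_diff_flat_exp\<close> expects;
    \<open>g1\<close> and \<open>g2\<close> give the readable forms.\<close>
  define g where "g b s k x = flat_exp 0 (x \<bullet> ((s * real (Suc k)) *\<^sub>R b) + - s * real (Suc k) * ((if s = 1 then c else d) \<bullet> b))"
    for b :: 'a and s :: real and k :: nat and x :: 'a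
  have g1: "g b 1 k x = flat_exp 0 (real (Suc k) * (x \<bullet> b - c \<bullet> b))" for b k x
    by (simp add: g_def algebra_simps)
  have g2: "g b (-1) k x = flat_exp 0 (real (Suc k) * (d \<bullet> b - x \<bullet> b))" for b k x
    by (simp add: g_def algebra_simps)
  define \<phi> where "\<phi> k x = (\<Prod>b\<in>Basis. g b 1 k x * g b (-1) k x)" for k x
  have flat01: "0 \<le> flat_exp 0 s" "flat_exp 0 s \<le> 1" for s by (auto simp: flat_exp_def)
  show z: "\<phi> k x = 0" if "x \<notin> box c d" for k x
  proof -
    from that obtain b where b: "b \<in> Basis" "x \<bullet> b \<le> c \<bullet> b \<or> d \<bullet> b \<le> x \<bullet> b"
      by (auto simp: mem_box not_less)
    then have "g b 1 k x * g b (-1) k x = 0"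
      unfolding g1 g2 by (auto simp: flat_exp_def zero_less_mult_iff)
    then show ?thesis using b(1) unfolding \<phi>_def by (intro prod_zero) auto
  qed
  show "\<phi> k \<in> test_functions U" for k
  proof -
    have "C_diff j (\<lambda>x. \<phi> k x)" for j unfolding \<phi>_def g_def
      by (intro C_diff_prod C_diff_mult C_diff_flat_exp finite_Basis)
    moreover have "\<forall>x. x \<notin> cbox c d \<longrightarrow> \<phi> k x = 0" using z box_subset_cbox by blast
    ultimately show ?thesis unfolding test_functions_iff smooth_def
      using assms compact_cbox[of c d] by metis
  qed
  show "\<bar>\<phi> k x\<bar> \<le> 1" for k x
  proof -
    have "0 \<le> g b 1 k x * g b (-1) k x" "g b 1 k x * g b (-1) k x \<le> 1" for b
      unfolding g1 g2 by (intro mult_nonneg_nonneg mult_le_one flat01)+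
    then have "0 \<le> \<phi> k x" "\<phi> k x \<le> 1" unfolding \<phi>_def
      by (simp_all only: prod_nonneg prod_le_1 ball_simps simp_thms)
    then show ?thesis by simp
  qed
  show "(\<lambda>k. \<phi> k x) \<longlonglongrightarrow> indicator (box c d) x" for x
  proof (cases "x \<in> box c d")
    case False then show ?thesis using z by simp
  next
    case True
    have F: "(\<lambda>k. flat_exp 0 (real (Suc k) * s)) \<longlonglongrightarrow> 1" if "s > 0" for s
    proof -
      have "(\<lambda>k. exp (- (1 / s) * inverse (real (Suc k)))) \<longlonglongrightarrow> exp (- (1 / s) * 0)"
        by (intro tendsto_intros LIMSEQ_inverse_real_of_nat)
      moreover have "exp (- (1 / s) * inverse (real (Suc k))) = flat_exp 0 (real (Suc k) * s)" for k
        using that mult_pos_pos[of "real (Suc k)" s] by (simp add: flat_exp_def field_simps)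
      ultimately show ?thesis by simp
    qed
    have "(\<lambda>k. \<phi> k x) \<longlonglongrightarrow> (\<Prod>b\<in>(Basis::'a set). 1 * 1)" unfolding \<phi>_def g1 g2
      using True by (intro tendsto_prod tendsto_mult F) (auto simp: mem_box)
    then show ?thesis using True by simp
  qed
qed


section \<open>Integration by parts and uniqueness of weak gradients\<close>

lemma integrable_compact_support:
  fixes f :: "'a::euclidean_space \<Rightarrow> 'b::euclidean_space"
  assumes "continuous_on UNIV f" "compact K" "\<And>x. x \<notin> K \<Longrightarrow> f x = 0"
  shows "integrable lborel f"
proof -
  have "integrable lborel (\<lambda>x. indicator K x *\<^sub>R f x)"
    using assms by (intro borel_integrable_compact continuous_on_subset[OF assms(1)]) auto
  moreover have "(\<lambda>x. indicator K x *\<^sub>R f x) = f" using assms(3) by (auto simp: indicator_def)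
  ultimately show ?thesis by simp
qed

text \<open>Lebesgue measure on \<open>U\<close> is a restriction of a completion, whereas
  translation invariance is used on \<open>lborel\<close>; this lets continuous compactly supported
  integrands move between the two.\<close>

lemma lebesgue_on_compact_support:
  fixes f :: "'a::euclidean_space \<Rightarrow> 'b::euclidean_space"
  assumes "continuous_on UNIV f" "compact K" "\<And>x. x \<notin> K \<Longrightarrow> f x = 0"
    and U: "U \<in> sets lebesgue" "K \<subseteq> U"
  shows "integrable (lebesgue_on U) f" "integral\<^sup>L (lebesgue_on U) f = integral\<^sup>L lborel f"
proof -
  have eq: "(\<lambda>x. indicator U x *\<^sub>R f x) = f" using assms(3) U by (force simp: indicator_def)
  have m: "f \<in> borel_measurable lborel" using borel_measurable_continuous_onI[OF assms(1)] by simp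
  show "integrable (lebesgue_on U) f"
    using integrable_compact_support[OF assms(1-3)] U m
    by (subst integrable_restrict_space) (auto simp: eq integrable_completion)
  show "integral\<^sup>L (lebesgue_on U) f = integral\<^sup>L lborel f"
    using U m by (subst integral_restrict_space) (auto simp: eq integral_completion)
qed

lemma lborel_integral_translate:
  fixes f :: "'a::euclidean_space \<Rightarrow> 'b::euclidean_space"
  assumes "f \<in> borel_measurable borel"
  shows "(LINT x|lborel. f (w + x)) = integral\<^sup>L lborel f"
proof -
  have "integral\<^sup>L lborel f = integral\<^sup>L (distr lborel borel ((+) w)) f" by (simp add: lborel_distr_plus)
  also have "\<dots> = (LINT x|lborel. f (w + x))"
    using assms by (intro integral_distr) auto
  finally show ?thesis ..
qed

text \<open>The difference quotients of \<open>f\<close> have integral \<open>0\<close> by translation invariance.\<close>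

lemma integral_directional_derivative_eq_0:
  fixes f :: "'a::euclidean_space \<Rightarrow> real"
  assumes f: "\<And>x. (f has_derivative f' x) (at x)"
    and c: "continuous_on UNIV (\<lambda>x. f' x v)"
    and K: "compact K" "\<And>x. x \<notin> K \<Longrightarrow> f x = 0"
  shows "(LINT x|lborel. f' x v) = 0"
proof -
  have f'0: "f' x v = 0" if "x \<notin> K" for x
  proof -
    have "((\<lambda>_. 0) has_derivative (\<lambda>_. 0)) (at x)" by simp
    then have "(f has_derivative (\<lambda>_. 0)) (at x)"
      by (rule has_derivative_transform_within_open[where s = "- K"])
        (use K that compact_imp_closed in auto)
    then show ?thesis using has_derivative_unique[OF f[of x]] by metis
  qed
  obtain M where M: "M \<ge> 0" "\<And>x. \<bar>f' x v\<bar> \<le> M"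
  proof -
    have "bounded ((\<lambda>x. f' x v) ` K)"
      by (intro compact_imp_bounded compact_continuous_image continuous_on_subset[OF c] K) auto
    then obtain B where B: "B > 0" "\<And>x. x \<in> K \<Longrightarrow> \<bar>f' x v\<bar> \<le> B" by (auto simp: bounded_pos)
    then have "\<bar>f' x v\<bar> \<le> B" for x using f'0[of x] by (cases "x \<in> K") auto
    with B(1) show thesis using that[of B] by auto
  qed
  obtain R where R: "\<And>x. x \<in> K \<Longrightarrow> norm x \<le> R" using compact_imp_bounded[OF K(1)] by (auto simp: bounded_iff)
  have cf: "continuous_on UNIV f"
    by (intro continuous_at_imp_continuous_on ballI has_derivative_continuous[OF f])
  have fm: "f \<in> borel_measurable borel" using cf by (rule borel_measurable_continuous_onI)
  have fi: "integrable lborel f" using integrable_compact_support[OF cf K] .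
  have line: "((\<lambda>t. f (x + t *\<^sub>R v)) has_real_derivative f' (x + t *\<^sub>R v) v) (at t)" for x t
  proof -
    have "((\<lambda>t. f (x + t *\<^sub>R v)) has_derivative (\<lambda>s. f' (x + t *\<^sub>R v) (s *\<^sub>R v))) (at t)"
      by (rule has_derivative_compose[OF _ f, of "\<lambda>t. x + t *\<^sub>R v" "\<lambda>s. s *\<^sub>R v"])
        (auto intro!: derivative_eq_intros)
    moreover have "f' (x + t *\<^sub>R v) (s *\<^sub>R v) = f' (x + t *\<^sub>R v) v * s" for s
      using linear_cmul[OF has_derivative_linear[OF f[of "x + t *\<^sub>R v"]]] by simp
    ultimately show ?thesis by (simp add: has_field_derivative_def)
  qed
  define e where "e k = inverse (real (Suc k))" for k
  have e: "0 < e k" "e k \<le> 1" for k by (auto simp: e_def inverse_le_1_iff)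
  define q where "q k x = (f (e k *\<^sub>R v + x) - f x) / e k" for k x
  have qi: "integral\<^sup>L lborel (q k) = 0" for k
  proof -
    have "integrable lborel (\<lambda>x. f (e k *\<^sub>R v + x))"
      using fi fm integrable_distr_eq[of "(+) (e k *\<^sub>R v)" lborel borel f]
      by (simp add: lborel_distr_plus)
    then show ?thesis unfolding q_def
      using fi lborel_integral_translate[OF fm, of "e k *\<^sub>R v"] by simp
  qed
  have "(\<lambda>k. integral\<^sup>L lborel (q k)) \<longlonglongrightarrow> (LINT x|lborel. f' x v)"
  proof (rule integral_dominated_convergence)
    show "(\<lambda>x. f' x v) \<in> borel_measurable lborel" using borel_measurable_continuous_onI[OF c] by simp
    show "q k \<in> borel_measurable lborel" for k unfolding q_def using fm by measurable
    \<comment> \<open>Since \<open>e k \<le> 1\<close>, every quotient \<open>q k\<close> vanishes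
      outside the ball of radius \<open>R + norm v\<close>; inside, the mean value theorem bounds it
      by \<open>M\<close>.\<close>
    show "integrable lborel (\<lambda>x. indicator (cball (0::'a) (R + norm v)) x *\<^sub>R M)"
      by (intro borel_integrable_compact) auto
    show "AE x in lborel. (\<lambda>k. q k x) \<longlonglongrightarrow> f' x v"
    proof (rule AE_I2)
      fix x :: 'a
      have "((\<lambda>h. (f (x + h *\<^sub>R v) - f x) / h) \<longlongrightarrow> f' x v) (at 0)"
        using line[of x 0] by (simp add: DERIV_def)
      moreover have "filterlim e (at 0) sequentially"
        unfolding e_def filterlim_at using LIMSEQ_inverse_real_of_nat by (auto simp: eventually_sequentially)
      ultimately have "(\<lambda>k. (f (x + e k *\<^sub>R v) - f x) / e k) \<longlonglongrightarrow> f' x v"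
        by (rule filterlim_compose)
      then show "(\<lambda>k. q k x) \<longlonglongrightarrow> f' x v" by (simp add: q_def add.commute)
    qed
    show "AE x in lborel. norm (q k x) \<le> indicator (cball (0::'a) (R + norm v)) x *\<^sub>R M" for k
    proof (rule AE_I2)
      fix x :: 'a
      show "norm (q k x) \<le> indicator (cball (0::'a) (R + norm v)) x *\<^sub>R M"
      proof (cases "norm x \<le> R + norm v")
        case True
        have "\<exists>z>0. z < e k \<and> f (x + e k *\<^sub>R v) - f (x + 0 *\<^sub>R v) = (e k - 0) * f' (x + z *\<^sub>R v) v"
          by (rule MVT2) (use line e in auto)
        then obtain z where "f (x + e k *\<^sub>R v) - f x = e k * f' (x + z *\<^sub>R v) v" by auto
        then have "q k x = f' (x + z *\<^sub>R v) v" using e[of k] by (simp add: q_def add.commute)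
        then show ?thesis using True M by simp
      next
        case False
        have "norm (e k *\<^sub>R v) \<le> norm v" using e[of k] by (simp add: mult_left_le_one_le)
        then have "\<not> norm (e k *\<^sub>R v + x) \<le> R" "\<not> norm x \<le> R"
          using False norm_triangle_ineq4[of "e k *\<^sub>R v + x" "e k *\<^sub>R v"] norm_ge_zero[of v] by (auto, linarith+)
        then have "e k *\<^sub>R v + x \<notin> K" "x \<notin> K" using R by blast+
        then show ?thesis using K False by (simp add: q_def)
      qed
    qed
  qed
  then show ?thesis unfolding qi using LIMSEQ_unique tendsto_const by blast
qed

text \<open>The derivative of \<open>f * \<phi>\<close> along \<open>e\<close> integrates to 0.
  Working with one direction at a time fits the Wolff flux, whose two components are differentiated
  along \<open>\<rho>\<close> and along \<open>\<rho>'\<close> respectively.\<close>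

lemma integration_by_parts_test:
  fixes f :: "'a::euclidean_space \<Rightarrow> real"
  assumes f: "\<And>x. f differentiable at x" "continuous_on UNIV (\<lambda>x. grad f x \<bullet> e)"
    and \<phi>: "\<phi> \<in> test_functions U" and U: "U \<in> sets lebesgue"
  shows "(LINT x|lebesgue_on U. f x * (grad \<phi> x \<bullet> e)) = - (LINT x|lebesgue_on U. \<phi> x * (grad f x \<bullet> e))"
proof -
  obtain K where K: "smooth \<phi>" "compact K" "K \<subseteq> U" "\<And>x. x \<notin> K \<Longrightarrow> \<phi> x = 0" "\<And>x. x \<notin> K \<Longrightarrow> grad \<phi> x = 0"
    using test_functionD[OF \<phi>] by blast
  have cf: "continuous_on UNIV f"
    by (intro continuous_at_imp_continuous_on ballI differentiable_imp_continuous_within f(1))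
  have c: "continuous_on UNIV (\<lambda>x. f x * (grad \<phi> x \<bullet> e))" "continuous_on UNIV (\<lambda>x. \<phi> x * (grad f x \<bullet> e))"
    using smoothD[OF K(1)] cf f(2) by (auto intro!: continuous_intros)
  have "((\<lambda>x. f x * \<phi> x) has_derivative (\<lambda>h. f x * (h \<bullet> grad \<phi> x) + (h \<bullet> grad f x) * \<phi> x)) (at x)" for x
    by (intro has_derivative_mult has_derivative_grad f smoothD K)
  then have "(LINT x|lborel. f x * (e \<bullet> grad \<phi> x) + (e \<bullet> grad f x) * \<phi> x) = 0"
    by (rule integral_directional_derivative_eq_0[OF _ _ K(2)])
      (use c K in \<open>auto simp: inner_commute mult.commute intro!: continuous_intros\<close>)
  moreover have "integrable lborel (\<lambda>x. f x * (grad \<phi> x \<bullet> e))" "integrable lborel (\<lambda>x. \<phi> x * (grad f x \<bullet> e))"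
    using K by (auto intro!: integrable_compact_support[OF c(1) K(2)] integrable_compact_support[OF c(2) K(2)])
  ultimately have "(LINT x|lborel. f x * (grad \<phi> x \<bullet> e)) + (LINT x|lborel. \<phi> x * (grad f x \<bullet> e)) = 0"
    by (simp add: inner_commute mult.commute)
  moreover have "(LINT x|lebesgue_on U. f x * (grad \<phi> x \<bullet> e)) = (LINT x|lborel. f x * (grad \<phi> x \<bullet> e))"
    "(LINT x|lebesgue_on U. \<phi> x * (grad f x \<bullet> e)) = (LINT x|lborel. \<phi> x * (grad f x \<bullet> e))"
    using K U by (auto intro!: lebesgue_on_compact_support(2)[OF c(1) K(2)] lebesgue_on_compact_support(2)[OF c(2) K(2)])
  ultimately show ?thesis by simp
qed

lemma locally_integrable_continuous:
  fixes f :: "'a::euclidean_space \<Rightarrow> 'b::euclidean_space"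
  assumes "continuous_on UNIV f"
  shows "locally_integrable U f"
  unfolding locally_integrable_def set_integrable_def
proof (intro allI impI)
  fix K assume K: "compact K \<and> K \<subseteq> U"
  have "integrable lborel (\<lambda>x. indicator K x *\<^sub>R f x)"
    using K by (intro borel_integrable_compact continuous_on_subset[OF assms]) auto
  then show "integrable lebesgue (\<lambda>x. indicator K x *\<^sub>R f x)"
    by (subst integrable_completion) auto
qed

lemma has_weak_gradient_C1:
  fixes f :: "'a::euclidean_space \<Rightarrow> real"
  assumes f: "\<And>x. f differentiable at x" "continuous_on UNIV (grad f)"
    and U: "U \<in> sets lebesgue"
  shows "has_weak_gradient U f (grad f)"
  unfolding has_weak_gradient_def
proof (intro conjI ballI)
  have cf: "continuous_on UNIV f"
    by (intro continuous_at_imp_continuous_on ballI differentiable_imp_continuous_within f(1))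
  show "locally_integrable U f" "locally_integrable U (grad f)"
    using cf f by (auto intro: locally_integrable_continuous)
  fix \<phi> assume \<phi>: "\<phi> \<in> test_functions U"
  obtain K where K: "smooth \<phi>" "compact K" "K \<subseteq> U" "\<And>x. x \<notin> K \<Longrightarrow> \<phi> x = 0" "\<And>x. x \<notin> K \<Longrightarrow> grad \<phi> x = 0"
    using test_functionD[OF \<phi>] by blast
  have i: "integrable (lebesgue_on U) (\<lambda>x. f x *\<^sub>R grad \<phi> x)" "integrable (lebesgue_on U) (\<lambda>x. \<phi> x *\<^sub>R grad f x)"
    using K smoothD[OF K(1)] cf f U by (auto intro!: lebesgue_on_compact_support(1)[OF _ K(2)] continuous_intros)
  show "(LINT x|lebesgue_on U. f x *\<^sub>R grad \<phi> x) = - (LINT x|lebesgue_on U. \<phi> x *\<^sub>R grad f x)"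
  proof (rule euclidean_eqI)
    fix b :: 'a
    have "(LINT x|lebesgue_on U. f x *\<^sub>R grad \<phi> x) \<bullet> b = (LINT x|lebesgue_on U. f x * (grad \<phi> x \<bullet> b))"
      using integral_inner_left[of b "lebesgue_on U", OF i(1)] by simp
    moreover have "(LINT x|lebesgue_on U. \<phi> x *\<^sub>R grad f x) \<bullet> b = (LINT x|lebesgue_on U. \<phi> x * (grad f x \<bullet> b))"
      using integral_inner_left[of b "lebesgue_on U", OF i(2)] by simp
    moreover have "continuous_on UNIV (\<lambda>x. grad f x \<bullet> b)" using f by (intro continuous_intros)
    ultimately show "(LINT x|lebesgue_on U. f x *\<^sub>R grad \<phi> x) \<bullet> b = - (LINT x|lebesgue_on U. \<phi> x *\<^sub>R grad f x) \<bullet> b"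
      using integration_by_parts_test[OF f(1) _ \<phi> U, of b] by simp
  qed
qed

section \<open>The fundamental lemma of the calculus of variations\<close>

lemma sigma_finite_lebesgue: "sigma_finite_measure (lebesgue :: 'a::euclidean_space measure)"
proof
  obtain A :: "'a set set" where A: "countable A" "A \<subseteq> sets lborel" "\<Union>A = space lborel" "\<And>a. a \<in> A \<Longrightarrow> emeasure lborel a \<noteq> \<infinity>"
    using lborel.sigma_finite_countable by metis
  then have "A \<subseteq> sets lebesgue \<and> (\<forall>a\<in>A. emeasure lebesgue a \<noteq> \<infinity>)"
    by (auto simp: subset_iff)
  then show "\<exists>A::'a set set. countable A \<and> A \<subseteq> sets lebesgue \<and> \<Union>A = space lebesgue \<and> (\<forall>a\<in>A. emeasure lebesgue a \<noteq> \<infinity>)"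
    using A(1,3) by (intro exI[of _ A]) simp
qed

text \<open>Boxes are stable under intersection and generate the Borel sets, so the vanishing of set
  integrals spreads by a Dynkin argument; the total integral enters for complements. A Lebesgue set
  differs from a Borel set by a null set only.\<close>

lemma AE_zero_if_box_integrals_zero:
  fixes H :: "'a::euclidean_space \<Rightarrow> 'b::euclidean_space"
  assumes H: "integrable lebesgue H" and H0: "\<And>a b. (LINT x:box a b|lebesgue. H x) = 0"
    and HU: "integral\<^sup>L lebesgue H = 0"
  shows "AE x in lebesgue. H x = 0"
proof (rule sigma_finite_measure.density_zero[OF sigma_finite_lebesgue H])
  have si: "set_integrable lebesgue A H" if "A \<in> sets lebesgue" for A
    using integrable_mult_indicator[OF that H] by (simp add: set_integrable_def)
  have *: "(LINT x:A|lebesgue. H x) = 0" if "A \<in> sigma_sets UNIV (range (\<lambda>(a, b). box a b))" for A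
  proof -
    have leb: "X \<in> sets lebesgue" if "X \<in> sigma_sets UNIV (range (\<lambda>(a, b). box a b))" for X :: "'a set"
    proof -
      have "X \<in> sets borel" using that unfolding borel_eq_box by simp
      then show ?thesis by (simp add: sets_completionI_sets)
    qed
    have "Int_stable (range (\<lambda>(a, b). box a b :: 'a set))"
      by (auto simp: Int_stable_def box_Int_box)
    moreover have "range (\<lambda>(a, b). box a b :: 'a set) \<subseteq> Pow UNIV" by simp
    ultimately show ?thesis using that
    proof (induction rule: sigma_sets_induct_disjoint)
      case (basic A) then show ?case using H0 by auto
    next
      case empty show ?case by (simp add: set_lebesgue_integral_def)
    next
      case (compl A)
      have "(LINT x:A \<union> (UNIV - A)|lebesgue. H x) = (LINT x:A|lebesgue. H x) + (LINT x:UNIV - A|lebesgue. H x)"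
        using leb[OF compl(1)] by (intro set_integral_Un si) auto
      moreover have "(LINT x:A \<union> (UNIV - A)|lebesgue. H x) = 0"
        using HU by (simp add: set_lebesgue_integral_def)
      ultimately show ?case using compl by simp
    next
      case (union A)
      have A: "A i \<in> sets lebesgue" for i using union leb by blast
      have "(LINT x:(\<Union>i. A i)|lebesgue. H x) = (\<Sum>i. (LINT x:(A i)|lebesgue. H x))"
        using A union(1) by (intro lebesgue_integral_countable_add si sets.countable_UN)
          (auto simp: disjoint_family_on_def)
      then show ?case using union by simp
    qed
  qed
  fix A :: "'a set" assume A: "A \<in> sets lebesgue"
  then obtain S N N' where S: "A = S \<union> N" "N \<subseteq> N'" "N' \<in> null_sets lborel" "S \<in> sets lborel"
    by (rule sets_completionE)
  have "AE x in lborel. x \<notin> N'" using S(3) by (rule AE_not_in)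
  then have "AE x in lebesgue. x \<notin> N'" by (rule AE_completion)
  then have AS: "AE x in lebesgue. (x \<in> A) = (x \<in> S)"
    by eventually_elim (use S in blast)
  have SL: "S \<in> sets lebesgue" using S(4) by (simp add: sets_completionI_sets)
  have "(LINT x:A|lebesgue. H x) = (LINT x:S|lebesgue. H x)"
    using AS by (intro set_integral_cong_set)
      (use si[OF A] si[OF SL] in \<open>auto simp: set_borel_measurable_def set_integrable_def\<close>)
  also have "\<dots> = 0" using S(4) by (intro *) (simp add: borel_eq_box)
  finally show "(LINT x:A|lebesgue. H x) = 0" .
qed

text \<open>Test functions approximate indicators of open boxes boundedly, so \<open>G\<close>
  integrates to 0 over every open box whose closed box lies in \<open>U\<close>. As \<open>G\<close>
  is only locally integrable, the argument is run on one closed box at a time; countably many of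
  them cover \<open>U\<close>.\<close>

lemma AE_zero_if_test_integrals_zero:
  fixes G :: "'a::euclidean_space \<Rightarrow> 'b::euclidean_space"
  assumes U: "open U" and G: "locally_integrable U G"
    and G0: "\<And>\<phi>. \<phi> \<in> test_functions U \<Longrightarrow> (LINT x|lebesgue_on U. \<phi> x *\<^sub>R G x) = 0"
  shows "AE x in lebesgue_on U. G x = 0"
proof -
  have Us: "U \<in> sets lebesgue" using U by simp
  have box0: "(LINT x:box c d|lebesgue. G x) = 0" if cd: "cbox c d \<subseteq> U" for c d
  proof -
    obtain \<phi> where \<phi>: "\<And>k::nat. \<phi> k \<in> test_functions U" "\<And>k x. \<bar>\<phi> k x\<bar> \<le> 1"
      "\<And>k x. x \<notin> box c d \<Longrightarrow> \<phi> k x = 0" "\<And>x. (\<lambda>k. \<phi> k x) \<longlonglongrightarrow> indicator (box c d) x"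
      using box_indicator_approximation[OF cd] by metis
    define H where "H = (\<lambda>x. indicator (cbox c d) x *\<^sub>R G x)"
    have H: "integrable lebesgue H"
      using G cd by (auto simp: locally_integrable_def set_integrable_def H_def)
    have in_cbox: "x \<in> cbox c d" if "x \<in> box c d" for x using box_subset_cbox that by blast
    have "(LINT x|lebesgue. \<phi> k x *\<^sub>R H x) = 0" for k
    proof -
      have "(LINT x|lebesgue. \<phi> k x *\<^sub>R H x) = (LINT x|lebesgue. indicator U x *\<^sub>R (\<phi> k x *\<^sub>R G x))"
        using \<phi>(3) in_cbox cd by (intro Bochner_Integration.integral_cong) (auto simp: H_def indicator_def)
      also have "\<dots> = (LINT x|lebesgue_on U. \<phi> k x *\<^sub>R G x)"
        using Us by (simp add: integral_restrict_space)
      finally show ?thesis using G0[OF \<phi>(1)] by simp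
    qed
    moreover have "(\<lambda>k. LINT x|lebesgue. \<phi> k x *\<^sub>R H x) \<longlonglongrightarrow> (LINT x|lebesgue. indicator (box c d) x *\<^sub>R H x)"
    proof (rule integral_dominated_convergence[where w = "\<lambda>x. norm (H x)"])
      show "(\<lambda>x. indicator (box c d) x *\<^sub>R H x) \<in> borel_measurable lebesgue"
        using H by (intro borel_measurable_scaleR borel_measurable_indicator) auto
      show "(\<lambda>x. \<phi> k x *\<^sub>R H x) \<in> borel_measurable lebesgue" for k
      proof -
        have "\<phi> k \<in> borel_measurable lborel"
          using borel_measurable_continuous_onI[OF smoothD(2)] \<phi>(1)[of k] by (auto simp: test_functions_iff)
        then have "\<phi> k \<in> borel_measurable lebesgue" by (rule measurable_completion)
        then show ?thesis using H by (intro borel_measurable_scaleR) auto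
      qed
      show "AE x in lebesgue. (\<lambda>k. \<phi> k x *\<^sub>R H x) \<longlonglongrightarrow> indicator (box c d) x *\<^sub>R H x"
        by (intro AE_I2 tendsto_intros \<phi>)
      show "AE x in lebesgue. norm (\<phi> k x *\<^sub>R H x) \<le> norm (H x)" for k
        using \<phi>(2)[of k] by (auto simp: mult_left_le_one_le)
    qed (use H in auto)
    ultimately have "(LINT x|lebesgue. indicator (box c d) x *\<^sub>R H x) = 0"
      by (simp add: LIMSEQ_const_iff)
    moreover have "indicator (box c d) x *\<^sub>R H x = indicator (box c d) x *\<^sub>R G x" for x
      using in_cbox by (auto simp: H_def indicator_def)
    ultimately show ?thesis by (simp add: set_lebesgue_integral_def)
  qed
  have ae: "AE x in lebesgue. x \<in> cbox c d \<longrightarrow> G x = 0" if cd: "cbox c d \<subseteq> U" for c d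
  proof -
    define H where "H = (\<lambda>x. indicator (box c d) x *\<^sub>R G x)"
    have "AE x in lebesgue. H x = 0"
    proof (rule AE_zero_if_box_integrals_zero)
      have "set_integrable lebesgue (cbox c d) G"
        using G cd compact_cbox[of c d] unfolding locally_integrable_def by metis
      then have "set_integrable lebesgue (box c d) G"
        by (rule set_integrable_subset) (auto simp: box_subset_cbox)
      then show "integrable lebesgue H" by (simp add: H_def set_integrable_def)
      show "integral\<^sup>L lebesgue H = 0" using box0[OF cd] by (simp add: H_def set_lebesgue_integral_def)
      fix a b :: 'a
      obtain e f where ef: "box a b \<inter> box c d = box e f" unfolding box_Int_box by blast
      have "(LINT x:box e f|lebesgue. G x) = 0"
      \<comment> \<open>A nonempty open box has \<open>cbox e f\<close> as its closure, which keeps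
        the latter inside \<open>cbox c d\<close>. An empty box says nothing about the position of
        \<open>cbox e f\<close>, hence the separate case.\<close>
      proof (cases "box e f = {}")
        case False
        then have "cbox e f = closure (box e f)" by (simp add: closure_box)
        also have "\<dots> \<subseteq> cbox c d"
          unfolding ef[symmetric] using box_subset_cbox[of c d] by (intro closure_minimal) auto
        finally show ?thesis using cd by (intro box0) (rule order_trans)
      qed (simp add: set_lebesgue_integral_def)
      moreover have "indicator (box a b) x *\<^sub>R H x = indicator (box e f) x *\<^sub>R G x" for x
        by (simp add: H_def flip: ef) (simp add: indicator_inter_arith)
      ultimately show "(LINT x:box a b|lebesgue. H x) = 0" by (simp add: set_lebesgue_integral_def)
    qed
    moreover have "AE x in lebesgue. x \<notin> cbox c d - box c d"
      using negligible_frontier_interval[of c d] by (intro AE_not_in) (simp add: negligible_iff_null_sets)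
    ultimately show ?thesis by eventually_elim (auto simp: H_def)
  qed
  obtain \<D> where \<D>: "countable \<D>" "\<D> \<subseteq> Pow U" "\<And>X. X \<in> \<D> \<Longrightarrow> \<exists>a b. X = cbox a b" "\<Union>\<D> = U"
    using open_countable_Union_open_cbox[OF U] by metis
  have "AE x in lebesgue. \<forall>X\<in>\<D>. x \<in> X \<longrightarrow> G x = 0"
  proof (rule AE_ball_countable'[OF _ \<D>(1)])
    fix X assume X: "X \<in> \<D>"
    then obtain c d where "X = cbox c d" using \<D> by blast
    then show "AE x in lebesgue. x \<in> X \<longrightarrow> G x = 0" using ae[of c d] X \<D>(2) by blast
  qed
  then have "AE x in lebesgue. x \<in> U \<longrightarrow> G x = 0" by eventually_elim (use \<D>(4) in blast)
  then show ?thesis using Us by (simp add: AE_restrict_space_iff)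
qed

lemma locally_integrable_lincomb:
  assumes "locally_integrable U f" "locally_integrable U g"
  shows "locally_integrable U (\<lambda>x. c *\<^sub>R f x + d *\<^sub>R g x)"
  using assms unfolding locally_integrable_def by (auto intro!: set_integral_add)

text \<open>Local integrability controls compact pieces, and \<open>U\<close> is a countable union
  of closed boxes. This supplies measurability for the representative chosen in
  \<open>weak_grad\<close>.\<close>

lemma locally_integrable_imp_measurable:
  fixes f :: "'a::euclidean_space \<Rightarrow> 'b::euclidean_space"
  assumes U: "open U" and f: "locally_integrable U f"
  shows "f \<in> borel_measurable (lebesgue_on U)"
proof -
  obtain \<D> where \<D>: "countable \<D>" "\<D> \<subseteq> Pow U" "\<And>X. X \<in> \<D> \<Longrightarrow> \<exists>a b. X = cbox a b" "\<Union>\<D> = U"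
    using open_countable_Union_open_cbox[OF U] by metis
  show ?thesis
  proof (rule measurable_piecewise_restrict[OF \<D>(1)])
    show "space (lebesgue_on U) \<subseteq> \<Union>\<D>" using \<D> by simp
    fix X assume X: "X \<in> \<D>"
    then obtain c d where cd: "X = cbox c d" "X \<subseteq> U" using \<D> by blast
    have "X \<in> sets lebesgue" using cd by simp
    then show "X \<inter> space (lebesgue_on U) \<in> sets (lebesgue_on U)"
      using U by (auto simp: sets_restrict_space)
    have "f absolutely_integrable_on X" using f cd by (auto simp: locally_integrable_def)
    then have "f \<in> borel_measurable (lebesgue_on X)"
      by (rule absolutely_integrable_measurable[THEN iffD1, THEN conjunct1, rotated]) (use cd in auto)
    moreover have "restrict_space (lebesgue_on U) X = lebesgue_on X"
      using cd U by (subst restrict_restrict_space) (auto simp: inf.absorb2)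
    ultimately show "f \<in> borel_measurable (restrict_space (lebesgue_on U) X)" by simp
  qed
qed


section \<open>Sobolev functions on bounded open sets\<close>

lemma DERIV_abs_powr:
  fixes s :: real
  assumes p: "1 < p"
  shows "DERIV (\<lambda>s. \<bar>s\<bar> powr p) s :> p * p_flux p s"
proof -
  consider "s > 0" | "s < 0" | "s = 0" by linarith
  then show ?thesis
  proof cases
    case 1
    have "DERIV (\<lambda>s. s powr p) s :> p * p_flux p s"
      using has_real_derivative_powr[OF 1, of p] 1 by (simp add: p_flux_def powr_diff power2_eq_square)
    then show ?thesis
      by (rule has_field_derivative_transform_within_open[where S = "{0<..}"]) (use 1 in auto)
  next
    case 2
    have "DERIV (\<lambda>s. (- s) powr p) s :> p * p_flux p s"
      using 2 by (auto intro!: derivative_eq_intros simp: p_flux_def powr_diff power2_eq_square)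
    then show ?thesis
      by (rule has_field_derivative_transform_within_open[where S = "{..<0}"]) (use 2 in auto)
  next
    case 3
    \<comment> \<open>The absolute value of the difference quotient at 0 is
      \<open>\<bar>h\<bar> powr (p - 1)\<close>, which tends to 0 because
      \<open>p > 1\<close>.\<close>
    have "((\<lambda>h::real. \<bar>h\<bar> powr (p - 1)) \<longlongrightarrow> 0 powr (p - 1)) (at 0)"
      using p by (intro tendsto_powr' tendsto_eq_intros) auto
    then have *: "((\<lambda>h::real. \<bar>h\<bar> powr (p - 1)) \<longlongrightarrow> 0) (at 0)" by simp
    have "((\<lambda>h::real. norm ((\<bar>0 + h\<bar> powr p - \<bar>0\<bar> powr p) / h)) \<longlongrightarrow> 0) (at 0)"
      by (rule Lim_transform_eventually[OF *])
        (auto simp: eventually_at_filter powr_diff intro!: always_eventually)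
    from tendsto_norm_zero_cancel[OF this] show ?thesis using 3 by (simp add: DERIV_def p_flux_def)
  qed
qed

locale bounded_open =
  fixes U :: "'a::euclidean_space set" and p :: real
  assumes open_U: "open U" and bounded_U: "bounded U" and p_gt_1: "1 < p"
begin

abbreviation "M \<equiv> lebesgue_on U"

lemma U_lebesgue [simp]: "U \<in> sets lebesgue"
  using open_U by simp

sublocale M: finite_measure M
  using finite_measure_lebesgue_on lmeasurable_open bounded_U open_U by blast

section \<open>Completeness and convergence in L^p on a set of finite measure\<close>

lemma LpD:
  fixes f :: "'a \<Rightarrow> 'b::euclidean_space"
  assumes "f \<in> Lp_on p U"
  shows "f \<in> borel_measurable M" "integrable M (\<lambda>x. norm (f x) powr p)"
  using assms by (auto simp: Lp_on_def)

lemma Lp_lincomb: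
  fixes f g :: "'a \<Rightarrow> 'b::euclidean_space"
  assumes "f \<in> Lp_on p U" "g \<in> Lp_on p U"
  shows "(\<lambda>x. c *\<^sub>R f x + d *\<^sub>R g x) \<in> Lp_on p U"
proof -
  let ?w = "\<lambda>x. 2 powr p * (\<bar>c\<bar> powr p * norm (f x) powr p + \<bar>d\<bar> powr p * norm (g x) powr p)"
  note fg = LpD[OF assms(1)] LpD[OF assms(2)]
  have m: "(\<lambda>x. c *\<^sub>R f x + d *\<^sub>R g x) \<in> borel_measurable M" using fg by measurable
  have "integrable M (\<lambda>x. norm (c *\<^sub>R f x + d *\<^sub>R g x) powr p)"
  proof (rule Bochner_Integration.integrable_bound)
    show "integrable M ?w"
      using fg by auto
    show "AE x in M. norm (norm (c *\<^sub>R f x + d *\<^sub>R g x) powr p)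
        \<le> norm (?w x)"
    proof (rule AE_I2)
      fix x
      show "norm (norm (c *\<^sub>R f x + d *\<^sub>R g x) powr p)
        \<le> norm (?w x)"
        using norm_add_powr_le2[OF p_gt_1, of "c *\<^sub>R f x" "d *\<^sub>R g x"] by (simp add: powr_mult)
    qed
  qed (use m in measurable)
  with m show ?thesis by (simp add: Lp_on_def)
qed

lemma Lp_diff:
  fixes f g :: "'a \<Rightarrow> 'b::euclidean_space"
  shows "f \<in> Lp_on p U \<Longrightarrow> g \<in> Lp_on p U \<Longrightarrow> (\<lambda>x. f x - g x) \<in> Lp_on p U"
  using Lp_lincomb[of f g 1 "-1"] by simp

lemma Lp_cong_AE:
  fixes f g :: "'a \<Rightarrow> 'b::euclidean_space"
  assumes "f \<in> Lp_on p U" "g \<in> borel_measurable M" "AE x in M. f x = g x"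
  shows "g \<in> Lp_on p U"
proof -
  have "integrable M (\<lambda>x. norm (g x) powr p)"
  proof (rule integrable_cong_AE_imp[OF LpD(2)[OF assms(1)]])
    show "AE x in M. norm (f x) powr p = norm (g x) powr p" using assms(3) by eventually_elim simp
  qed (use assms(2) in measurable)
  then show ?thesis using assms(2) by (simp add: Lp_on_def)
qed

lemma Lp_integrable:
  fixes f :: "'a \<Rightarrow> 'b::euclidean_space"
  assumes "f \<in> Lp_on p U"
  shows "integrable M f"
proof (rule Bochner_Integration.integrable_bound)
  show "integrable M (\<lambda>x. 1 + norm (f x) powr p)" using LpD[OF assms] by simp
  show "AE x in M. norm (f x) \<le> norm (1 + norm (f x) powr p)"
  proof (rule AE_I2)
    fix x show "norm (f x) \<le> norm (1 + norm (f x) powr p)"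
      using le_eps_plus_powr[of p "norm (f x)" 1] p_gt_1 by simp
  qed
qed (use LpD[OF assms] in auto)

lemma integrable_imp_locally_integrable:
  fixes f :: "'a \<Rightarrow> 'b::euclidean_space"
  assumes "integrable M f"
  shows "locally_integrable U f"
  unfolding locally_integrable_def
proof (intro allI impI)
  fix K assume K: "compact K \<and> K \<subseteq> U"
  have "set_integrable lebesgue U f"
    using assms by (simp add: integrable_restrict_space set_integrable_def)
  then show "set_integrable lebesgue K f"
    by (rule set_integrable_subset) (use K compact_imp_closed in \<open>auto intro!: lmeasurable_compact fmeasurableD\<close>)
qed

lemma Lp_norm_le:
  fixes f :: "'a \<Rightarrow> 'b::euclidean_space"
  assumes f: "f \<in> Lp_on p U" and e: "0 < e"
  shows "(LINT x|M. norm (f x)) \<le> e * measure M U + e powr (1 - p) * (LINT x|M. norm (f x) powr p)"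
proof -
  have "(LINT x|M. norm (f x)) \<le> (LINT x|M. e + e powr (1 - p) * norm (f x) powr p)"
    using Lp_integrable[OF f] LpD[OF f] p_gt_1 e
    by (intro integral_mono) (auto intro!: le_eps_plus_powr)
  also have "\<dots> = e * measure M U + e powr (1 - p) * (LINT x|M. norm (f x) powr p)"
    using LpD[OF f] by simp
  finally show ?thesis .
qed

lemma Lp_norm_small:
  assumes e: "0 < e"
  shows "\<exists>d>0. \<forall>f :: 'a \<Rightarrow> 'b::euclidean_space. f \<in> Lp_on p U \<longrightarrow> (LINT x|M. norm (f x) powr p) < d \<longrightarrow> (LINT x|M. norm (f x)) < e"
proof -
  \<comment> \<open>\<open>h\<close> keeps the measure term below \<open>e / 2\<close>, and
    \<open>d\<close> does the same for the other term. Adding 1 to the measure avoids division by 0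
    when \<open>U\<close> is empty.\<close>
  define h where "h = e / (2 * (measure M U + 1))"
  define d where "d = e / (2 * h powr (1 - p))"
  have mU: "0 \<le> measure M U" by simp
  then have h: "0 < h" unfolding h_def using e by (intro divide_pos_pos mult_pos_pos add_nonneg_pos) auto
  then have d: "0 < d" using e by (simp add: d_def)
  have "(LINT x|M. norm (f x)) < e" if f: "f \<in> Lp_on p U" "(LINT x|M. norm (f x) powr p) < d" for f :: "'a \<Rightarrow> 'b"
  proof -
    have "h * measure M U \<le> h * (measure M U + 1)" using h by simp
    also have "\<dots> = e / 2"
    proof -
      have "e / (2 * K) * K = e / 2" if "K \<noteq> 0" for K :: real using that by simp
      then show ?thesis unfolding h_def using mU by (metis add_nonneg_pos less_irrefl zero_less_one)
    qed
    finally have "h * measure M U \<le> e / 2" .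
    moreover have "h powr (1 - p) * (LINT x|M. norm (f x) powr p) < h powr (1 - p) * d"
      using f(2) h by (intro mult_strict_left_mono) auto
    moreover have "h powr (1 - p) * d = e / 2" using h by (simp add: d_def)
    ultimately show ?thesis using Lp_norm_le[OF f(1) h] by simp
  qed
  with d show ?thesis by blast
qed

text \<open>On finite measure an L^p Cauchy sequence is Cauchy in L^1, so a subsequence converges
  almost everywhere; Fatou's lemma along this subsequence carries the Cauchy estimate over to the
  limit.\<close>

lemma Lp_complete:
  fixes f :: "nat \<Rightarrow> 'a \<Rightarrow> 'b::euclidean_space"
  assumes f: "\<And>k. f k \<in> Lp_on p U"
    and C: "\<And>e. e > 0 \<Longrightarrow> \<exists>N. \<forall>i\<ge>N. \<forall>j\<ge>N. (LINT x|M. norm (f i x - f j x) powr p) < e"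
  obtains g where "g \<in> Lp_on p U" "(\<lambda>k. LINT x|M. norm (f k x - g x) powr p) \<longlonglongrightarrow> 0"
proof -
  have C1: "\<exists>N. \<forall>i\<ge>N. \<forall>j\<ge>N. (LINT x|M. norm (f i x - f j x)) < e" if e: "e > 0" for e
  proof -
    obtain d where d: "d > 0" "\<And>h :: 'a \<Rightarrow> 'b. h \<in> Lp_on p U \<Longrightarrow> (LINT x|M. norm (h x) powr p) < d \<Longrightarrow> (LINT x|M. norm (h x)) < e"
      using Lp_norm_small[OF e] by metis
    from C[OF d(1)] show ?thesis using d(2)[OF Lp_diff[OF f f]] by blast
  qed
  obtain r where r: "strict_mono r" "AE x in M. Cauchy (\<lambda>i. f (r i) x)"
    using cauchy_L1_AE_cauchy_subseq[of M f, OF Lp_integrable[OF f] C1] by blast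
  define g where "g x = lim (\<lambda>i. f (r i) x)" for x
  have fm: "f k \<in> borel_measurable M" for k using LpD[OF f] by auto
  have gm: "g \<in> borel_measurable M" unfolding g_def
    by (rule borel_measurable_lim_metric) (rule fm)
  have lim: "AE x in M. (\<lambda>i. f (r i) x) \<longlonglongrightarrow> g x"
    using r(2) by eventually_elim (simp add: g_def Cauchy_convergent_iff convergent_LIMSEQ_iff)
  have main: "(\<integral>\<^sup>+x. ennreal (norm (f k x - g x) powr p) \<partial>M) \<le> ennreal e"
    if e: "e > 0" and N: "\<forall>i\<ge>N. \<forall>j\<ge>N. (LINT x|M. norm (f i x - f j x) powr p) < e" and k: "k \<ge> N" for e N k
  proof -
    have "(\<integral>\<^sup>+x. ennreal (norm (f k x - g x) powr p) \<partial>M)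
       = (\<integral>\<^sup>+x. liminf (\<lambda>i. ennreal (norm (f k x - f (r i) x) powr p)) \<partial>M)"
    proof (rule nn_integral_cong_AE)
      show "AE x in M. ennreal (norm (f k x - g x) powr p) = liminf (\<lambda>i. ennreal (norm (f k x - f (r i) x) powr p))"
        using lim
      proof eventually_elim
        case (elim x)
        have "(\<lambda>i. norm (f k x - f (r i) x) powr p) \<longlonglongrightarrow> norm (f k x - g x) powr p"
          using p_gt_1 elim by (intro tendsto_powr' tendsto_intros) auto
        then have "(\<lambda>i. ennreal (norm (f k x - f (r i) x) powr p)) \<longlonglongrightarrow> ennreal (norm (f k x - g x) powr p)"
          by (intro tendsto_ennrealI)
        then show ?case by (intro lim_imp_Liminf[symmetric] sequentially_bot)
      qed
    qed
    also have "\<dots> \<le> liminf (\<lambda>i. \<integral>\<^sup>+x. ennreal (norm (f k x - f (r i) x) powr p) \<partial>M)"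
      using fm by (intro nn_integral_liminf) measurable
    also have "\<dots> \<le> ennreal e"
    proof -
      have "\<forall>\<^sub>F i in sequentially. (\<integral>\<^sup>+x. ennreal (norm (f k x - f (r i) x) powr p) \<partial>M) \<le> ennreal e"
      proof (rule eventually_sequentiallyI[of N])
        fix i assume "N \<le> i"
        then have "N \<le> r i" using seq_suble[OF r(1), of i] by simp
        then have "(LINT x|M. norm (f k x - f (r i) x) powr p) < e" using N k by blast
        then show "(\<integral>\<^sup>+x. ennreal (norm (f k x - f (r i) x) powr p) \<partial>M) \<le> ennreal e"
          using LpD(2)[OF Lp_diff[OF f f], of k "r i"]
          by (subst nn_integral_eq_integral) (auto intro!: ennreal_leI)
      qed
      then show ?thesis by (intro Liminf_le) (auto intro: eventually_frequently)
    qed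
    finally show ?thesis .
  qed
  have g_diff: "(\<lambda>x. f k x - g x) \<in> Lp_on p U \<and> (LINT x|M. norm (f k x - g x) powr p) \<le> e"
    if "e > 0" "\<forall>i\<ge>N. \<forall>j\<ge>N. (LINT x|M. norm (f i x - f j x) powr p) < e" "k \<ge> N" for e N k
  proof -
    have m: "(\<lambda>x. f k x - g x) \<in> borel_measurable M" using fm gm by measurable
    have "(\<integral>\<^sup>+x. ennreal (norm (f k x - g x) powr p) \<partial>M) < \<infinity>"
      using main[OF that] by (simp add: order_le_less_trans)
    then have i: "integrable M (\<lambda>x. norm (f k x - g x) powr p)"
      using m by (intro integrableI_nonneg) auto
    moreover have "(LINT x|M. norm (f k x - g x) powr p) \<le> e"
      using main[OF that] nn_integral_eq_integral[OF i] that(1) by (simp add: ennreal_le_iff)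
    ultimately show ?thesis using m by (simp add: Lp_on_def)
  qed
  have "g \<in> Lp_on p U"
  proof -
    obtain N where "\<forall>i\<ge>N. \<forall>j\<ge>N. (LINT x|M. norm (f i x - f j x) powr p) < 1" using C[of 1] by auto
    then have "(\<lambda>x. f N x - g x) \<in> Lp_on p U" using g_diff[of 1 N N] by auto
    from Lp_diff[OF f this, of N] show ?thesis by simp
  qed
  moreover have "(\<lambda>k. LINT x|M. norm (f k x - g x) powr p) \<longlonglongrightarrow> 0"
  proof (rule LIMSEQ_I)
    fix e :: real assume e: "e > 0"
    then obtain N where N: "\<forall>i\<ge>N. \<forall>j\<ge>N. (LINT x|M. norm (f i x - f j x) powr p) < e / 2" using C[of "e/2"] by auto
    show "\<exists>N. \<forall>k\<ge>N. norm ((LINT x|M. norm (f k x - g x) powr p) - 0) < e"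
    proof (intro exI[of _ N] allI impI)
      fix k assume "N \<le> k"
      then have "(LINT x|M. norm (f k x - g x) powr p) \<le> e / 2" using g_diff[OF _ N] e by auto
      moreover have "0 \<le> (LINT x|M. norm (f k x - g x) powr p)" by (intro integral_nonneg_AE) auto
      ultimately show "norm ((LINT x|M. norm (f k x - g x) powr p) - 0) < e" using e by simp
    qed
  qed
  ultimately show thesis using that by blast
qed

text \<open>L^p convergence gives L^1 convergence, which a bounded factor preserves. It serves to
  pass to the limit in the integral identity that defines a weak gradient.\<close>

lemma Lp_tendsto_integral:
  fixes f :: "nat \<Rightarrow> 'a \<Rightarrow> 'b::euclidean_space"
  assumes f: "\<And>k. f k \<in> Lp_on p U" "g \<in> Lp_on p U"
    and lim: "(\<lambda>k. LINT x|M. norm (f k x - g x) powr p) \<longlonglongrightarrow> 0"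
    and \<psi>: "\<psi> \<in> borel_measurable M" "\<And>x. \<bar>\<psi> x\<bar> \<le> B"
  shows "(\<lambda>k. LINT x|M. \<psi> x *\<^sub>R f k x) \<longlonglongrightarrow> (LINT x|M. \<psi> x *\<^sub>R g x)"
proof -
  have int: "integrable M (\<lambda>x. \<psi> x *\<^sub>R h x)" if "h \<in> Lp_on p U" for h :: "'a \<Rightarrow> 'b"
  proof (rule Bochner_Integration.integrable_bound)
    show "integrable M (\<lambda>x. B *\<^sub>R h x)" using Lp_integrable[OF that] by simp
    show "AE x in M. norm (\<psi> x *\<^sub>R h x) \<le> norm (B *\<^sub>R h x)"
      using \<psi>(2) by (auto intro!: mult_right_mono order_trans[OF \<psi>(2)])
  qed (use LpD[OF that] \<psi> in measurable)
  have B: "0 \<le> B" using \<psi>(2)[of undefined] by linarith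
  have L1: "(\<lambda>k. LINT x|M. norm (f k x - g x)) \<longlonglongrightarrow> 0"
  proof (rule LIMSEQ_I)
    fix e :: real assume "e > 0"
    then obtain d where d: "d > 0" "\<And>h :: 'a \<Rightarrow> 'b. h \<in> Lp_on p U \<Longrightarrow> (LINT x|M. norm (h x) powr p) < d \<Longrightarrow> (LINT x|M. norm (h x)) < e"
      using Lp_norm_small by metis
    from LIMSEQ_D[OF lim d(1)] obtain N where "\<forall>k\<ge>N. (LINT x|M. norm (f k x - g x) powr p) < d" by force
    then have "\<forall>k\<ge>N. (LINT x|M. norm (f k x - g x)) < e" using d(2)[OF Lp_diff[OF f]] by blast
    moreover have "0 \<le> (LINT x|M. norm (f k x - g x))" for k by simp
    ultimately show "\<exists>N. \<forall>k\<ge>N. norm ((LINT x|M. norm (f k x - g x)) - 0) < e" by auto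
  qed
  have "(\<lambda>k. B * (LINT x|M. norm (f k x - g x))) \<longlonglongrightarrow> B * 0" by (intro tendsto_intros L1)
  then have L2: "(\<lambda>k. B * (LINT x|M. norm (f k x - g x))) \<longlonglongrightarrow> 0" by simp
  have "norm ((LINT x|M. \<psi> x *\<^sub>R f k x) - (LINT x|M. \<psi> x *\<^sub>R g x)) \<le> B * (LINT x|M. norm (f k x - g x))" for k
  proof -
    have "norm ((LINT x|M. \<psi> x *\<^sub>R f k x) - (LINT x|M. \<psi> x *\<^sub>R g x)) = norm (LINT x|M. \<psi> x *\<^sub>R (f k x - g x))"
      using int f by (simp add: scaleR_diff_right)
    also have "\<dots> \<le> (LINT x|M. norm (\<psi> x *\<^sub>R (f k x - g x)))" by (rule integral_norm_bound)
    also have "\<dots> \<le> (LINT x|M. B * norm (f k x - g x))"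
    proof (rule integral_mono)
      show "integrable M (\<lambda>x. norm (\<psi> x *\<^sub>R (f k x - g x)))"
        by (intro integrable_norm int Lp_diff f)
      show "integrable M (\<lambda>x. B * norm (f k x - g x))"
        by (intro integrable_mult_right integrable_norm Lp_integrable[OF Lp_diff[OF f]])
      fix x show "norm (\<psi> x *\<^sub>R (f k x - g x)) \<le> B * norm (f k x - g x)"
        using \<psi>(2)[of x] by (simp add: mult_right_mono)
    qed
    finally show ?thesis by simp
  qed
  then have "(\<lambda>k. (LINT x|M. \<psi> x *\<^sub>R f k x) - (LINT x|M. \<psi> x *\<^sub>R g x)) \<longlonglongrightarrow> 0"
    by (intro Lim_null_comparison[OF always_eventually L2] allI)
  then show ?thesis by (rule LIM_zero_cancel)
qed

lemma bounded_continuous_Lp: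
  fixes f :: "'a \<Rightarrow> 'b::euclidean_space"
  assumes f: "continuous_on UNIV f"
  shows "f \<in> Lp_on p U"
proof -
  have "f \<in> borel_measurable lborel" using borel_measurable_continuous_onI[OF f] by simp
  then have m: "f \<in> borel_measurable M" by (intro measurable_restrict_space1 measurable_completion)
  have "compact (f ` closure U)"
    using bounded_U by (intro compact_continuous_image continuous_on_subset[OF f]) auto
  then have "bounded (f ` closure U)" by (rule compact_imp_bounded)
  then obtain B where B: "\<And>x. x \<in> closure U \<Longrightarrow> norm (f x) \<le> B" by (auto simp: bounded_iff)
  have "integrable M (\<lambda>x. norm (f x) powr p)"
  proof (rule Bochner_Integration.integrable_bound)
    show "integrable M (\<lambda>x. B powr p)" by simp
    show "AE x in M. norm (norm (f x) powr p) \<le> norm (B powr p)"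
      using B closure_subset[of U] p_gt_1 by (intro AE_I2) (auto intro!: powr_mono2)
  qed (use m in measurable)
  with m show ?thesis by (simp add: Lp_on_def)
qed

section \<open>Weak gradients and the Sobolev spaces\<close>

lemma test_mult_integrable:
  fixes G :: "'a \<Rightarrow> 'b::euclidean_space" and u :: "'a \<Rightarrow> real"
  assumes \<phi>: "\<phi> \<in> test_functions U"
  shows "locally_integrable U G \<Longrightarrow> integrable M (\<lambda>x. \<phi> x *\<^sub>R G x)"
    and "locally_integrable U u \<Longrightarrow> integrable M (\<lambda>x. u x *\<^sub>R grad \<phi> x)"
proof -
  obtain K where K: "smooth \<phi>" "compact K" "K \<subseteq> U" "\<And>x. x \<notin> K \<Longrightarrow> \<phi> x = 0" "\<And>x. x \<notin> K \<Longrightarrow> grad \<phi> x = 0"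
    using test_functionD[OF \<phi>] by blast
  have *: "integrable M f" if h: "locally_integrable U h" and fm: "f \<in> borel_measurable M"
    and f: "\<And>x. x \<in> K \<Longrightarrow> norm (f x) \<le> B * norm (h x)" "\<And>x. x \<notin> K \<Longrightarrow> f x = 0"
    for f :: "'a \<Rightarrow> 'c::euclidean_space" and h :: "'a \<Rightarrow> 'd::euclidean_space" and B
  proof (rule Bochner_Integration.integrable_bound[OF _ fm])
    have "integrable lebesgue (\<lambda>x. indicator K x *\<^sub>R h x)"
      using h K unfolding locally_integrable_def set_integrable_def by blast
    moreover have "indicator U x *\<^sub>R (indicator K x *\<^sub>R h x) = indicator K x *\<^sub>R h x" for x
      using K(3) by (auto simp: indicator_def)
    ultimately have "integrable M (\<lambda>x. indicator K x *\<^sub>R h x)"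
      by (simp only: integrable_restrict_space U_lebesgue Int_UNIV_right space_completion space_lborel space_borel)
    then show "integrable M (\<lambda>x. B *\<^sub>R (indicator K x *\<^sub>R h x))" by (rule integrable_scaleR_right)
    show "AE x in M. norm (f x) \<le> norm (B *\<^sub>R (indicator K x *\<^sub>R h x))"
    proof (rule AE_I2)
      fix x show "norm (f x) \<le> norm (B *\<^sub>R (indicator K x *\<^sub>R h x))"
        using f[of x] mult_right_mono[OF abs_ge_self[of B], of "norm (h x)"] by (cases "x \<in> K") auto
    qed
  qed
  have c: "continuous_on UNIV \<phi>" "continuous_on UNIV (grad \<phi>)" using smoothD[OF K(1)] by auto
  have m: "\<phi> \<in> borel_measurable M" "grad \<phi> \<in> borel_measurable M"
    using LpD(1)[OF bounded_continuous_Lp] c by auto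
  obtain A B where AB: "\<And>x. x \<in> K \<Longrightarrow> \<bar>\<phi> x\<bar> \<le> A" "\<And>x. x \<in> K \<Longrightarrow> norm (grad \<phi> x) \<le> B"
  proof -
    have "bounded (\<phi> ` K)" "bounded (grad \<phi> ` K)"
      by (intro compact_imp_bounded compact_continuous_image K continuous_on_subset[OF c(1)]
          continuous_on_subset[OF c(2)] subset_UNIV)+
    then show thesis using that by (auto simp: bounded_iff)
  qed
  show "integrable M (\<lambda>x. \<phi> x *\<^sub>R G x)" if G: "locally_integrable U G"
    by (rule *[OF G, of _ A])
      (use m locally_integrable_imp_measurable[OF open_U G] AB K in \<open>auto intro!: mult_right_mono\<close>)
  show "integrable M (\<lambda>x. u x *\<^sub>R grad \<phi> x)" if u: "locally_integrable U u"
    by (rule *[OF u, of _ B])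
      (use m locally_integrable_imp_measurable[OF open_U u] AB K in
        \<open>auto intro!: mult_left_mono simp: mult.commute[of B]\<close>)
qed

text \<open>The difference of two candidates annihilates every test function. The almost-everywhere
  identities for the chosen \<open>weak_grad\<close> rest on this.\<close>

lemma weak_gradient_unique:
  assumes G: "has_weak_gradient U u G" and H: "has_weak_gradient U u H"
  shows "AE x in M. G x = H x"
proof -
  have l: "locally_integrable U G" "locally_integrable U H"
    using assms by (auto simp: has_weak_gradient_def)
  have "AE x in M. G x - H x = 0"
  proof (rule AE_zero_if_test_integrals_zero[OF open_U])
    show "locally_integrable U (\<lambda>x. G x - H x)"
      using locally_integrable_lincomb[OF l, of 1 "-1"] by simp
    fix \<phi> assume \<phi>: "\<phi> \<in> test_functions U"
    then show "(LINT x|M. \<phi> x *\<^sub>R (G x - H x)) = 0"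
      using G H test_mult_integrable(1)[OF \<phi> l(1)] test_mult_integrable(1)[OF \<phi> l(2)]
      by (simp add: has_weak_gradient_def scaleR_diff_right)
  qed
  then show ?thesis by eventually_elim simp
qed

lemma has_weak_gradient_lincomb:
  assumes "has_weak_gradient U u G" "has_weak_gradient U v H"
  shows "has_weak_gradient U (\<lambda>x. c * u x + d * v x) (\<lambda>x. c *\<^sub>R G x + d *\<^sub>R H x)"
  unfolding has_weak_gradient_def
proof (intro conjI ballI)
  have l: "locally_integrable U u" "locally_integrable U v" "locally_integrable U G" "locally_integrable U H"
    using assms by (auto simp: has_weak_gradient_def)
  show "locally_integrable U (\<lambda>x. c * u x + d * v x)" "locally_integrable U (\<lambda>x. c *\<^sub>R G x + d *\<^sub>R H x)"
    using locally_integrable_lincomb[OF l(1,2)] locally_integrable_lincomb[OF l(3,4)] by auto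
  fix \<phi> assume \<phi>: "\<phi> \<in> test_functions U"
  note i = test_mult_integrable(2)[OF \<phi> l(1)] test_mult_integrable(2)[OF \<phi> l(2)]
    test_mult_integrable(1)[OF \<phi> l(3)] test_mult_integrable(1)[OF \<phi> l(4)]
  have "(LINT x|M. (c * u x + d * v x) *\<^sub>R grad \<phi> x)
      = (LINT x|M. c *\<^sub>R (u x *\<^sub>R grad \<phi> x) + d *\<^sub>R (v x *\<^sub>R grad \<phi> x))"
    by (simp add: scaleR_add_left)
  also have "\<dots> = c *\<^sub>R (LINT x|M. u x *\<^sub>R grad \<phi> x) + d *\<^sub>R (LINT x|M. v x *\<^sub>R grad \<phi> x)"
    using i by (subst Bochner_Integration.integral_add) (auto simp del: scaleR_scaleR)
  also have "\<dots> = - (c *\<^sub>R (LINT x|M. \<phi> x *\<^sub>R G x) + d *\<^sub>R (LINT x|M. \<phi> x *\<^sub>R H x))"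
    using assms \<phi> by (simp add: has_weak_gradient_def)
  also have "c *\<^sub>R (LINT x|M. \<phi> x *\<^sub>R G x) + d *\<^sub>R (LINT x|M. \<phi> x *\<^sub>R H x)
      = (LINT x|M. c *\<^sub>R (\<phi> x *\<^sub>R G x) + d *\<^sub>R (\<phi> x *\<^sub>R H x))"
    using i by (subst Bochner_Integration.integral_add) (auto simp del: scaleR_scaleR)
  also have "\<dots> = (LINT x|M. \<phi> x *\<^sub>R (c *\<^sub>R G x + d *\<^sub>R H x))"
    by (simp add: scaleR_add_right mult.commute)
  finally show "(LINT x|M. (c * u x + d * v x) *\<^sub>R grad \<phi> x) = - (LINT x|M. \<phi> x *\<^sub>R (c *\<^sub>R G x + d *\<^sub>R H x))" .
qed

text \<open>Membership in \<open>W1p\<close> provides some p-integrable weak gradient, while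
  \<open>weak_grad\<close> may select another one; uniqueness almost everywhere transfers the
  integrability.\<close>

lemma W1pD:
  assumes "u \<in> W1p p U"
  shows "u \<in> Lp_on p U" "has_weak_gradient U u (weak_grad U u)" "weak_grad U u \<in> Lp_on p U"
proof -
  obtain G where G: "has_weak_gradient U u G" "G \<in> Lp_on p U" and u: "u \<in> Lp_on p U"
    using assms by (auto simp: W1p_def)
  show "u \<in> Lp_on p U" by (rule u)
  show w: "has_weak_gradient U u (weak_grad U u)" unfolding weak_grad_def by (rule someI[of "has_weak_gradient U u", OF G(1)])
  have "weak_grad U u \<in> borel_measurable M"
    using w by (intro locally_integrable_imp_measurable[OF open_U]) (simp add: has_weak_gradient_def)
  then show "weak_grad U u \<in> Lp_on p U"
    by (rule Lp_cong_AE[OF G(2)]) (rule weak_gradient_unique[OF G(1) w])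
qed

lemma W1pI: "u \<in> Lp_on p U \<Longrightarrow> has_weak_gradient U u G \<Longrightarrow> G \<in> Lp_on p U \<Longrightarrow> u \<in> W1p p U"
  by (auto simp: W1p_def)

lemma weak_grad_eq: "has_weak_gradient U u G \<Longrightarrow> AE x in M. weak_grad U u x = G x"
  by (rule weak_gradient_unique) (auto simp: weak_grad_def intro: someI[of "has_weak_gradient U u"])

lemma W1p_lincomb:
  assumes "u \<in> W1p p U" "v \<in> W1p p U"
  shows "(\<lambda>x. c * u x + d * v x) \<in> W1p p U"
    "AE x in M. weak_grad U (\<lambda>x. c * u x + d * v x) x = c *\<^sub>R weak_grad U u x + d *\<^sub>R weak_grad U v x"
proof -
  note u = W1pD[OF assms(1)] and v = W1pD[OF assms(2)]
  note h = has_weak_gradient_lincomb[OF u(2) v(2), of c d]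
  show "(\<lambda>x. c * u x + d * v x) \<in> W1p p U"
    using Lp_lincomb[OF u(1) v(1), of c d] Lp_lincomb[OF u(3) v(3), of c d] h by (auto intro: W1pI)
  show "AE x in M. weak_grad U (\<lambda>x. c * u x + d * v x) x = c *\<^sub>R weak_grad U u x + d *\<^sub>R weak_grad U v x"
    using h by (rule weak_grad_eq)
qed

lemma W1p_C1:
  assumes "\<And>x. f differentiable at x" "continuous_on UNIV (grad f)"
  shows "f \<in> W1p p U" "AE x in M. weak_grad U f x = grad f x" "grad f \<in> Lp_on p U"
proof -
  have "continuous_on UNIV f"
    by (intro continuous_at_imp_continuous_on ballI differentiable_imp_continuous_within assms(1))
  then have L: "f \<in> Lp_on p U" "grad f \<in> Lp_on p U" using assms bounded_continuous_Lp by auto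
  have h: "has_weak_gradient U f (grad f)" by (intro has_weak_gradient_C1 assms) simp
  show "f \<in> W1p p U" "AE x in M. weak_grad U f x = grad f x" "grad f \<in> Lp_on p U"
    using L h by (auto intro: W1pI weak_grad_eq)
qed

lemma test_W1p:
  assumes "\<phi> \<in> test_functions U"
  shows "\<phi> \<in> W1p p U" "AE x in M. weak_grad U \<phi> x = grad \<phi> x" "grad \<phi> \<in> Lp_on p U" "\<phi> \<in> Lp_on p U"
proof -
  have s: "smooth \<phi>" using assms by (simp add: test_functions_iff)
  show "\<phi> \<in> W1p p U" "AE x in M. weak_grad U \<phi> x = grad \<phi> x" "grad \<phi> \<in> Lp_on p U"
    using smoothD[OF s] by (auto intro!: W1p_C1)
  then show "\<phi> \<in> Lp_on p U" using W1pD by blast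
qed

text \<open>Separates the Sobolev norm into its two integrals and puts the classical gradient of the
  test function in place of a chosen weak gradient of the difference. Later arguments about
  \<open>W1p0\<close> start from this form.\<close>

lemma W1p0_iff:
  "u \<in> W1p0 p U \<longleftrightarrow> u \<in> W1p p U \<and> (\<exists>\<phi>. (\<forall>k::nat. \<phi> k \<in> test_functions U) \<and>
     (\<lambda>k. LINT x|M. \<bar>u x - \<phi> k x\<bar> powr p) \<longlonglongrightarrow> 0 \<and>
     (\<lambda>k. LINT x|M. norm (weak_grad U u x - grad (\<phi> k) x) powr p) \<longlonglongrightarrow> 0)"
proof -
  have "(\<lambda>k. W1p_norm p U (\<lambda>x. u x - \<phi> k x)) \<longlonglongrightarrow> 0 \<longleftrightarrow>
     (\<lambda>k. LINT x|M. \<bar>u x - \<phi> k x\<bar> powr p) \<longlonglongrightarrow> 0 \<and>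
     (\<lambda>k. LINT x|M. norm (weak_grad U u x - grad (\<phi> k) x) powr p) \<longlonglongrightarrow> 0"
    if u: "u \<in> W1p p U" and \<phi>: "\<forall>k. \<phi> k \<in> test_functions U" for \<phi> :: "nat \<Rightarrow> 'a \<Rightarrow> real"
  proof -
    define A where "A k = (LINT x|M. \<bar>u x - \<phi> k x\<bar> powr p)" for k
    define B where "B k = (LINT x|M. norm (weak_grad U u x - grad (\<phi> k) x) powr p)" for k
    have A0: "0 \<le> A k" and B0: "0 \<le> B k" for k by (auto simp: A_def B_def)
    have "(LINT x|M. norm (weak_grad U (\<lambda>x. u x - \<phi> k x) x) powr p) = B k" for k
    proof -
      have \<phi>k: "\<phi> k \<in> test_functions U" using \<phi> by simp
      note t = test_W1p[OF \<phi>k]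
      note d = W1p_lincomb[OF u t(1), of 1 "-1"]
      show ?thesis unfolding B_def
      proof (rule integral_cong_AE)
        show "(\<lambda>x. norm (weak_grad U (\<lambda>x. u x - \<phi> k x) x) powr p) \<in> borel_measurable M"
          using LpD(2)[OF W1pD(3)[OF d(1)]] by simp
        show "(\<lambda>x. norm (weak_grad U u x - grad (\<phi> k) x) powr p) \<in> borel_measurable M"
          using LpD(2)[OF Lp_diff[OF W1pD(3)[OF u] t(3)]] by simp
        show "AE x in M. norm (weak_grad U (\<lambda>x. u x - \<phi> k x) x) powr p = norm (weak_grad U u x - grad (\<phi> k) x) powr p"
          using d(2) t(2) by eventually_elim simp
      qed
    qed
    then have N: "W1p_norm p U (\<lambda>x. u x - \<phi> k x) = (A k + B k) powr (1 / p)" for k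
      by (simp add: W1p_norm_def A_def)
    have "(\<lambda>k. (A k + B k) powr (1 / p)) \<longlonglongrightarrow> 0 \<longleftrightarrow> A \<longlonglongrightarrow> 0 \<and> B \<longlonglongrightarrow> 0"
    proof
      assume "(\<lambda>k. (A k + B k) powr (1 / p)) \<longlonglongrightarrow> 0"
      then have "(\<lambda>k. ((A k + B k) powr (1 / p)) powr p) \<longlonglongrightarrow> 0 powr p"
        using p_gt_1 by (intro tendsto_powr' tendsto_const) auto
      then have AB: "(\<lambda>k. A k + B k) \<longlonglongrightarrow> 0" using p_gt_1 A0 B0 by (simp add: powr_powr)
      show "A \<longlonglongrightarrow> 0 \<and> B \<longlonglongrightarrow> 0"
        using A0 B0 by (auto intro!: tendsto_sandwich[OF _ _ tendsto_const AB] always_eventually)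
    next
      assume "A \<longlonglongrightarrow> 0 \<and> B \<longlonglongrightarrow> 0"
      then have "(\<lambda>k. (A k + B k) powr (1 / p)) \<longlonglongrightarrow> (0 + 0) powr (1 / p)"
        using p_gt_1 A0 B0 by (intro tendsto_powr' tendsto_add tendsto_const) auto
      then show "(\<lambda>k. (A k + B k) powr (1 / p)) \<longlonglongrightarrow> 0" by simp
    qed
    then show ?thesis unfolding N by (simp add: A_def[abs_def] B_def[abs_def])
  qed
  then show ?thesis unfolding W1p0_def by blast
qed

lemma W1p0E:
  assumes "u \<in> W1p0 p U"
  obtains \<phi> where "u \<in> W1p p U" "\<forall>k::nat. \<phi> k \<in> test_functions U"
     "(\<lambda>k. LINT x|M. \<bar>u x - \<phi> k x\<bar> powr p) \<longlonglongrightarrow> 0"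
     "(\<lambda>k. LINT x|M. norm (weak_grad U u x - grad (\<phi> k) x) powr p) \<longlonglongrightarrow> 0"
  using assms unfolding W1p0_iff by (elim conjE exE) (rule that; assumption)

lemma Lp_tendsto_lincomb:
  fixes f g :: "'a \<Rightarrow> 'b::euclidean_space"
  assumes L: "f \<in> Lp_on p U" "g \<in> Lp_on p U" "\<And>k. f' k \<in> Lp_on p U" "\<And>k. g' k \<in> Lp_on p U"
    and lim: "(\<lambda>k. LINT x|M. norm (f x - f' k x) powr p) \<longlonglongrightarrow> 0" "(\<lambda>k. LINT x|M. norm (g x - g' k x) powr p) \<longlonglongrightarrow> 0"
  shows "(\<lambda>k::nat. LINT x|M. norm ((c *\<^sub>R f x + d *\<^sub>R g x) - (c *\<^sub>R f' k x + d *\<^sub>R g' k x)) powr p) \<longlonglongrightarrow> 0"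
proof (rule tendsto_sandwich[OF _ _ tendsto_const])
  let ?e = "\<lambda>k x. (c *\<^sub>R f x + d *\<^sub>R g x) - (c *\<^sub>R f' k x + d *\<^sub>R g' k x)"
  let ?r = "\<lambda>k x. 2 powr p * (\<bar>c\<bar> powr p * norm (f x - f' k x) powr p + \<bar>d\<bar> powr p * norm (g x - g' k x) powr p)"
  let ?b = "\<lambda>k. 2 powr p * (\<bar>c\<bar> powr p * (LINT x|M. norm (f x - f' k x) powr p) + \<bar>d\<bar> powr p * (LINT x|M. norm (g x - g' k x) powr p))"
  have "?b \<longlonglongrightarrow> 2 powr p * (\<bar>c\<bar> powr p * 0 + \<bar>d\<bar> powr p * 0)" by (intro tendsto_intros lim)
  then show "?b \<longlonglongrightarrow> 0" by simp
  have "(LINT x|M. norm (?e k x) powr p) \<le> ?b k" for k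
  proof -
    note l1 = LpD(2)[OF Lp_diff[OF L(1) L(3)[of k]]] LpD(2)[OF Lp_diff[OF L(2) L(4)[of k]]]
    have "(LINT x|M. norm (?e k x) powr p)
       \<le> (LINT x|M. ?r k x)"
    proof (rule integral_mono)
      show "integrable M (\<lambda>x. norm (?e k x) powr p)"
        by (intro LpD Lp_diff Lp_lincomb L)
      show "integrable M (\<lambda>x. ?r k x)"
        using l1 by simp
      fix x
      have "?e k x = c *\<^sub>R (f x - f' k x) + d *\<^sub>R (g x - g' k x)"
        by (simp add: algebra_simps)
      then show "norm (?e k x) powr p
        \<le> ?r k x"
        using norm_add_powr_le2[OF p_gt_1, of "c *\<^sub>R (f x - f' k x)" "d *\<^sub>R (g x - g' k x)"] by (simp add: powr_mult)
    qed
    also have "\<dots> = ?b k" using l1 by simp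
    finally show ?thesis .
  qed
  then show "\<forall>\<^sub>F k in sequentially. (LINT x|M. norm (?e k x) powr p) \<le> ?b k"
    by simp
qed simp

lemma W1p0_lincomb:
  assumes "u \<in> W1p0 p U" "v \<in> W1p0 p U"
  shows "(\<lambda>x. c * u x + d * v x) \<in> W1p0 p U"
proof -
  let ?H = "\<lambda>x. c *\<^sub>R weak_grad U u x + d *\<^sub>R weak_grad U v x" and ?W = "weak_grad U (\<lambda>x. c * u x + d * v x)"
  obtain \<phi> where u: "u \<in> W1p p U" "\<forall>k::nat. \<phi> k \<in> test_functions U"
     "(\<lambda>k. LINT x|M. \<bar>u x - \<phi> k x\<bar> powr p) \<longlonglongrightarrow> 0"
     "(\<lambda>k. LINT x|M. norm (weak_grad U u x - grad (\<phi> k) x) powr p) \<longlonglongrightarrow> 0"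
    by (rule W1p0E[OF assms(1)])
  obtain \<psi> where v: "v \<in> W1p p U" "\<forall>k::nat. \<psi> k \<in> test_functions U"
     "(\<lambda>k. LINT x|M. \<bar>v x - \<psi> k x\<bar> powr p) \<longlonglongrightarrow> 0"
     "(\<lambda>k. LINT x|M. norm (weak_grad U v x - grad (\<psi> k) x) powr p) \<longlonglongrightarrow> 0"
    by (rule W1p0E[OF assms(2)])
  let ?T = "\<lambda>k. grad (\<lambda>x. c * \<phi> k x + d * \<psi> k x)" and ?G = "\<lambda>k x. c *\<^sub>R grad (\<phi> k) x + d *\<^sub>R grad (\<psi> k) x"
  note t = test_W1p[OF u(2)[rule_format]] test_W1p[OF v(2)[rule_format]]
  note w = W1p_lincomb[OF u(1) v(1), of c d]
  have d: "\<phi> k differentiable at x" "\<psi> k differentiable at x" for k x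
    using u(2) v(2) by (auto intro!: smoothD(1) simp: test_functions_def)
  have "(\<lambda>k. LINT x|M. norm ((c *\<^sub>R u x + d *\<^sub>R v x) - (c *\<^sub>R \<phi> k x + d *\<^sub>R \<psi> k x)) powr p) \<longlonglongrightarrow> 0"
    by (rule Lp_tendsto_lincomb) (use u v W1pD(1) t in auto)
  moreover have "(\<lambda>k. LINT x|M. norm (?W x - ?T k x) powr p) \<longlonglongrightarrow> 0"
  proof (rule Lim_transform_eventually)
    show "(\<lambda>k. LINT x|M. norm (?H x - ?G k x) powr p) \<longlonglongrightarrow> 0"
      by (rule Lp_tendsto_lincomb) (use u v W1pD(3) t in auto)
    have "(LINT x|M. norm (?H x - ?G k x) powr p)
        = (LINT x|M. norm (?W x - ?T k x) powr p)" for k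
    proof (rule integral_cong_AE)
      have grad_eq: "?T k = (\<lambda>x. c *\<^sub>R grad (\<phi> k) x + d *\<^sub>R grad (\<psi> k) x)"
        by (intro ext grad_lincomb d)
      have g: "(\<lambda>x. c *\<^sub>R grad (\<phi> k) x + d *\<^sub>R grad (\<psi> k) x) \<in> Lp_on p U" by (intro Lp_lincomb t)
      then have g': "?T k \<in> Lp_on p U"
        by (simp only: grad_eq)
      show "(\<lambda>x. norm (?H x - ?G k x) powr p) \<in> borel_measurable M"
        using LpD(2)[OF Lp_diff[OF Lp_lincomb[OF W1pD(3)[OF u(1)] W1pD(3)[OF v(1)]] g]] by auto
      show "(\<lambda>x. norm (?W x - ?T k x) powr p) \<in> borel_measurable M"
        using LpD(2)[OF Lp_diff[OF W1pD(3)[OF w(1)] g']] by auto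
      show "AE x in M. norm (?H x - ?G k x) powr p
        = norm (?W x - ?T k x) powr p"
        using w(2) by eventually_elim (simp add: grad_lincomb d)
    qed
    then show "\<forall>\<^sub>F k in sequentially. (LINT x|M. norm (?H x - ?G k x) powr p)
        = (LINT x|M. norm (?W x - ?T k x) powr p)"
      by simp
  qed
  moreover have "(\<lambda>x. c * \<phi> k x + d * \<psi> k x) \<in> test_functions U" for k
    using u v by (intro test_functions_lincomb) auto
  ultimately show ?thesis using w(1) unfolding W1p0_iff
    by (intro conjI exI[of _ "\<lambda>k x. c * \<phi> k x + d * \<psi> k x"]) auto
qed

text \<open>Integrate the derivative of \<open>(x \<bullet> e) |\<phi>|\<^sup>p\<close> in a direction \<open>e\<close>.\<close>

lemma Poincare_test:
  "\<exists>C>0. \<forall>\<phi>\<in>test_functions U. (LINT x|M. \<bar>\<phi> x\<bar> powr p) \<le> C * (LINT x|M. norm (grad \<phi> x) powr p)"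
proof -
  obtain R where R: "R > 0" "\<And>x. x \<in> U \<Longrightarrow> norm x \<le> R" using bounded_U by (auto simp: bounded_pos)
  \<comment> \<open>This value gives the absorbed term the coefficient 1/2; moving it to the left
    doubles the gradient term, which explains the factor 2 in \<open>C\<close>.\<close>
  define \<epsilon> where "\<epsilon> = 1 / (2 * p * R)"
  have \<epsilon>: "\<epsilon> > 0" "p * R * \<epsilon> = 1 / 2" using R p_gt_1 by (auto simp: \<epsilon>_def)
  define C where "C = 2 * p * R * \<epsilon> powr (1 - p)"
  have C: "C > 0" using \<epsilon> R p_gt_1 by (simp add: C_def)
  obtain e :: 'a where e: "e \<in> Basis" using nonempty_Basis by blast
  have "(LINT x|M. \<bar>\<phi> x\<bar> powr p) \<le> C * (LINT x|M. norm (grad \<phi> x) powr p)" if \<phi>: "\<phi> \<in> test_functions U" for \<phi>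
  proof -
    let ?w = "\<lambda>x. p * R * (\<epsilon> * \<bar>\<phi> x\<bar> powr p + \<epsilon> powr (1 - p) * norm (grad \<phi> x) powr p)"
    obtain K where K: "smooth \<phi>" "compact K" "K \<subseteq> U" "\<And>x. x \<notin> K \<Longrightarrow> \<phi> x = 0" "\<And>x. x \<notin> K \<Longrightarrow> grad \<phi> x = 0"
      using test_functionD[OF \<phi>] by blast
    have c: "continuous_on UNIV \<phi>" "continuous_on UNIV (grad \<phi>)" using smoothD[OF K(1)] by auto
    \<comment> \<open>The part of the derivative along \<open>e\<close> in which the power is
      differentiated. The other part comes from \<open>x \<bullet> e\<close> and is
      \<open>\<bar>\<phi> x\<bar> powr p\<close>, the quantity to be estimated.\<close>
    define g where "g x = (x \<bullet> e) * (p * p_flux p (\<phi> x) * (grad \<phi> x \<bullet> e))" for x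
    have cg: "continuous_on UNIV (\<lambda>x. \<bar>\<phi> x\<bar> powr p)" "continuous_on UNIV g"
      unfolding g_def using p_gt_1 c continuous_on_norm_powr[of p UNIV \<phi>]
      by (auto intro!: continuous_intros continuous_on_compose2[OF continuous_on_p_flux[OF p_gt_1, of UNIV]])
    have z: "\<bar>\<phi> x\<bar> powr p = 0" "g x = 0" if "x \<notin> K" for x using K that by (auto simp: g_def)
    have "((\<lambda>x. (x \<bullet> e) * \<bar>\<phi> x\<bar> powr p) has_derivative
        (\<lambda>h. (x \<bullet> e) * (p * p_flux p (\<phi> x) * (h \<bullet> grad \<phi> x)) + (h \<bullet> e) * \<bar>\<phi> x\<bar> powr p)) (at x)" for x
    proof (rule has_derivative_mult)
      show "((\<lambda>x. x \<bullet> e) has_derivative (\<lambda>h. h \<bullet> e)) (at x)" by (auto intro!: derivative_eq_intros)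
      have "((\<lambda>s. \<bar>s\<bar> powr p) has_derivative (\<lambda>h. p * p_flux p (\<phi> x) * h)) (at (\<phi> x))"
        using DERIV_abs_powr[OF p_gt_1, of "\<phi> x"] by (simp add: has_field_derivative_def)
      with has_derivative_grad[OF smoothD(1)[OF K(1)], of x]
      show "((\<lambda>x. \<bar>\<phi> x\<bar> powr p) has_derivative (\<lambda>h. p * p_flux p (\<phi> x) * (h \<bullet> grad \<phi> x))) (at x)"
        by (rule has_derivative_compose)
    qed
    then have "(LINT x|lborel. (x \<bullet> e) * (p * p_flux p (\<phi> x) * (e \<bullet> grad \<phi> x)) + (e \<bullet> e) * \<bar>\<phi> x\<bar> powr p) = 0"
    proof (rule integral_directional_derivative_eq_0[OF _ _ K(2)])
      show "continuous_on UNIV (\<lambda>x. (x \<bullet> e) * (p * p_flux p (\<phi> x) * (e \<bullet> grad \<phi> x)) + (e \<bullet> e) * \<bar>\<phi> x\<bar> powr p)"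
        using cg by (auto simp: g_def inner_commute intro!: continuous_intros)
    qed (use K in auto)
    then have "(LINT x|lborel. g x + \<bar>\<phi> x\<bar> powr p) = 0" using e by (simp add: g_def inner_commute)
    then have 1: "(LINT x|lborel. \<bar>\<phi> x\<bar> powr p) = (LINT x|lborel. - g x)"
      using integrable_compact_support[OF cg(1) K(2) z(1)] integrable_compact_support[OF cg(2) K(2) z(2)] by simp
    have ig: "integrable M g" and "integral\<^sup>L M g = integral\<^sup>L lborel g"
      "(LINT x|M. \<bar>\<phi> x\<bar> powr p) = (LINT x|lborel. \<bar>\<phi> x\<bar> powr p)"
      using K(3) by (auto intro!: lebesgue_on_compact_support[OF cg(1) K(2) z(1)] lebesgue_on_compact_support[OF cg(2) K(2) z(2)])
    with 1 have "(LINT x|M. \<bar>\<phi> x\<bar> powr p) = (LINT x|M. - g x)" by simp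
    also have "\<dots> \<le> (LINT x|M. ?w x)"
    proof (rule integral_mono)
      show "integrable M ?w"
        using LpD(2)[OF test_W1p(3)[OF \<phi>]] LpD(2)[OF test_W1p(4)[OF \<phi>]] by auto
      show "integrable M (\<lambda>x. - g x)" using ig by simp
      fix x assume "x \<in> space M"
      then have xR: "norm x \<le> R" using R by simp
      have "\<bar>x \<bullet> e\<bar> \<le> norm x" using Cauchy_Schwarz_ineq2[of x e] e by simp
      then have 2: "\<bar>x \<bullet> e\<bar> \<le> R" using xR by linarith
      have 3: "\<bar>grad \<phi> x \<bullet> e\<bar> \<le> norm (grad \<phi> x)" using Cauchy_Schwarz_ineq2[of "grad \<phi> x" e] e by simp
      have "- g x \<le> \<bar>x \<bullet> e\<bar> * (p * \<bar>p_flux p (\<phi> x)\<bar> * \<bar>grad \<phi> x \<bullet> e\<bar>)"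
        using p_gt_1 abs_ge_minus_self[of "g x"] by (simp add: g_def abs_mult)
      also have "\<dots> \<le> R * (p * \<bar>p_flux p (\<phi> x)\<bar> * norm (grad \<phi> x))"
        using 2 3 p_gt_1 R by (intro mult_mono) auto
      also have "\<dots> = p * R * (\<bar>\<phi> x\<bar> powr (p - 1) * norm (grad \<phi> x))"
        using norm_p_flux[of p "\<phi> x"] by simp
      also have "\<dots> \<le> ?w x"
        using p_gt_1 R \<epsilon> by (intro mult_left_mono powr_mult_le_eps) auto
      finally show "- g x \<le> ?w x" .
    qed
    also have "\<dots> = p * R * \<epsilon> * (LINT x|M. \<bar>\<phi> x\<bar> powr p) + p * R * \<epsilon> powr (1 - p) * (LINT x|M. norm (grad \<phi> x) powr p)"
      using LpD(2)[OF test_W1p(3)[OF \<phi>]] LpD(2)[OF test_W1p(4)[OF \<phi>]] by (simp add: algebra_simps)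
    finally show ?thesis unfolding \<epsilon>(2) by (simp add: C_def)
  qed
  with C show ?thesis by blast
qed

end


section \<open>The weighted p-Laplace equation\<close>

locale conductivity = bounded_open +
  fixes \<gamma> :: "'a \<Rightarrow> real" and \<gamma>\<^sub>0 \<gamma>\<^sub>1 :: real
  assumes \<gamma>_measurable: "\<gamma> \<in> borel_measurable M"
    and \<gamma>\<^sub>0_pos: "0 < \<gamma>\<^sub>0"
    and \<gamma>_ge: "AE x in M. \<gamma>\<^sub>0 \<le> \<gamma> x"
    and \<gamma>_le: "AE x in M. \<gamma> x \<le> \<gamma>\<^sub>1"
begin

text \<open>The argument is an arbitrary vector field: a minimizing sequence converges as a sequence
  of fields, before its limit is recognized as a weak gradient.\<close>

definition energy :: "('a \<Rightarrow> 'a) \<Rightarrow> real" where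
  "energy A = (LINT x|M. \<gamma> x * norm (A x) powr p)"

section \<open>Continuity and first variation of the energy\<close>

lemma integrable_\<gamma>_mult:
  fixes h :: "'a \<Rightarrow> real"
  assumes "integrable M h"
  shows "integrable M (\<lambda>x. \<gamma> x * h x)"
proof (rule Bochner_Integration.integrable_bound)
  show "integrable M (\<lambda>x. \<gamma>\<^sub>1 * h x)" using assms by simp
  show "AE x in M. norm (\<gamma> x * h x) \<le> norm (\<gamma>\<^sub>1 * h x)"
    using \<gamma>_ge \<gamma>_le
  proof eventually_elim
    case (elim x)
    then have "\<bar>\<gamma> x\<bar> \<le> \<bar>\<gamma>\<^sub>1\<bar>" using \<gamma>\<^sub>0_pos by linarith
    then show ?case by (simp add: abs_mult mult_right_mono)
  qed
qed (use assms \<gamma>_measurable in measurable)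

lemma \<gamma>_integral_mono:
  fixes g h :: "'a \<Rightarrow> real"
  assumes "integrable M g" "integrable M h" "\<And>x. x \<in> U \<Longrightarrow> g x \<le> h x"
  shows "(LINT x|M. \<gamma> x * g x) \<le> (LINT x|M. \<gamma> x * h x)"
proof (rule integral_mono_AE)
  show "AE x in M. \<gamma> x * g x \<le> \<gamma> x * h x"
    using \<gamma>_ge AE_space
  proof eventually_elim
    case (elim x)
    then show ?case using assms(3) \<gamma>\<^sub>0_pos by (intro mult_left_mono) auto
  qed
qed (use assms integrable_\<gamma>_mult in auto)

lemma energy_integrable: "A \<in> Lp_on p U \<Longrightarrow> integrable M (\<lambda>x. \<gamma> x * norm (A x) powr p)"
  by (intro integrable_\<gamma>_mult LpD)

lemma energy_ge: "A \<in> Lp_on p U \<Longrightarrow> \<gamma>\<^sub>0 * (LINT x|M. norm (A x) powr p) \<le> energy A"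
  unfolding energy_def integral_mult_right_zero[symmetric]
proof (rule integral_mono_AE)
  assume A: "A \<in> Lp_on p U"
  show "integrable M (\<lambda>x. \<gamma>\<^sub>0 * norm (A x) powr p)" using LpD(2)[OF A] by simp
  show "AE x in M. \<gamma>\<^sub>0 * norm (A x) powr p \<le> \<gamma> x * norm (A x) powr p"
    using \<gamma>_ge by eventually_elim (simp add: mult_right_mono)
qed (rule energy_integrable)

lemma energy_le: "A \<in> Lp_on p U \<Longrightarrow> energy A \<le> \<gamma>\<^sub>1 * (LINT x|M. norm (A x) powr p)"
  unfolding energy_def integral_mult_right_zero[symmetric]
proof (rule integral_mono_AE)
  assume A: "A \<in> Lp_on p U"
  show "integrable M (\<lambda>x. \<gamma>\<^sub>1 * norm (A x) powr p)" using LpD(2)[OF A] by simp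
  show "AE x in M. \<gamma> x * norm (A x) powr p \<le> \<gamma>\<^sub>1 * norm (A x) powr p"
    using \<gamma>_le by eventually_elim (simp add: mult_right_mono)
qed (rule energy_integrable)

lemma energy_nonneg: "0 \<le> energy A"
  unfolding energy_def
proof (rule integral_nonneg_AE)
  show "AE x in M. 0 \<le> \<gamma> x * norm (A x) powr p" using \<gamma>_ge
    by eventually_elim (use \<gamma>\<^sub>0_pos in auto)
qed

lemma energy_perturb:
  assumes A: "A \<in> Lp_on p U" and B: "B \<in> Lp_on p U" and t: "0 < t" "t < 1"
  shows "energy A \<le> (1 - t) powr (1 - p) * energy B + t powr (1 - p) * energy (\<lambda>x. A x - B x)"
proof -
  note i = LpD(2)[OF B] LpD(2)[OF Lp_diff[OF A B]] energy_integrable[OF B] energy_integrable[OF Lp_diff[OF A B]]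
  have "energy A \<le> (LINT x|M. \<gamma> x * ((1 - t) powr (1 - p) * norm (B x) powr p + t powr (1 - p) * norm (A x - B x) powr p))"
    unfolding energy_def
  proof (rule \<gamma>_integral_mono[OF LpD(2)[OF A]])
    fix x show "norm (A x) powr p \<le> (1 - t) powr (1 - p) * norm (B x) powr p + t powr (1 - p) * norm (A x - B x) powr p"
      using norm_add_powr_le[OF p_gt_1 t, of "B x" "A x - B x"] by simp
  qed (use i in auto)
  also have "\<dots> = (LINT x|M. (1 - t) powr (1 - p) * (\<gamma> x * norm (B x) powr p) + t powr (1 - p) * (\<gamma> x * norm (A x - B x) powr p))"
    by (simp add: algebra_simps)
  also have "\<dots> = (1 - t) powr (1 - p) * energy B + t powr (1 - p) * energy (\<lambda>x. A x - B x)"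
    unfolding energy_def using i by simp
  finally show ?thesis .
qed

lemma le_of_powr_factor:
  fixes c y :: real
  assumes "\<And>t. 0 < t \<Longrightarrow> t < 1 \<Longrightarrow> c \<le> (1 - t) powr (1 - p) * y"
  shows "c \<le> y"
proof (rule LIMSEQ_le_const)
  have "(\<lambda>n. (1 - inverse (real (Suc n))) powr (1 - p) * y) \<longlonglongrightarrow> (1 - 0) powr (1 - p) * y"
    by (intro tendsto_intros LIMSEQ_inverse_real_of_nat) auto
  then show "(\<lambda>n. (1 - inverse (real (Suc n))) powr (1 - p) * y) \<longlonglongrightarrow> y" by simp
  show "\<exists>N. \<forall>n\<ge>N. c \<le> (1 - inverse (real (Suc n))) powr (1 - p) * y"
    \<comment> \<open>Index 0 would give \<open>t = 1\<close>, which the assumption excludes; from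
      index 1 on, \<open>t\<close> lies strictly between 0 and 1.\<close>
    by (intro exI[of _ 1] allI impI assms) (auto simp: field_simps)
qed

text \<open>\<open>energy_perturb\<close> is used in both directions. For fixed \<open>t\<close> the
  energy of the difference tends to 0 along the sequence; letting \<open>t\<close> tend to 0
  afterwards removes the remaining factor.\<close>

lemma energy_limit:
  assumes A: "\<And>k::nat. A k \<in> Lp_on p U" and B: "B \<in> Lp_on p U"
    and lim: "(\<lambda>k. LINT x|M. norm (A k x - B x) powr p) \<longlonglongrightarrow> 0"
  shows "(\<And>k. c \<le> energy (A k)) \<Longrightarrow> c \<le> energy B"
    and "(\<lambda>k. energy (A k)) \<longlonglongrightarrow> c \<Longrightarrow> energy B \<le> c"
proof -
  have d: "(\<lambda>k. energy (\<lambda>x. A k x - B x)) \<longlonglongrightarrow> 0"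
  proof (rule tendsto_sandwich[OF _ _ tendsto_const])
    have "(\<lambda>k. \<gamma>\<^sub>1 * (LINT x|M. norm (A k x - B x) powr p)) \<longlonglongrightarrow> \<gamma>\<^sub>1 * 0" by (intro tendsto_intros lim)
    then show "(\<lambda>k. \<gamma>\<^sub>1 * (LINT x|M. norm (A k x - B x) powr p)) \<longlonglongrightarrow> 0" by simp
  qed (auto intro!: always_eventually energy_nonneg energy_le Lp_diff A B)
  have d': "energy (\<lambda>x. B x - A k x) = energy (\<lambda>x. A k x - B x)" for k
    by (simp add: energy_def norm_minus_commute)
  show "c \<le> energy B" if c: "\<And>k. c \<le> energy (A k)"
  proof (rule le_of_powr_factor)
    fix t :: real assume t: "0 < t" "t < 1"
    have "(\<lambda>k. (1 - t) powr (1 - p) * energy B + t powr (1 - p) * energy (\<lambda>x. A k x - B x))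
      \<longlonglongrightarrow> (1 - t) powr (1 - p) * energy B + t powr (1 - p) * 0" by (intro tendsto_intros d)
    then have "c \<le> (1 - t) powr (1 - p) * energy B + t powr (1 - p) * 0"
      by (rule LIMSEQ_le_const) (use energy_perturb[OF A B t] c order_trans in blast)
    then show "c \<le> (1 - t) powr (1 - p) * energy B" by simp
  qed
  show "energy B \<le> c" if c: "(\<lambda>k. energy (A k)) \<longlonglongrightarrow> c"
  proof (rule le_of_powr_factor)
    fix t :: real assume t: "0 < t" "t < 1"
    have "(\<lambda>k. (1 - t) powr (1 - p) * energy (A k) + t powr (1 - p) * energy (\<lambda>x. A k x - B x))
      \<longlonglongrightarrow> (1 - t) powr (1 - p) * c + t powr (1 - p) * 0" by (intro tendsto_intros d c)
    then have "energy B \<le> (1 - t) powr (1 - p) * c + t powr (1 - p) * 0"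
      by (rule LIMSEQ_le_const) (use energy_perturb[OF B A t] d' in auto)
    then show "energy B \<le> (1 - t) powr (1 - p) * c" by simp
  qed
qed

lemma p_flux_measurable [measurable]: "p_flux p \<in> borel_measurable borel"
  using continuous_on_p_flux[OF p_gt_1, of UNIV] by (rule borel_measurable_continuous_onI)

lemma flux_integrable:
  assumes A: "A \<in> Lp_on p U" and B: "B \<in> Lp_on p U"
  shows "integrable M (\<lambda>x. p_flux p (A x) \<bullet> B x)"
proof (rule Bochner_Integration.integrable_bound)
  show "integrable M (\<lambda>x. norm (A x) powr p + norm (B x) powr p)" using LpD[OF A] LpD[OF B] by simp
  show "AE x in M. norm (p_flux p (A x) \<bullet> B x) \<le> norm (norm (A x) powr p + norm (B x) powr p)"
  proof (rule AE_I2)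
    fix x show "norm (p_flux p (A x) \<bullet> B x) \<le> norm (norm (A x) powr p + norm (B x) powr p)"
      using abs_p_flux_inner_le[of p "A x" "B x"] powr_mult_le_eps[OF p_gt_1, of "norm (A x)" "norm (B x)" 1] by simp
  qed
  have [measurable]: "A \<in> borel_measurable M" "B \<in> borel_measurable M" using LpD[OF A] LpD[OF B] by auto
  show "(\<lambda>x. p_flux p (A x) \<bullet> B x) \<in> borel_measurable M" by measurable
qed

text \<open>No derivative is taken under the integral: the tangent inequality at the perturbed field
  bounds the increase of the energy by \<open>p * s\<close> times the integral of
  \<open>\<gamma>\<close> times the perturbed flux paired with \<open>B\<close>. That integral is
  thus nonnegative, and dominated convergence lets \<open>s\<close> tend to 0.\<close>

lemma flux_nonneg_of_minimal:
  assumes A: "A \<in> Lp_on p U" and B: "B \<in> Lp_on p U"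
    and min: "\<And>s. 0 < s \<Longrightarrow> energy A \<le> energy (\<lambda>x. A x + s *\<^sub>R B x)"
  shows "0 \<le> (LINT x|M. \<gamma> x * (p_flux p (A x) \<bullet> B x))"
proof -
  define s where "s n = inverse (real (Suc n))" for n
  have s: "0 < s n" "s n \<le> 1" for n by (auto simp: s_def inverse_le_1_iff)
  let ?Z = "\<lambda>n x. A x + s n *\<^sub>R B x" and ?F = "\<lambda>n x. p_flux p (A x + s n *\<^sub>R B x) \<bullet> B x"
  have L: "(?Z n) \<in> Lp_on p U" for n using Lp_lincomb[OF A B, of 1 "s n"] by simp
  have nonneg: "0 \<le> (LINT x|M. \<gamma> x * ?F n x)" for n
  proof -
    have "energy (?Z n) \<le>
        (LINT x|M. \<gamma> x * (norm (A x) powr p + p * s n * ?F n x))"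
      unfolding energy_def
    proof (rule \<gamma>_integral_mono[OF LpD(2)[OF L]])
      show "integrable M (\<lambda>x. norm (A x) powr p + p * s n * ?F n x)"
        using LpD[OF A] flux_integrable[OF L B] by simp
      fix x
      let ?Y = "?Z n x"
      have "p * (p_flux p ?Y \<bullet> A x) \<le> (p - 1) * norm ?Y powr p + norm (A x) powr p"
        by (rule p_flux_inner_le[OF p_gt_1])
      moreover have "p_flux p ?Y \<bullet> A x = norm ?Y powr p - s n * (p_flux p ?Y \<bullet> B x)"
        using p_flux_inner_self[of p ?Y] by (simp add: inner_add_right)
      ultimately show "norm ?Y powr p \<le> norm (A x) powr p + p * s n * (p_flux p ?Y \<bullet> B x)"
        by (simp add: algebra_simps)
    qed
    also have "\<dots> = (LINT x|M. \<gamma> x * norm (A x) powr p + p * s n * (\<gamma> x * ?F n x))"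
      by (simp add: algebra_simps)
    also have "\<dots> = energy A + p * s n * (LINT x|M. \<gamma> x * ?F n x)"
      using energy_integrable[OF A] integrable_\<gamma>_mult[OF flux_integrable[OF L B], of n] by (simp add: energy_def)
    finally have "0 \<le> p * s n * (LINT x|M. \<gamma> x * ?F n x)"
      using min[OF s(1)[of n]] by linarith
    moreover have "0 < p * s n" using s(1)[of n] p_gt_1 by simp
    ultimately show ?thesis by (metis mult_le_cancel_left_pos mult_zero_right)
  qed
  have [measurable]: "A \<in> borel_measurable M" "B \<in> borel_measurable M" "\<gamma> \<in> borel_measurable M"
    using LpD[OF A] LpD[OF B] \<gamma>_measurable by auto
  have "(\<lambda>n. LINT x|M. \<gamma> x * ?F n x) \<longlonglongrightarrow> (LINT x|M. \<gamma> x * (p_flux p (A x) \<bullet> B x))"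
  proof (rule integral_dominated_convergence)
    \<comment> \<open>A bound for all \<open>n\<close> at once, obtained from
      \<open>s n \<le> 1\<close> and the p-th power of a sum.\<close>
    let ?w = "\<lambda>x. \<gamma>\<^sub>1 * (2 powr p * (norm (A x) powr p + norm (B x) powr p) + norm (B x) powr p)"
    show "integrable M ?w" using LpD[OF A] LpD[OF B] by simp
    show "AE x in M. (\<lambda>n. \<gamma> x * ?F n x) \<longlonglongrightarrow> \<gamma> x * (p_flux p (A x) \<bullet> B x)"
    proof (rule AE_I2)
      fix x
      have "(\<lambda>n. A x + s n *\<^sub>R B x) \<longlonglongrightarrow> A x + 0 *\<^sub>R B x"
        unfolding s_def by (intro tendsto_intros LIMSEQ_inverse_real_of_nat)
      then have "(\<lambda>n. A x + s n *\<^sub>R B x) \<longlonglongrightarrow> A x" by simp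
      from isCont_tendsto_compose[OF isCont_p_flux[OF p_gt_1] this]
      show "(\<lambda>n. \<gamma> x * ?F n x) \<longlonglongrightarrow> \<gamma> x * (p_flux p (A x) \<bullet> B x)"
        by (intro tendsto_intros)
    qed
    show "AE x in M. norm (\<gamma> x * ?F n x) \<le> ?w x" for n
      using \<gamma>_ge \<gamma>_le
    proof eventually_elim
      case (elim x)
      have "norm (s n *\<^sub>R B x) powr p \<le> norm (B x) powr p"
        using s[of n] p_gt_1 by (intro powr_mono2) (auto simp: mult_left_le_one_le)
      then have "norm (?Z n x) powr p \<le> 2 powr p * (norm (A x) powr p + norm (B x) powr p)"
        by (intro order_trans[OF norm_add_powr_le2[OF p_gt_1]] mult_left_mono add_left_mono) auto
      moreover have "\<bar>?F n x\<bar> \<le> norm (?Z n x) powr p + norm (B x) powr p"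
        using abs_p_flux_inner_le[of p "?Z n x" "B x"]
          powr_mult_le_eps[OF p_gt_1, of "norm (?Z n x)" "norm (B x)" 1] by simp
      ultimately have "\<bar>?F n x\<bar> \<le> 2 powr p * (norm (A x) powr p + norm (B x) powr p) + norm (B x) powr p"
        by linarith
      then show ?case using elim \<gamma>\<^sub>0_pos unfolding real_norm_def abs_mult by (intro mult_mono) auto
    qed
  qed measurable
  then show ?thesis by (rule LIMSEQ_le_const) (use nonneg in auto)
qed

lemma Euler_Lagrange:
  assumes A: "A \<in> Lp_on p U" and B: "B \<in> Lp_on p U"
    and min: "\<And>s. energy A \<le> energy (\<lambda>x. A x + s *\<^sub>R B x)"
  shows "(LINT x|M. \<gamma> x * (p_flux p (A x) \<bullet> B x)) = 0"
proof -
  have nB: "(\<lambda>x. - B x) \<in> Lp_on p U" using Lp_lincomb[OF B B, of "-1" 0] by simp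
  have "0 \<le> (LINT x|M. \<gamma> x * (p_flux p (A x) \<bullet> B x))" using A B min by (intro flux_nonneg_of_minimal)
  moreover have "0 \<le> (LINT x|M. \<gamma> x * (p_flux p (A x) \<bullet> (- B x)))"
    using min[of "- s" for s] by (intro flux_nonneg_of_minimal A nB) simp
  ultimately show ?thesis by simp
qed

text \<open>Pointwise uniform convexity, integrated against \<open>\<gamma>\<close>: fields whose
  midpoint has nearly the average energy must be close. This is what makes a minimizing sequence a
  Cauchy sequence.\<close>

lemma midpoint_energy:
  assumes e: "0 < \<epsilon>"
  shows "\<exists>C>0. \<forall>A\<in>Lp_on p U. \<forall>B\<in>Lp_on p U. energy (\<lambda>x. A x - B x) \<le>
    \<epsilon> * (energy A + energy B) + C * ((energy A + energy B) / 2 - energy (\<lambda>x. (1/2) *\<^sub>R (A x + B x)))"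
proof -
  obtain C where C: "C > 0" "\<And>a b :: 'a. norm (a - b) powr p \<le>
     \<epsilon> * (norm a powr p + norm b powr p) +
     C * ((norm a powr p + norm b powr p) / 2 - norm ((1/2) *\<^sub>R (a + b)) powr p)"
    using norm_powr_uniformly_convex[OF p_gt_1 e] by blast
  have "energy (\<lambda>x. A x - B x) \<le>
    \<epsilon> * (energy A + energy B) + C * ((energy A + energy B) / 2 - energy (\<lambda>x. (1/2) *\<^sub>R (A x + B x)))"
    if A: "A \<in> Lp_on p U" and B: "B \<in> Lp_on p U" for A B
  proof -
    have mid: "(\<lambda>x. (1/2) *\<^sub>R (A x + B x)) \<in> Lp_on p U"
      using Lp_lincomb[OF A B, of "1/2" "1/2"] by (simp add: scaleR_add_right)
    note i = LpD(2)[OF A] LpD(2)[OF B] LpD(2)[OF mid]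
    note j = energy_integrable[OF A] energy_integrable[OF B] energy_integrable[OF mid]
    have "energy (\<lambda>x. A x - B x) \<le> (LINT x|M. \<gamma> x * (\<epsilon> * (norm (A x) powr p + norm (B x) powr p) +
     C * ((norm (A x) powr p + norm (B x) powr p) / 2 - norm ((1/2) *\<^sub>R (A x + B x)) powr p)))"
      unfolding energy_def
      by (rule \<gamma>_integral_mono[OF LpD(2)[OF Lp_diff[OF A B]] _ C(2)])
        (intro Bochner_Integration.integrable_add Bochner_Integration.integrable_diff integrable_mult_right integrable_divide i)
    also have "\<dots> = (LINT x|M. \<epsilon> * (\<gamma> x * norm (A x) powr p + \<gamma> x * norm (B x) powr p) +
     C * ((\<gamma> x * norm (A x) powr p + \<gamma> x * norm (B x) powr p) / 2 - \<gamma> x * norm ((1/2) *\<^sub>R (A x + B x)) powr p))"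
      by (intro Bochner_Integration.integral_cong refl) (simp only: algebra_simps add_divide_distrib times_divide_eq_right)
    also have "\<dots> = \<epsilon> * (energy A + energy B) + C * ((energy A + energy B) / 2 - energy (\<lambda>x. (1/2) *\<^sub>R (A x + B x)))"
      unfolding energy_def using j by simp
    finally show ?thesis .
  qed
  with C(1) show ?thesis by blast
qed

text \<open>Test functions obey classical integration by parts, and both sides pass to the limit
  against the bounded multipliers \<open>grad \<psi> x \<bullet> b\<close> and
  \<open>\<psi>\<close>. The identity is verified in components because the limit lemma takes scalar
  multipliers.\<close>

lemma weak_gradient_limit:
  assumes \<phi>: "\<And>k::nat. \<phi> k \<in> test_functions U" and w: "w \<in> Lp_on p U" and B: "B \<in> Lp_on p U"
    and limw: "(\<lambda>k. LINT x|M. \<bar>\<phi> k x - w x\<bar> powr p) \<longlonglongrightarrow> 0"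
    and limB: "(\<lambda>k. LINT x|M. norm (grad (\<phi> k) x - B x) powr p) \<longlonglongrightarrow> 0"
  shows "has_weak_gradient U w B" "w \<in> W1p0 p U"
proof -
  note t = test_W1p[OF \<phi>]
  show h: "has_weak_gradient U w B"
    unfolding has_weak_gradient_def
  proof (intro conjI ballI)
    show l: "locally_integrable U w" "locally_integrable U B"
      using w B by (auto intro: integrable_imp_locally_integrable Lp_integrable)
    fix \<psi> assume \<psi>: "\<psi> \<in> test_functions U"
    obtain K where K: "smooth \<psi>" "compact K" "K \<subseteq> U" "\<And>x. x \<notin> K \<Longrightarrow> \<psi> x = 0" "\<And>x. x \<notin> K \<Longrightarrow> grad \<psi> x = 0"
      using test_functionD[OF \<psi>] by blast
    have c: "continuous_on UNIV \<psi>" "continuous_on UNIV (\<lambda>x. grad \<psi> x \<bullet> b)" for b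
      using smoothD[OF K(1)] by (auto intro: continuous_intros)
    have bnd: "\<exists>A. \<forall>x. \<bar>f x\<bar> \<le> A" if f: "continuous_on UNIV f" "\<And>x. x \<notin> K \<Longrightarrow> f x = 0" for f :: "'a \<Rightarrow> real"
    proof -
      have "bounded (f ` K)"
        by (intro compact_imp_bounded compact_continuous_image K continuous_on_subset[OF f(1)] subset_UNIV)
      then obtain A where A: "\<forall>y\<in>f ` K. norm y \<le> A" by (auto simp: bounded_iff)
      have "\<bar>f x\<bar> \<le> max 0 A" for x using A f(2)[of x] by (cases "x \<in> K") (auto intro: max.coboundedI2)
      then show ?thesis by blast
    qed
    show "(LINT x|M. w x *\<^sub>R grad \<psi> x) = - (LINT x|M. \<psi> x *\<^sub>R B x)"
    proof (rule euclidean_eqI)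
      fix b :: 'a
      note i = test_mult_integrable(2)[OF \<psi> l(1)] test_mult_integrable(1)[OF \<psi> l(2)]
      have "\<exists>A. \<forall>x. \<bar>grad \<psi> x \<bullet> b\<bar> \<le> A" by (rule bnd[OF c(2)]) (simp add: K(5))
      then obtain A1 where A1: "\<And>x. \<bar>grad \<psi> x \<bullet> b\<bar> \<le> A1" by blast
      have "\<exists>A. \<forall>x. \<bar>\<psi> x\<bar> \<le> A" by (rule bnd[OF c(1) K(4)])
      then obtain A2 where A2: "\<And>x. \<bar>\<psi> x\<bar> \<le> A2" by blast
      have "(\<lambda>k. LINT x|M. (grad \<psi> x \<bullet> b) *\<^sub>R \<phi> k x) \<longlonglongrightarrow> (LINT x|M. (grad \<psi> x \<bullet> b) *\<^sub>R w x)"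
        by (rule Lp_tendsto_integral[OF t(4) w _ _ A1])
          (use limw LpD(1)[OF bounded_continuous_Lp[OF c(2)]] in auto)
      moreover have "(LINT x|M. (grad \<psi> x \<bullet> b) *\<^sub>R w x) = (LINT x|M. w x *\<^sub>R grad \<psi> x) \<bullet> b"
        using integral_inner_left[of b M, OF i(1)] by (simp add: mult.commute)
      moreover have "(\<lambda>k. (LINT x|M. \<psi> x *\<^sub>R grad (\<phi> k) x) \<bullet> b) \<longlonglongrightarrow> (LINT x|M. \<psi> x *\<^sub>R B x) \<bullet> b"
        by (intro tendsto_inner tendsto_const Lp_tendsto_integral[OF t(3) B limB _ A2])
          (use LpD(1)[OF bounded_continuous_Lp[OF c(1)]] in auto)
      moreover have "(LINT x|M. (grad \<psi> x \<bullet> b) *\<^sub>R \<phi> k x) = - ((LINT x|M. \<psi> x *\<^sub>R grad (\<phi> k) x) \<bullet> b)" for k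
      proof -
        have s: "smooth (\<phi> k)" using \<phi> by (simp add: test_functions_def)
        have "integrable M (\<lambda>x. \<psi> x *\<^sub>R grad (\<phi> k) x)"
          by (intro test_mult_integrable(1)[OF \<psi>] integrable_imp_locally_integrable Lp_integrable t)
        then have "(LINT x|M. \<psi> x *\<^sub>R grad (\<phi> k) x) \<bullet> b = (LINT x|M. \<psi> x * (grad (\<phi> k) x \<bullet> b))"
          using integral_inner_left[of b M "\<lambda>x. \<psi> x *\<^sub>R grad (\<phi> k) x"] by simp
        moreover have "(LINT x|M. \<phi> k x * (grad \<psi> x \<bullet> b)) = - (LINT x|M. \<psi> x * (grad (\<phi> k) x \<bullet> b))"
          using smoothD[OF s] by (intro integration_by_parts_test \<psi>) (auto intro: continuous_intros)
        ultimately show ?thesis by (simp add: mult.commute)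
      qed
      ultimately have "(\<lambda>k. - ((LINT x|M. \<psi> x *\<^sub>R grad (\<phi> k) x) \<bullet> b)) \<longlonglongrightarrow> (LINT x|M. w x *\<^sub>R grad \<psi> x) \<bullet> b"
        "(\<lambda>k. - ((LINT x|M. \<psi> x *\<^sub>R grad (\<phi> k) x) \<bullet> b)) \<longlonglongrightarrow> - ((LINT x|M. \<psi> x *\<^sub>R B x) \<bullet> b)"
        by (simp_all only: tendsto_minus)
      then show "(LINT x|M. w x *\<^sub>R grad \<psi> x) \<bullet> b = - (LINT x|M. \<psi> x *\<^sub>R B x) \<bullet> b"
        unfolding inner_minus_left by (rule LIMSEQ_unique)
    qed
  qed
  have wW: "w \<in> W1p p U" using w h B by (rule W1pI)
  have "(LINT x|M. norm (weak_grad U w x - grad (\<phi> k) x) powr p) = (LINT x|M. norm (grad (\<phi> k) x - B x) powr p)" for k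
  proof (rule integral_cong_AE)
    show "AE x in M. norm (weak_grad U w x - grad (\<phi> k) x) powr p = norm (grad (\<phi> k) x - B x) powr p"
      using weak_grad_eq[OF h] by eventually_elim (simp add: norm_minus_commute)
  qed (use LpD(2)[OF Lp_diff[OF W1pD(3)[OF wW] t(3)]] LpD(2)[OF Lp_diff[OF t(3) B]] in auto)
  then show "w \<in> W1p0 p U"
    unfolding W1p0_iff using wW \<phi> limw limB
    by (intro conjI exI[of _ \<phi>]) (auto simp: abs_minus_commute)
qed

text \<open>The infimum runs over \<open>u\<^sub>0\<close> plus test functions, a class with the
  right boundary values and classical gradients of the perturbations. The limits of the
  perturbations and of their gradients are then joined by
  \<open>weak_gradient_limit\<close>.\<close>

lemma weak_solution_exists:
  assumes u0: "u\<^sub>0 \<in> W1p p U"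
  shows "\<exists>u. weak_solution p U \<gamma> u \<and> (\<lambda>x. u\<^sub>0 x - u x) \<in> W1p0 p U"
proof -
  define G where "G = weak_grad U u\<^sub>0"
  have G: "G \<in> Lp_on p U" using W1pD(3)[OF u0] by (simp add: G_def)
  define E where "E \<phi> = energy (\<lambda>x. G x + grad \<phi> x)" for \<phi>
  define m where "m = Inf (E ` test_functions U)"
  have bdd: "bdd_below (E ` test_functions U)"
    by (rule bdd_belowI[of _ 0]) (auto simp: E_def energy_nonneg)
  have mE: "m \<le> E \<phi>" if "\<phi> \<in> test_functions U" for \<phi>
    unfolding m_def using bdd that by (intro cInf_lower) auto
  have "\<exists>\<phi>\<in>test_functions U. E \<phi> < m + inverse (real (Suc k))" for k
  proof -
    have ne: "E ` test_functions U \<noteq> {}" using zero_test_function by blast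
    have "Inf (E ` test_functions U) < m + inverse (real (Suc k))" by (simp add: m_def)
    then show ?thesis using cInf_less_iff[OF ne bdd] by auto
  qed
  then obtain \<phi> where \<phi>: "\<And>k. \<phi> k \<in> test_functions U" "\<And>k. E (\<phi> k) < m + inverse (real (Suc k))"
    by metis
  note t = test_W1p[OF \<phi>(1)]
  define A where "A k x = G x + grad (\<phi> k) x" for k x
  have A: "A k \<in> Lp_on p U" for k
    using Lp_lincomb[OF G t(3), of 1 1 k] by (simp add: A_def[abs_def])
  have EA: "energy (A k) = E (\<phi> k)" for k by (simp add: E_def A_def[abs_def])
  have diff: "\<phi> k differentiable at x" for k x
    using \<phi>(1) by (auto intro!: smoothD(1) simp: test_functions_def)
  have m0: "0 \<le> m" unfolding m_def
    by (rule cInf_greatest) (use zero_test_function in \<open>auto simp: E_def energy_nonneg\<close>)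
  have Cauchy_A: "\<exists>N. \<forall>i\<ge>N. \<forall>j\<ge>N. (LINT x|M. norm (A i x - A j x) powr p) < e" if e: "e > 0" for e
  proof -
    \<comment> \<open>Both energies are below \<open>m + 1\<close>, so the first term of the
      midpoint estimate is at most \<open>\<gamma>\<^sub>0 * e / 2\<close>; \<open>N\<close> is then
      chosen so that the deficit term stays under the other half.\<close>
    define \<epsilon> where "\<epsilon> = \<gamma>\<^sub>0 * e / (4 * (m + 1))"
    have \<epsilon>: "0 < \<epsilon>" using e m0 \<gamma>\<^sub>0_pos by (simp add: \<epsilon>_def)
    obtain C where C: "C > 0" "\<And>A B. A \<in> Lp_on p U \<Longrightarrow> B \<in> Lp_on p U \<Longrightarrow> energy (\<lambda>x. A x - B x) \<le>
      \<epsilon> * (energy A + energy B) + C * ((energy A + energy B) / 2 - energy (\<lambda>x. (1/2) *\<^sub>R (A x + B x)))"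
      using midpoint_energy[OF \<epsilon>] by blast
    obtain N where N: "inverse (real (Suc N)) < \<gamma>\<^sub>0 * e / (2 * C)"
      using reals_Archimedean[of "\<gamma>\<^sub>0 * e / (2 * C)"] e C \<gamma>\<^sub>0_pos by auto
    have "(LINT x|M. norm (A i x - A j x) powr p) < e" if ij: "i \<ge> N" "j \<ge> N" for i j
    proof -
      have inv: "inverse (real (Suc k)) \<le> inverse (real (Suc N))" if "k \<ge> N" for k using that by simp
      have 1: "E (\<phi> i) < m + inverse (real (Suc N))" "E (\<phi> j) < m + inverse (real (Suc N))"
        using \<phi>(2)[of i] \<phi>(2)[of j] inv[OF ij(1)] inv[OF ij(2)] by linarith+
      have le1: "inverse (real (Suc N)) \<le> 1" by (simp add: inverse_le_1_iff)
      \<comment> \<open>The midpoint of two competitors is again a competitor, so its energy is at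
        least \<open>m\<close>. This makes the convexity deficit small.\<close>
      let ?mid = "\<lambda>x. (1/2) * \<phi> i x + (1/2) * \<phi> j x"
      have "m \<le> E ?mid" by (intro mE test_functions_lincomb \<phi>)
      also have "E ?mid = energy (\<lambda>x. (1/2) *\<^sub>R (A i x + A j x))"
      proof -
        have "G x + grad ?mid x = (1/2) *\<^sub>R (A i x + A j x)" for x
          unfolding grad_lincomb[OF diff diff] A_def
          by (simp add: algebra_simps flip: scaleR_add_left)
        then show ?thesis by (simp add: E_def)
      qed
      finally have 2: "m \<le> energy (\<lambda>x. (1/2) *\<^sub>R (A i x + A j x))" .
      have "(E (\<phi> i) + E (\<phi> j)) / 2 - energy (\<lambda>x. (1/2) *\<^sub>R (A i x + A j x)) < inverse (real (Suc N))"
      proof -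
        have "(a + b) / 2 - q < d" if "a < m + d" "b < m + d" "m \<le> q" for a b d q
          using that by argo
        from this[OF 1 2] show ?thesis .
      qed
      with N have 3: "(E (\<phi> i) + E (\<phi> j)) / 2 - energy (\<lambda>x. (1/2) *\<^sub>R (A i x + A j x)) < \<gamma>\<^sub>0 * e / (2 * C)"
        by (rule less_trans[rotated])
      have "\<gamma>\<^sub>0 * (LINT x|M. norm (A i x - A j x) powr p) \<le> energy (\<lambda>x. A i x - A j x)"
        by (intro energy_ge Lp_diff A)
      also have "\<dots> \<le> \<epsilon> * (energy (A i) + energy (A j)) + C * ((energy (A i) + energy (A j)) / 2 - energy (\<lambda>x. (1/2) *\<^sub>R (A i x + A j x)))"
        by (rule C(2)[OF A A])
      also have "\<dots> < \<epsilon> * (2 * (m + 1)) + C * (\<gamma>\<^sub>0 * e / (2 * C))"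
        using 1 3 le1 C(1) \<epsilon> unfolding EA
        by (intro add_le_less_mono mult_left_mono mult_strict_left_mono) auto
      also have "\<dots> = \<gamma>\<^sub>0 * e"
      proof -
        have "\<epsilon> * (2 * (m + 1)) = \<gamma>\<^sub>0 * e / 2" unfolding \<epsilon>_def using m0 by (simp add: divide_simps)
        then show ?thesis using C(1) by simp
      qed
      finally show ?thesis using \<gamma>\<^sub>0_pos by simp
    qed
    then show ?thesis by blast
  qed
  have A_diff: "A i x - A j x = grad (\<phi> i) x - grad (\<phi> j) x" for i j x by (simp add: A_def)
  obtain B where B: "B \<in> Lp_on p U" "(\<lambda>k. LINT x|M. norm (grad (\<phi> k) x - B x) powr p) \<longlonglongrightarrow> 0"
    by (rule Lp_complete[OF t(3) Cauchy_A[unfolded A_diff]])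
  obtain C where C: "C > 0" "\<And>\<psi>. \<psi> \<in> test_functions U \<Longrightarrow> (LINT x|M. \<bar>\<psi> x\<bar> powr p) \<le> C * (LINT x|M. norm (grad \<psi> x) powr p)"
    using Poincare_test by blast
  \<comment> \<open>So far only gradients are controlled. Differences of test functions are test
    functions, so the Poincare inequality transfers the Cauchy property to the functions
    themselves.\<close>
  have Cauchy_\<phi>: "\<exists>N. \<forall>i\<ge>N. \<forall>j\<ge>N. (LINT x|M. norm (\<phi> i x - \<phi> j x) powr p) < e" if e: "e > 0" for e
  proof -
    obtain N where N: "\<And>i j. i \<ge> N \<Longrightarrow> j \<ge> N \<Longrightarrow> (LINT x|M. norm (A i x - A j x) powr p) < e / C"
      using Cauchy_A[of "e / C"] e C(1) by auto
    have "(LINT x|M. norm (\<phi> i x - \<phi> j x) powr p) < e" if ij: "i \<ge> N" "j \<ge> N" for i j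
    proof -
      let ?\<psi> = "\<lambda>x. 1 * \<phi> i x + (-1) * \<phi> j x"
      have "(LINT x|M. \<bar>?\<psi> x\<bar> powr p) \<le> C * (LINT x|M. norm (grad ?\<psi> x) powr p)"
        by (intro C(2) test_functions_lincomb \<phi>)
      also have "(LINT x|M. norm (grad ?\<psi> x) powr p) = (LINT x|M. norm (A i x - A j x) powr p)"
        unfolding grad_lincomb[OF diff diff] A_diff by simp
      also have "C * \<dots> < C * (e / C)" using N[OF ij] C(1) by (intro mult_strict_left_mono)
      finally show ?thesis using C(1) by simp
    qed
    then show ?thesis by blast
  qed
  obtain w where w: "w \<in> Lp_on p U" "(\<lambda>k. LINT x|M. norm (\<phi> k x - w x) powr p) \<longlonglongrightarrow> 0"
    by (rule Lp_complete[OF t(4) Cauchy_\<phi>])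
  have wB: "has_weak_gradient U w B" "w \<in> W1p0 p U"
    using weak_gradient_limit[OF \<phi>(1) w(1) B(1) _ B(2)] w(2) by auto
  define u where "u x = u\<^sub>0 x + w x" for x
  have wW: "w \<in> W1p p U" using w(1) wB(1) B(1) by (rule W1pI)
  have u: "u \<in> W1p p U" "AE x in M. weak_grad U u x = G x + B x"
  proof -
    note l = W1p_lincomb[OF u0 wW, of 1 1]
    show "u \<in> W1p p U" using l(1) by (simp add: u_def[abs_def])
    show "AE x in M. weak_grad U u x = G x + B x"
      using l(2) weak_grad_eq[OF wB(1)] by eventually_elim (simp add: u_def[abs_def] G_def)
  qed
  have GB: "(\<lambda>x. G x + B x) \<in> Lp_on p U" using Lp_lincomb[OF G B(1), of 1 1] by simp
  have limA: "(\<lambda>k. LINT x|M. norm (A k x - (G x + B x)) powr p) \<longlonglongrightarrow> 0"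
    using B(2) by (simp add: A_def)
  have "(\<lambda>k. energy (A k)) \<longlonglongrightarrow> m"
  proof (rule tendsto_sandwich[OF _ _ tendsto_const])
    have "(\<lambda>k. m + inverse (real (Suc k))) \<longlonglongrightarrow> m + 0" by (intro tendsto_intros LIMSEQ_inverse_real_of_nat)
    then show "(\<lambda>k. m + inverse (real (Suc k))) \<longlonglongrightarrow> m" by simp
  qed (use \<phi> mE in \<open>auto simp: EA intro!: always_eventually less_imp_le\<close>)
  then have Em: "energy (\<lambda>x. G x + B x) \<le> m" by (rule energy_limit(2)[OF A GB limA])
  have "(LINT x|M. \<gamma> x * (p_flux p (weak_grad U u x) \<bullet> grad \<psi> x)) = 0" if \<psi>: "\<psi> \<in> test_functions U" for \<psi>
  proof -
    note t\<psi> = test_W1p[OF \<psi>]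
    have diff': "\<psi> differentiable at x" for x
      using \<psi> by (auto intro!: smoothD(1) simp: test_functions_def)
    have "energy (\<lambda>x. G x + B x) \<le> energy (\<lambda>x. (G x + B x) + s *\<^sub>R grad \<psi> x)" for s
    proof (rule order_trans[OF Em])
      \<comment> \<open>Minimality is known only for perturbations by test functions. The competitor
        built from the limit field is therefore reached through the admissible fields
        \<open>X k\<close>.\<close>
      define X where "X k x = A k x + s *\<^sub>R grad \<psi> x" for k x
      show "m \<le> energy (\<lambda>x. (G x + B x) + s *\<^sub>R grad \<psi> x)"
      proof (rule energy_limit(1))
        show "X k \<in> Lp_on p U" for k using Lp_lincomb[OF A t\<psi>(3), of 1 k s] by (simp add: X_def[abs_def])
        show "(\<lambda>x. (G x + B x) + s *\<^sub>R grad \<psi> x) \<in> Lp_on p U" using Lp_lincomb[OF GB t\<psi>(3), of 1 s] by simp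
        show "(\<lambda>k. LINT x|M. norm (X k x - (G x + B x + s *\<^sub>R grad \<psi> x)) powr p) \<longlonglongrightarrow> 0"
          using limA by (simp add: X_def)
        show "m \<le> energy (X k)" for k
        proof -
          let ?\<chi> = "\<lambda>x. 1 * \<phi> k x + s * \<psi> x"
          have "m \<le> E ?\<chi>" by (intro mE test_functions_lincomb \<phi> \<psi>)
          also have "E ?\<chi> = energy (X k)"
            unfolding E_def grad_lincomb[OF diff diff'] X_def[abs_def] A_def by (simp add: add.assoc)
          finally show ?thesis .
        qed
      qed
    qed
    then have 0: "(LINT x|M. \<gamma> x * (p_flux p (G x + B x) \<bullet> grad \<psi> x)) = 0"
      by (intro Euler_Lagrange GB t\<psi>)
    have "(LINT x|M. \<gamma> x * (p_flux p (weak_grad U u x) \<bullet> grad \<psi> x)) = (LINT x|M. \<gamma> x * (p_flux p (G x + B x) \<bullet> grad \<psi> x))"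
    proof (rule integral_cong_AE)
      show "AE x in M. \<gamma> x * (p_flux p (weak_grad U u x) \<bullet> grad \<psi> x) = \<gamma> x * (p_flux p (G x + B x) \<bullet> grad \<psi> x)"
        using u(2) by eventually_elim simp
    qed (use integrable_\<gamma>_mult[OF flux_integrable[OF W1pD(3)[OF u(1)] t\<psi>(3)]]
          integrable_\<gamma>_mult[OF flux_integrable[OF GB t\<psi>(3)]] in auto)
    then show ?thesis using 0 by simp
  qed
  then have "weak_solution p U \<gamma> u" using u(1) by (simp add: weak_solution_def)
  moreover have "(\<lambda>x. u\<^sub>0 x - u x) \<in> W1p0 p U"
    using W1p0_lincomb[OF wB(2) wB(2), of "-1" 0] by (simp add: u_def)
  ultimately show ?thesis by blast
qed

text \<open>Density extends the equation from smooth test functions to \<open>W1p0\<close>. The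
  error of replacing \<open>w\<close> by \<open>\<phi> k\<close> is split with a parameter: first
  \<open>k\<close> tends to infinity, then \<open>\<epsilon>\<close> to 0.\<close>

lemma weak_solution_W1p0:
  assumes u: "weak_solution p U \<gamma> u" and w: "w \<in> W1p0 p U"
  shows "(LINT x|M. \<gamma> x * (p_flux p (weak_grad U u x) \<bullet> weak_grad U w x)) = 0"
proof -
  obtain \<phi> where \<phi>: "w \<in> W1p p U" "\<forall>k::nat. \<phi> k \<in> test_functions U"
     "(\<lambda>k. LINT x|M. \<bar>w x - \<phi> k x\<bar> powr p) \<longlonglongrightarrow> 0"
     "(\<lambda>k. LINT x|M. norm (weak_grad U w x - grad (\<phi> k) x) powr p) \<longlonglongrightarrow> 0"
    by (rule W1p0E[OF w])
  define A where "A = weak_grad U u"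
  define W where "W = weak_grad U w"
  have A: "A \<in> Lp_on p U" using u W1pD(3) by (simp add: A_def weak_solution_def)
  have W: "W \<in> Lp_on p U" using W1pD(3)[OF \<phi>(1)] by (simp add: W_def)
  note t = test_W1p[OF \<phi>(2)[rule_format]]
  define V where "V = (LINT x|M. \<gamma> x * (p_flux p (A x) \<bullet> W x))"
  define d where "d k = (LINT x|M. norm (W x - grad (\<phi> k) x) powr p)" for k
  have d: "d \<longlonglongrightarrow> 0" using \<phi>(4) by (simp add: d_def[abs_def] W_def)
  define I where "I = (LINT x|M. norm (A x) powr p)"
  let ?D = "\<lambda>k x. W x - grad (\<phi> k) x"
  have 1: "\<bar>V\<bar> \<le> \<gamma>\<^sub>1 * (\<epsilon> * I + \<epsilon> powr (1 - p) * d k)" if e: "0 < \<epsilon>" for \<epsilon> k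
  proof -
    note D = Lp_diff[OF W t(3)[of k]]
    have "V = V - (LINT x|M. \<gamma> x * (p_flux p (A x) \<bullet> grad (\<phi> k) x))"
      using u \<phi>(2) by (simp add: weak_solution_def A_def)
    also have "\<dots> = (LINT x|M. \<gamma> x * (p_flux p (A x) \<bullet> (?D k x)))"
      unfolding V_def using integrable_\<gamma>_mult[OF flux_integrable[OF A W]] integrable_\<gamma>_mult[OF flux_integrable[OF A t(3)[of k]]]
      by (simp add: inner_diff_right right_diff_distrib)
    finally have "\<bar>V\<bar> \<le> (LINT x|M. \<bar>\<gamma> x * (p_flux p (A x) \<bullet> (?D k x))\<bar>)"
      using integral_abs_bound by metis
    also have "\<dots> \<le> (LINT x|M. \<gamma>\<^sub>1 * (\<epsilon> * norm (A x) powr p + \<epsilon> powr (1 - p) * norm (?D k x) powr p))"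
    proof (rule integral_mono_AE)
      show "integrable M (\<lambda>x. \<bar>\<gamma> x * (p_flux p (A x) \<bullet> (?D k x))\<bar>)"
        by (intro integrable_abs integrable_\<gamma>_mult flux_integrable A D)
      show "integrable M (\<lambda>x. \<gamma>\<^sub>1 * (\<epsilon> * norm (A x) powr p + \<epsilon> powr (1 - p) * norm (?D k x) powr p))"
        using LpD(2)[OF A] LpD(2)[OF D] by simp
      show "AE x in M. \<bar>\<gamma> x * (p_flux p (A x) \<bullet> (?D k x))\<bar>
          \<le> \<gamma>\<^sub>1 * (\<epsilon> * norm (A x) powr p + \<epsilon> powr (1 - p) * norm (?D k x) powr p)"
        using \<gamma>_ge \<gamma>_le
      proof eventually_elim
        case (elim x)
        have "\<bar>p_flux p (A x) \<bullet> (?D k x)\<bar> \<le> \<epsilon> * norm (A x) powr p + \<epsilon> powr (1 - p) * norm (?D k x) powr p"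
          using abs_p_flux_inner_le[of p "A x" "?D k x"]
            powr_mult_le_eps[OF p_gt_1 norm_ge_zero[of "A x"] norm_ge_zero[of "?D k x"] e] by linarith
        then show ?case using elim \<gamma>\<^sub>0_pos unfolding abs_mult by (intro mult_mono) auto
      qed
    qed
    also have "\<dots> = \<gamma>\<^sub>1 * (\<epsilon> * I + \<epsilon> powr (1 - p) * d k)"
      using LpD(2)[OF A] LpD(2)[OF D] by (simp add: I_def d_def)
    finally show ?thesis .
  qed
  have 2: "\<bar>V\<bar> \<le> \<gamma>\<^sub>1 * (\<epsilon> * I)" if e: "0 < \<epsilon>" for \<epsilon>
  proof (rule LIMSEQ_le_const)
    have "(\<lambda>k. \<gamma>\<^sub>1 * (\<epsilon> * I + \<epsilon> powr (1 - p) * d k)) \<longlonglongrightarrow> \<gamma>\<^sub>1 * (\<epsilon> * I + \<epsilon> powr (1 - p) * 0)"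
      by (intro tendsto_intros d)
    then show "(\<lambda>k. \<gamma>\<^sub>1 * (\<epsilon> * I + \<epsilon> powr (1 - p) * d k)) \<longlonglongrightarrow> \<gamma>\<^sub>1 * (\<epsilon> * I)" by simp
  qed (use 1[OF e] in auto)
  have "\<bar>V\<bar> \<le> 0"
  proof (rule LIMSEQ_le_const)
    have "(\<lambda>n. \<gamma>\<^sub>1 * (inverse (real (Suc n)) * I)) \<longlonglongrightarrow> \<gamma>\<^sub>1 * (0 * I)"
      by (intro tendsto_intros LIMSEQ_inverse_real_of_nat)
    then show "(\<lambda>n. \<gamma>\<^sub>1 * (inverse (real (Suc n)) * I)) \<longlonglongrightarrow> 0" by simp
    show "\<exists>N. \<forall>n\<ge>N. \<bar>V\<bar> \<le> \<gamma>\<^sub>1 * (inverse (real (Suc n)) * I)" using 2 by auto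
  qed
  then show ?thesis by (simp add: V_def A_def W_def)
qed

text \<open>Testing the equation with \<open>u - v\<close> replaces the gradient of \<open>v\<close>
  by that of \<open>u\<close> in the pairing. The tangent inequality then bounds \<open>p\<close>
  times the energy of \<open>u\<close> by \<open>p - 1\<close> times itself plus the energy of
  \<open>v\<close>, which is minimality.\<close>

lemma weak_solution_pairing:
  assumes u: "weak_solution p U \<gamma> u" and v: "v \<in> W1p p U" and uv: "(\<lambda>x. u x - v x) \<in> W1p0 p U"
  shows "(LINT x|M. \<gamma> x * (p_flux p (weak_grad U u x) \<bullet> weak_grad U v x)) = energy (weak_grad U u)"
    and "energy (weak_grad U u) \<le> energy (weak_grad U v)"
proof -
  have uW: "u \<in> W1p p U" using u by (simp add: weak_solution_def)
  define A where "A = weak_grad U u"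
  define B where "B = weak_grad U v"
  have AB: "A \<in> Lp_on p U" "B \<in> Lp_on p U" using W1pD(3)[OF uW] W1pD(3)[OF v] by (auto simp: A_def B_def)
  have lin: "AE x in M. weak_grad U (\<lambda>x. u x - v x) x = A x - B x"
    using W1p_lincomb(2)[OF uW v, of 1 "-1"] by (simp add: A_def B_def)
  have dW: "weak_grad U (\<lambda>x. u x - v x) \<in> Lp_on p U"
    using uv by (intro W1pD) (simp add: W1p0_def)
  have "0 = (LINT x|M. \<gamma> x * (p_flux p (A x) \<bullet> weak_grad U (\<lambda>x. u x - v x) x))"
    using weak_solution_W1p0[OF u uv] by (simp add: A_def)
  also have "\<dots> = (LINT x|M. \<gamma> x * (p_flux p (A x) \<bullet> (A x - B x)))"
  proof (rule integral_cong_AE)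
    show "AE x in M. \<gamma> x * (p_flux p (A x) \<bullet> weak_grad U (\<lambda>x. u x - v x) x) = \<gamma> x * (p_flux p (A x) \<bullet> (A x - B x))"
      using lin by eventually_elim simp
  qed (use integrable_\<gamma>_mult[OF flux_integrable[OF AB(1) dW]]
      integrable_\<gamma>_mult[OF flux_integrable[OF AB(1) Lp_diff[OF AB]]] in auto)
  also have "\<dots> = (LINT x|M. \<gamma> x * norm (A x) powr p - \<gamma> x * (p_flux p (A x) \<bullet> B x))"
    by (simp add: inner_diff_right p_flux_inner_self right_diff_distrib)
  also have "\<dots> = energy A - (LINT x|M. \<gamma> x * (p_flux p (A x) \<bullet> B x))"
    unfolding energy_def using energy_integrable[OF AB(1)] integrable_\<gamma>_mult[OF flux_integrable[OF AB]] by simp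
  finally have eq: "(LINT x|M. \<gamma> x * (p_flux p (A x) \<bullet> B x)) = energy A" by simp
  then show "(LINT x|M. \<gamma> x * (p_flux p (weak_grad U u x) \<bullet> weak_grad U v x)) = energy (weak_grad U u)"
    by (simp add: A_def B_def)
  have "p * energy A = (LINT x|M. \<gamma> x * (p * (p_flux p (A x) \<bullet> B x)))"
    by (simp add: eq[symmetric] mult.left_commute)
  also have "\<dots> \<le> (LINT x|M. \<gamma> x * ((p - 1) * norm (A x) powr p + norm (B x) powr p))"
    using flux_integrable[OF AB] LpD(2)[OF AB(1)] LpD(2)[OF AB(2)]
    by (intro \<gamma>_integral_mono p_flux_inner_le p_gt_1) auto
  also have "\<dots> = (LINT x|M. (p - 1) * (\<gamma> x * norm (A x) powr p) + \<gamma> x * norm (B x) powr p)"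
    by (simp add: algebra_simps)
  also have "\<dots> = (p - 1) * energy A + energy B"
    unfolding energy_def using energy_integrable[OF AB(1)] energy_integrable[OF AB(2)] by simp
  finally show "energy (weak_grad U u) \<le> energy (weak_grad U v)"
    by (simp add: A_def B_def algebra_simps)
qed

lemma trace_class_iff:
  "g \<in> trace_class p U f \<longleftrightarrow> f \<in> W1p p U \<and> g \<in> W1p p U \<and> (\<lambda>x. f x - g x) \<in> W1p0 p U"
  by (auto simp: trace_class_def trace_rel_def)

text \<open>Existence of a solution makes both \<open>SOME\<close> terms in \<open>DN_map\<close>
  select genuine members of the class. They differ by an element of \<open>W1p0\<close>, so the
  pairing formula applies whatever was selected.\<close>

lemma DN_map_energy:
  assumes f: "f \<in> W1p p U"
  obtains u where "weak_solution p U \<gamma> u" "(\<lambda>x. f x - u x) \<in> W1p0 p U"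
    "DN_map p U \<gamma> (trace_class p U f) (trace_class p U f) = energy (weak_grad U u)"
proof -
  let ?F = "trace_class p U f"
  define u where "u = (SOME u. u \<in> ?F \<and> weak_solution p U \<gamma> u)"
  define v where "v = (SOME v. v \<in> ?F)"
  have ex: "\<exists>u. u \<in> ?F \<and> weak_solution p U \<gamma> u"
    using weak_solution_exists[OF f] f by (auto simp: trace_class_iff weak_solution_def)
  have u: "u \<in> ?F" "weak_solution p U \<gamma> u" using someI_ex[OF ex] by (auto simp: u_def)
  have "v \<in> ?F" unfolding v_def using u(1) by (rule someI[of "\<lambda>v. v \<in> ?F"])
  then have v: "v \<in> W1p p U" "(\<lambda>x. f x - v x) \<in> W1p0 p U" by (auto simp: trace_class_iff)
  have fu: "(\<lambda>x. f x - u x) \<in> W1p0 p U" using u by (simp add: trace_class_iff)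
  have "(\<lambda>x. u x - v x) \<in> W1p0 p U" using W1p0_lincomb[OF v(2) fu, of 1 "-1"] by simp
  note weak_solution_pairing(1)[OF u(2) v(1) this]
  then have "DN_map p U \<gamma> ?F ?F = energy (weak_grad U u)"
    by (simp add: DN_map_def Let_def u_def v_def)
  with u fu that show thesis by blast
qed

end


section \<open>Bounds for the Dirichlet-to-Neumann map and Wolff solutions\<close>

lemma powr_neg_exponent_le_1: "1 \<le> x \<Longrightarrow> 0 \<le> c \<Longrightarrow> x powr (- c) \<le> (1::real)"
  using powr_mono[of "- c" 0 x] by simp

context bounded_open
begin

lemma conductivity_one: "conductivity U p (\<lambda>_. 1) 1 1"
  by unfold_locales auto

lemma DN_difference_bounds:
  fixes \<sigma> :: "'a \<Rightarrow> real"
  assumes \<sigma>: "\<sigma> \<in> borel_measurable M" "AE x in M. 1 \<le> \<sigma> x" "AE x in M. \<sigma> x \<le> S"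
    and u0: "weak_solution p U (\<lambda>_. 1) u\<^sub>0"
  defines "F \<equiv> trace_class p U u\<^sub>0"
  defines "N \<equiv> \<lambda>x. norm (weak_grad U u\<^sub>0 x) powr p"
  shows "DN_map p U \<sigma> F F - DN_map p U (\<lambda>_. 1) F F \<le> (LINT x|M. (\<sigma> x - 1) * N x)"
    and "(p - 1) * (LINT x|M. (1 - \<sigma> x powr (- (1 / (p - 1)))) * N x)
      \<le> DN_map p U \<sigma> F F - DN_map p U (\<lambda>_. 1) F F"
    and "integrable M (\<lambda>x. (1 - \<sigma> x powr (- (1 / (p - 1)))) * N x)"
proof -
  interpret c\<sigma>: conductivity U p \<sigma> 1 S by unfold_locales (use \<sigma> in auto)
  interpret c1: conductivity U p "\<lambda>_. 1" 1 1 by (rule conductivity_one)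
  have u0W: "u\<^sub>0 \<in> W1p p U" using u0 by (simp add: weak_solution_def)
  define A where "A = weak_grad U u\<^sub>0"
  have A: "A \<in> Lp_on p U" using W1pD(3)[OF u0W] by (simp add: A_def)
  have iN: "integrable M N" using LpD(2)[OF A] by (simp add: N_def A_def)
  obtain u1 where u1: "weak_solution p U (\<lambda>_. 1) u1" "(\<lambda>x. u\<^sub>0 x - u1 x) \<in> W1p0 p U"
    "DN_map p U (\<lambda>_. 1) F F = c1.energy (weak_grad U u1)"
    using c1.DN_map_energy[OF u0W] unfolding F_def by metis
  obtain u where u: "weak_solution p U \<sigma> u" "(\<lambda>x. u\<^sub>0 x - u x) \<in> W1p0 p U"
    "DN_map p U \<sigma> F F = c\<sigma>.energy (weak_grad U u)"
    using c\<sigma>.DN_map_energy[OF u0W] unfolding F_def by metis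
  have W: "u1 \<in> W1p p U" "u \<in> W1p p U" using u1 u by (auto simp: weak_solution_def)
  have neg: "(\<lambda>x. v x - u\<^sub>0 x) \<in> W1p0 p U" if "(\<lambda>x. u\<^sub>0 x - v x) \<in> W1p0 p U" for v
    using W1p0_lincomb[OF that that, of "-1" 0] by simp
  define B where "B = weak_grad U u"
  have B: "B \<in> Lp_on p U" using W1pD(3)[OF W(2)] by (simp add: B_def)
  \<comment> \<open>\<open>u\<^sub>0\<close> and the selected solution \<open>u1\<close> solve the
    same problem with the same boundary values; minimality in both directions equates their
    energies.\<close>
  have E1: "DN_map p U (\<lambda>_. 1) F F = integral\<^sup>L M N"
    using c1.weak_solution_pairing(2)[OF u1(1) u0W neg[OF u1(2)]]
      c1.weak_solution_pairing(2)[OF u0 W(1) u1(2)] u1(3)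
    by (simp add: c1.energy_def N_def)
  have i\<sigma>N: "integrable M (\<lambda>x. \<sigma> x * N x)" by (rule c\<sigma>.integrable_\<gamma>_mult[OF iN])
  have "DN_map p U \<sigma> F F \<le> (LINT x|M. \<sigma> x * N x)"
    using c\<sigma>.weak_solution_pairing(2)[OF u(1) u0W neg[OF u(2)]] u(3)
    by (simp add: c\<sigma>.energy_def N_def)
  then show "DN_map p U \<sigma> F F - DN_map p U (\<lambda>_. 1) F F \<le> (LINT x|M. (\<sigma> x - 1) * N x)"
    unfolding E1 using i\<sigma>N iN by (simp add: left_diff_distrib)
  define w where "w x = \<sigma> x powr (- (1 / (p - 1)))" for x
  have iw: "integrable M (\<lambda>x. w x * N x)"
  proof (rule Bochner_Integration.integrable_bound[OF iN])
    show "(\<lambda>x. w x * N x) \<in> borel_measurable M"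
      unfolding w_def using \<sigma>(1) borel_measurable_integrable[OF iN] by measurable
    show "AE x in M. norm (w x * N x) \<le> norm (N x)" using \<sigma>(2)
    proof eventually_elim
      case (elim x)
      have "\<bar>w x\<bar> \<le> 1" unfolding w_def using powr_neg_exponent_le_1[OF elim, of "1 / (p - 1)"] p_gt_1 by simp
      then show ?case by (simp add: abs_mult mult_left_le_one_le)
    qed
  qed
  show "integrable M (\<lambda>x. (1 - \<sigma> x powr (- (1 / (p - 1)))) * N x)"
    using iw iN unfolding w_def by (simp add: left_diff_distrib)
  have i\<sigma>B: "integrable M (\<lambda>x. \<sigma> x * norm (B x) powr p)" by (rule c\<sigma>.energy_integrable[OF B])
  \<comment> \<open>Since \<open>u\<close> has the boundary values of the p-harmonic
    \<open>u\<^sub>0\<close>, pairing the flux of \<open>u\<^sub>0\<close> with the gradient of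
    \<open>u\<close> returns the energy of \<open>u\<^sub>0\<close>. Weighted Young then trades the
    gradient of \<open>u\<close> for its \<open>\<sigma>\<close>-energy.\<close>
  have "p * integral\<^sup>L M N = p * (LINT x|M. p_flux p (A x) \<bullet> B x)"
    using c1.weak_solution_pairing(1)[OF u0 W(2) u(2)] by (simp add: c1.energy_def N_def A_def B_def)
  also have "\<dots> = (LINT x|M. p * (p_flux p (A x) \<bullet> B x))" by simp
  also have "\<dots> \<le> (LINT x|M. (p - 1) * (w x * N x) + \<sigma> x * norm (B x) powr p)"
  proof (rule integral_mono_AE)
    show "integrable M (\<lambda>x. p * (p_flux p (A x) \<bullet> B x))" using c1.flux_integrable[OF A B] by simp
    show "integrable M (\<lambda>x. (p - 1) * (w x * N x) + \<sigma> x * norm (B x) powr p)" using iw i\<sigma>B by simp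
    show "AE x in M. p * (p_flux p (A x) \<bullet> B x) \<le> (p - 1) * (w x * N x) + \<sigma> x * norm (B x) powr p"
      using \<sigma>(2)
    proof eventually_elim
      case (elim x)
      have "p * (p_flux p (A x) \<bullet> B x) \<le> p * (norm (A x) powr (p - 1) * norm (B x))"
        using abs_p_flux_inner_le[of p "A x" "B x"] p_gt_1 by (intro mult_left_mono) auto
      also have "\<dots> \<le> (p - 1) * (w x * N x) + \<sigma> x * norm (B x) powr p"
        using Young_powr_weighted[OF p_gt_1, of "norm (A x)" "norm (B x)" "\<sigma> x"] elim
        by (simp add: w_def N_def A_def mult.assoc)
      finally show ?case .
    qed
  qed
  also have "\<dots> = (p - 1) * (LINT x|M. w x * N x) + DN_map p U \<sigma> F F"
    using iw i\<sigma>B u(3) by (simp add: c\<sigma>.energy_def B_def)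
  finally show "(p - 1) * (LINT x|M. (1 - \<sigma> x powr (- (1 / (p - 1)))) * N x)
      \<le> DN_map p U \<sigma> F F - DN_map p U (\<lambda>_. 1) F F"
    unfolding E1 w_def[symmetric] using iw iN by (simp add: left_diff_distrib) (simp add: algebra_simps)
qed

end

section \<open>Wolff solutions and their p-harmonicity\<close>

lemma GDERIV_exp_mult:
  fixes \<rho> \<rho>' x :: "'a::euclidean_space"
  assumes "DERIV h (\<tau> * (x \<bullet> \<rho>')) :> h'"
  shows "GDERIV (\<lambda>x. exp (c * (x \<bullet> \<rho> - t)) * h (\<tau> * (x \<bullet> \<rho>'))) x :>
     exp (c * (x \<bullet> \<rho> - t)) *\<^sub>R ((c * h (\<tau> * (x \<bullet> \<rho>'))) *\<^sub>R \<rho> + (\<tau> * h') *\<^sub>R \<rho>')"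
proof -
  have 1: "((\<lambda>x. exp (c * (x \<bullet> \<rho> - t))) has_derivative (\<lambda>y. c * (y \<bullet> \<rho>) * exp (c * (x \<bullet> \<rho> - t)))) (at x)"
    by (rule DERIV_compose_FDERIV[OF DERIV_exp]) (auto intro!: derivative_eq_intros)
  have 2: "((\<lambda>x. h (\<tau> * (x \<bullet> \<rho>'))) has_derivative (\<lambda>y. \<tau> * (y \<bullet> \<rho>') * h')) (at x)"
    by (rule DERIV_compose_FDERIV[where g = "\<lambda>x. \<tau> * (x \<bullet> \<rho>')" and x = x, OF assms]) (auto intro!: derivative_eq_intros)
  show ?thesis unfolding gderiv_def
    by (rule has_derivative_eq_rhs[OF has_derivative_mult[OF 1 2]])
      (auto simp: inner_add_right algebra_simps fun_eq_iff)
qed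

text \<open>The profile equation as a first-order system, with \<open>b\<close> in the role of the
  derivative of \<open>a\<close>. The two-sided bound on the sum of squares is what makes the
  gradient of a Wolff solution comparable to \<open>\<tau>\<close> times the exponential.\<close>

locale wolff =
  fixes p :: real and a b :: "real \<Rightarrow> real" and \<rho> \<rho>' :: "'a::euclidean_space" and c\<^sub>a C\<^sub>a :: real
  assumes p_gt_1: "1 < p"
    and \<rho>: "norm \<rho> = 1" "norm \<rho>' = 1" "\<rho> \<bullet> \<rho>' = 0"
    and a': "\<And>s. DERIV a s :> b s"
    and b': "\<And>s. DERIV b s :> - wolff_V p (a s) (b s) * a s"
    and c\<^sub>a: "0 < c\<^sub>a"
    and ab: "\<And>s. c\<^sub>a < (a s)\<^sup>2 + (b s)\<^sup>2" "\<And>s. (a s)\<^sup>2 + (b s)\<^sup>2 < C\<^sub>a"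
begin

lemma ab_pos: "0 < (a s)\<^sup>2 + (b s)\<^sup>2"
  using ab(1)[of s] c\<^sub>a by linarith

lemma cont_a: "continuous_on S a" and cont_b: "continuous_on S b"
  by (meson a' b' DERIV_isCont continuous_at_imp_continuous_on)+

text \<open>Up to a power of \<open>\<tau>\<close> and an exponential, this is the norm of the
  gradient of the Wolff solution to the power \<open>p - 2\<close>, the scalar factor in its
  p-flux.\<close>

definition W :: "real \<Rightarrow> real" where
  "W s = ((a s)\<^sup>2 + (b s)\<^sup>2) powr ((p - 2) / 2)"

definition W' :: "real \<Rightarrow> real" where
  "W' s = (p - 2) * (W s / ((a s)\<^sup>2 + (b s)\<^sup>2)) * (a s * b s + b s * (- wolff_V p (a s) (b s) * a s))"

lemma DERIV_W: "DERIV W s :> W' s"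
proof -
  have "DERIV (\<lambda>s. (a s)\<^sup>2 + (b s)\<^sup>2) s :> 2 * (a s * b s + b s * (- wolff_V p (a s) (b s) * a s))"
    by (auto intro!: derivative_eq_intros a' b')
  from DERIV_fun_powr[OF this ab_pos, of "(p - 2) / 2"]
  show ?thesis unfolding W_def[abs_def] W'_def
  proof (rule DERIV_cong)
    have "(p - 2) / 2 * q powr ((p - 2) / 2 - of_nat 1) * (2 * z) = (p - 2) * (q powr ((p - 2) / 2) / q) * z"
      if "q > 0" for q z using that by (simp add: powr_diff)
    from this[OF ab_pos]
    show "(p - 2) / 2 * ((a s)\<^sup>2 + (b s)\<^sup>2) powr ((p - 2) / 2 - of_nat 1) * (2 * (a s * b s + b s * (- wolff_V p (a s) (b s) * a s)))
      = (p - 2) * (((a s)\<^sup>2 + (b s)\<^sup>2) powr ((p - 2) / 2) / ((a s)\<^sup>2 + (b s)\<^sup>2)) * (a s * b s + b s * (- wolff_V p (a s) (b s) * a s))" .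
  qed
qed

text \<open>This is the Wolff equation in divergence form.\<close>

lemma DERIV_Wb: "DERIV (\<lambda>s. W s * b s) s :> - ((p - 1) * (W s * a s))"
proof -
  define V where "V = wolff_V p (a s) (b s)"
  define q where "q = (a s)\<^sup>2 + (b s)\<^sup>2"
  define d where "d = (p - 1) * (b s)\<^sup>2 + (a s)\<^sup>2"
  have q: "q \<noteq> 0" using ab_pos[of s] unfolding q_def by linarith
  have d: "d \<noteq> 0"
  proof (cases "a s = 0")
    case True
    then have "b s \<noteq> 0" using q by (simp add: q_def)
    then show ?thesis using True p_gt_1 by (simp add: d_def)
  next
    case False
    then have "d > 0" unfolding d_def using p_gt_1 by (intro add_nonneg_pos) auto
    then show ?thesis by simp
  qed
  have V: "V * d = (2 * p - 3) * (b s)\<^sup>2 + (p - 1) * (a s)\<^sup>2"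
    using d by (simp add: V_def wolff_V_def d_def)
  \<comment> \<open>The derivative of \<open>W s * b s\<close> is \<open>W s / q\<close> times this
    expression. As \<open>(p - 2) * (b s)\<^sup>2 + q = d\<close> is the denominator in
    \<open>wolff_V\<close>, the product \<open>V * d\<close> clears the fraction.\<close>
  have "(p - 2) * (a s * b s + b s * (- V * a s)) * b s + q * (- V * a s)
      = a s * ((p - 2) * (b s)\<^sup>2 - V * d)"
    by (simp add: q_def d_def algebra_simps power2_eq_square)
  also have "\<dots> = - ((p - 1) * q * a s)"
    unfolding V by (simp add: q_def algebra_simps)
  finally have key: "(p - 2) * (a s * b s + b s * (- V * a s)) * b s + q * (- V * a s) = - ((p - 1) * q * a s)" .
  have "W' s * b s + W s * (- V * a s) = W s / q * ((p - 2) * (a s * b s + b s * (- V * a s)) * b s + q * (- V * a s))"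
    using q by (simp add: W'_def V_def[symmetric] q_def[symmetric] field_simps)
  also have "\<dots> = - ((p - 1) * (W s * a s))" unfolding key using q by simp
  finally have "W' s * b s + W s * (- V * a s) = - ((p - 1) * (W s * a s))" .
  moreover have "DERIV (\<lambda>s. W s * b s) s :> W' s * b s + (- V * a s) * W s"
    unfolding V_def by (rule DERIV_mult[OF DERIV_W b'])
  ultimately show ?thesis by (simp add: mult.commute)
qed

lemma DERIV_Wa: "DERIV (\<lambda>s. W s * a s) s :> W' s * a s + b s * W s"
  by (rule DERIV_mult[OF DERIV_W a'])

lemma GDERIV_wolff:
  "GDERIV (wolff_solution a \<rho> \<rho>' \<tau> t) x :>
    (\<tau> * exp (\<tau> * (x \<bullet> \<rho> - t))) *\<^sub>R (a (\<tau> * (x \<bullet> \<rho>')) *\<^sub>R \<rho> + b (\<tau> * (x \<bullet> \<rho>')) *\<^sub>R \<rho>')"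
  using GDERIV_exp_mult[where h = a and h' = "b (\<tau> * (x \<bullet> \<rho>'))" and c = \<tau> and \<tau> = \<tau> and x = x
      and \<rho> = \<rho> and \<rho>' = \<rho>' and t = t, OF a']
  by (simp add: wolff_solution_def[abs_def] scaleR_add_right mult_ac)

lemmas grad_wolff = grad_eqI[OF GDERIV_wolff]

lemma wolff_C1:
  "wolff_solution a \<rho> \<rho>' \<tau> t differentiable (at x)"
  "continuous_on UNIV (grad (wolff_solution a \<rho> \<rho>' \<tau> t))"
proof -
  show "wolff_solution a \<rho> \<rho>' \<tau> t differentiable (at x)"
    using GDERIV_wolff by (auto simp: gderiv_def differentiable_def)
  show "continuous_on UNIV (grad (wolff_solution a \<rho> \<rho>' \<tau> t))"
    unfolding grad_wolff[abs_def]
    by (intro continuous_intros continuous_on_compose2[OF cont_a[of UNIV]] continuous_on_compose2[OF cont_b[of UNIV]]) auto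
qed

lemma norm_combination: "norm (r *\<^sub>R \<rho> + s *\<^sub>R \<rho>') = sqrt (r\<^sup>2 + s\<^sup>2)"
proof -
  have "\<rho> \<bullet> \<rho> = 1" "\<rho>' \<bullet> \<rho>' = 1" using \<rho> by (simp_all add: norm_eq_1)
  then have "(r *\<^sub>R \<rho> + s *\<^sub>R \<rho>') \<bullet> (r *\<^sub>R \<rho> + s *\<^sub>R \<rho>') = r\<^sup>2 + s\<^sup>2"
    using \<rho>(3) by (simp add: inner_add inner_commute power2_eq_square)
  then show ?thesis by (simp add: norm_eq_sqrt_inner)
qed

lemma norm_grad_wolff:
  assumes "\<tau> > 0"
  shows "norm (grad (wolff_solution a \<rho> \<rho>' \<tau> t) x) powr r =
    \<tau> powr r * exp (r * \<tau> * (x \<bullet> \<rho> - t)) * ((a (\<tau> * (x \<bullet> \<rho>')))\<^sup>2 + (b (\<tau> * (x \<bullet> \<rho>')))\<^sup>2) powr (r / 2)"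
proof -
  have "sqrt q powr r = q powr (r / 2)" if "q > 0" for q :: real
    using that by (simp add: powr_half_sqrt[symmetric] powr_powr)
  moreover have "exp s powr r = exp (r * s)" for s :: real by (simp add: powr_def)
  ultimately show ?thesis using assms ab_pos[of "\<tau> * (x \<bullet> \<rho>')"]
    by (simp add: grad_wolff norm_combination powr_mult mult.assoc)
qed

text \<open>The flux is a multiple of \<open>f1\<close> times \<open>\<rho>\<close> plus
  \<open>f2\<close> times \<open>\<rho>'\<close>. Its divergence is the derivative of
  \<open>f1\<close> along \<open>\<rho>\<close> plus that of \<open>f2\<close> along
  \<open>\<rho>'\<close>; the former is \<open>(p - 1) * \<tau> * f1\<close>, the latter its
  negative by \<open>DERIV_Wb\<close>.\<close>

lemma wolff_weak_solution:
  assumes "bounded_open U p" and \<tau>: "\<tau> > 0"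
  shows "weak_solution p U (\<lambda>_. 1) (wolff_solution a \<rho> \<rho>' \<tau> t)"
proof -
  interpret bounded_open U p by fact
  define u where "u = wolff_solution a \<rho> \<rho>' \<tau> t"
  note C1 = W1p_C1[OF wolff_C1, of \<tau> t, folded u_def]
  let ?s = "\<lambda>x. \<tau> * (x \<bullet> \<rho>')"
  \<comment> \<open>In the exponent, \<open>p - 2\<close> stems from the power of the gradient norm
    and 1 from the gradient itself.\<close>
  define e where "e x = exp (((p - 1) * \<tau>) * (x \<bullet> \<rho> - t))" for x
  define f1 where "f1 x = e x * (W (?s x) * a (?s x))" for x
  define f2 where "f2 x = e x * (W (?s x) * b (?s x))" for x
  have flux: "p_flux p (grad u x) = \<tau> powr (p - 1) *\<^sub>R (f1 x *\<^sub>R \<rho> + f2 x *\<^sub>R \<rho>')" for x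
  proof -
    have "exp ((p - 2) * \<tau> * (x \<bullet> \<rho> - t)) * exp (\<tau> * (x \<bullet> \<rho> - t)) = e x"
      by (simp add: e_def algebra_simps flip: exp_add)
    moreover have "\<tau> powr (p - 2) * \<tau> = \<tau> powr (p - 1)" using \<tau> by (simp add: powr_diff power2_eq_square)
    moreover have "T * E * y * (\<tau> * F * z) = (T * \<tau>) * ((E * F) * (y * z))" for T E F y z :: real
      by (simp only: mult_ac)
    ultimately have key: "\<tau> powr (p - 2) * exp ((p - 2) * \<tau> * (x \<bullet> \<rho> - t)) * y * (\<tau> * exp (\<tau> * (x \<bullet> \<rho> - t)) * z)
        = \<tau> powr (p - 1) * (e x * (y * z))" for y z
      by (simp only:)
    show ?thesis
      unfolding p_flux_def u_def norm_grad_wolff[OF \<tau>] unfolding grad_wolff f1_def f2_def W_def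
      by (simp only: scaleR_add_right scaleR_scaleR key)
  qed
  define G1 where "G1 x = e x *\<^sub>R ((((p - 1) * \<tau>) * (W (?s x) * a (?s x))) *\<^sub>R \<rho> +
    (\<tau> * (W' (?s x) * a (?s x) + b (?s x) * W (?s x))) *\<^sub>R \<rho>')" for x
  define G2 where "G2 x = e x *\<^sub>R ((((p - 1) * \<tau>) * (W (?s x) * b (?s x))) *\<^sub>R \<rho> +
    (\<tau> * - ((p - 1) * (W (?s x) * a (?s x)))) *\<^sub>R \<rho>')" for x
  have D1: "GDERIV f1 x :> G1 x" for x
    unfolding f1_def[abs_def] G1_def e_def by (rule GDERIV_exp_mult[OF DERIV_Wa])
  have D2: "GDERIV f2 x :> G2 x" for x
    unfolding f2_def[abs_def] G2_def e_def by (rule GDERIV_exp_mult[OF DERIV_Wb])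
  have g: "grad f1 x = G1 x" "grad f2 x = G2 x" for x using D1 D2 by (auto intro: grad_eqI)
  have dif: "f1 differentiable (at x)" "f2 differentiable (at x)" for x
    using D1 D2 by (auto simp: gderiv_def differentiable_def)
  have "\<rho> \<bullet> \<rho> = 1" "\<rho>' \<bullet> \<rho>' = 1" "\<rho>' \<bullet> \<rho> = 0" using \<rho> by (simp_all add: norm_eq_1 inner_commute)
  then have g\<rho>: "grad f1 x \<bullet> \<rho> = ((p - 1) * \<tau>) * f1 x" "grad f2 x \<bullet> \<rho>' = - (((p - 1) * \<tau>) * f1 x)" for x
    using \<rho>(3) by (simp_all add: g G1_def G2_def f1_def inner_add_left inner_diff_left)
  have cf: "continuous_on UNIV f1" "continuous_on UNIV f2"
    by (intro continuous_at_imp_continuous_on ballI differentiable_imp_continuous_within dif)+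
  have "(LINT x|M. 1 * (p_flux p (weak_grad U u x) \<bullet> grad \<phi> x)) = 0" if \<phi>: "\<phi> \<in> test_functions U" for \<phi>
  proof -
    interpret c1: conductivity U p "\<lambda>_. 1" 1 1 by (rule conductivity_one)
    note t = test_W1p[OF \<phi>]
    have "(LINT x|M. 1 * (p_flux p (weak_grad U u x) \<bullet> grad \<phi> x)) = (LINT x|M. p_flux p (grad u x) \<bullet> grad \<phi> x)"
    proof (rule integral_cong_AE)
      show "AE x in M. 1 * (p_flux p (weak_grad U u x) \<bullet> grad \<phi> x) = p_flux p (grad u x) \<bullet> grad \<phi> x"
        using C1(2) by eventually_elim simp
    qed (use c1.flux_integrable[OF W1pD(3)[OF C1(1)] t(3)] c1.flux_integrable[OF C1(3) t(3)] in auto)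
    also have "\<dots> = (LINT x|M. \<tau> powr (p - 1) * (f1 x * (grad \<phi> x \<bullet> \<rho>) + f2 x * (grad \<phi> x \<bullet> \<rho>')))"
      by (simp add: flux inner_add_left inner_commute[of \<rho>] inner_commute[of \<rho>'])
    also have "\<dots> = \<tau> powr (p - 1) * ((LINT x|M. f1 x * (grad \<phi> x \<bullet> \<rho>)) + (LINT x|M. f2 x * (grad \<phi> x \<bullet> \<rho>')))"
    proof -
      obtain K where K: "smooth \<phi>" "compact K" "K \<subseteq> U" "\<And>x. x \<notin> K \<Longrightarrow> \<phi> x = 0" "\<And>x. x \<notin> K \<Longrightarrow> grad \<phi> x = 0"
        using test_functionD[OF \<phi>] by blast
      have "integrable M (\<lambda>x. f1 x * (grad \<phi> x \<bullet> \<rho>))" "integrable M (\<lambda>x. f2 x * (grad \<phi> x \<bullet> \<rho>'))"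
        using K smoothD[OF K(1)] cf
        by (auto intro!: lebesgue_on_compact_support(1)[OF _ K(2)] continuous_intros)
      then show ?thesis by simp
    qed
    also have "(LINT x|M. f1 x * (grad \<phi> x \<bullet> \<rho>)) = - (LINT x|M. \<phi> x * (((p - 1) * \<tau>) * f1 x))"
      using integration_by_parts_test[OF dif(1) _ \<phi> U_lebesgue, of \<rho>] cf
      by (simp add: g\<rho> continuous_intros)
    also have "(LINT x|M. f2 x * (grad \<phi> x \<bullet> \<rho>')) = - (LINT x|M. \<phi> x * (- (((p - 1) * \<tau>) * f1 x)))"
      using integration_by_parts_test[OF dif(2) _ \<phi> U_lebesgue, of \<rho>'] cf
      by (simp add: g\<rho> continuous_intros)
    finally show ?thesis by simp
  qed
  then show ?thesis using C1(1) unfolding weak_solution_def u_def by blast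
qed

end

lemma wolff_profile_locale:
  fixes \<rho> \<rho>' :: "'a::euclidean_space"
  assumes "1 < p" "norm \<rho> = 1" "norm \<rho>' = 1" "\<rho> \<bullet> \<rho>' = 0" and a: "wolff_profile p a"
  obtains c C where "wolff p a (deriv a) \<rho> \<rho>' c C"
proof -
  have s: "smooth a" using a by (simp add: wolff_profile_def)
  have D: "DERIV f x :> deriv f x" if "smooth f" for f :: "real \<Rightarrow> real" and x
    using smoothD(1)[OF that] by (metis DERIV_deriv_iff_real_differentiable)
  have "grad a x \<bullet> 1 = deriv a x" for x
    using D[OF s, of x] by (simp add: grad_eqI)
  then have "smooth (deriv a)" using smoothD(4)[OF s, of 1] by simp
  note D2 = D[OF this]
  have eq: "deriv (deriv a) s = - wolff_V p (a s) (deriv a s) * a s" for s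
    using a by (simp add: wolff_profile_def eq_neg_iff_add_eq_0)
  have D3: "DERIV (deriv a) s :> - wolff_V p (a s) (deriv a s) * a s" for s
    using D2[of s] by (simp only: eq)
  obtain c C where "0 < c" "\<And>s. c < (a s)\<^sup>2 + (deriv a s)\<^sup>2" "\<And>s. (a s)\<^sup>2 + (deriv a s)\<^sup>2 < C"
    using a unfolding wolff_profile_def by blast
  then have "wolff p a (deriv a) \<rho> \<rho>' c C"
    using assms(1-4) D[OF s] D3 by unfold_locales
  then show thesis by (rule that)
qed


section \<open>Asymptotics of the indicator function\<close>

text \<open>An interior cone condition: balls centred on the ray from \<open>z\<close> in direction
  \<open>e\<close>, with radius proportional to the distance from \<open>z\<close>, sweep out a cone
  with vertex \<open>z\<close>.\<close>

lemma lipschitz_boundary_interior_balls: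
  fixes D :: "'a::euclidean_space set"
  assumes "lipschitz_boundary D" and z: "z \<in> frontier D"
  obtains e \<kappa> s\<^sub>0 where "norm e = 1" "0 < \<kappa>" "\<kappa> \<le> 1" "0 < s\<^sub>0"
    "\<And>s. 0 < s \<Longrightarrow> s < s\<^sub>0 \<Longrightarrow> ball (z + s *\<^sub>R e) (\<kappa> * s) \<subseteq> D"
proof -
  from assms(1) z obtain r e \<phi> L where r: "r > 0" and e: "norm e = 1"
    and L: "L-lipschitz_on {y. y \<bullet> e = 0} \<phi>"
    and D: "D \<inter> ball z r = {x \<in> ball z r. \<phi> (x - (x \<bullet> e) *\<^sub>R e) < x \<bullet> e}"
    unfolding lipschitz_boundary_def by blast
  have L0: "0 \<le> L" using lipschitz_on_nonneg[OF L] .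
  have ee: "e \<bullet> e = 1" using e by (simp add: norm_eq_1)
  define P where "P x = x - (x \<bullet> e) *\<^sub>R e" for x
  have Pe: "P x \<bullet> e = 0" for x using ee by (simp add: P_def inner_diff_left)
  have Pn: "norm (P v) \<le> 2 * norm v" for v
  proof -
    have "norm (P v) \<le> norm v + norm ((v \<bullet> e) *\<^sub>R e)" unfolding P_def by (rule norm_triangle_ineq4)
    also have "norm ((v \<bullet> e) *\<^sub>R e) \<le> norm v" using Cauchy_Schwarz_ineq2[of v e] e by simp
    finally show ?thesis by simp
  qed
  have PL: "\<bar>\<phi> (P x) - \<phi> (P y)\<bar> \<le> L * norm (P (x - y))" for x y
  proof -
    have "dist (\<phi> (P x)) (\<phi> (P y)) \<le> L * dist (P x) (P y)" by (rule lipschitz_onD[OF L]) (auto simp: Pe)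
    moreover have "P x - P y = P (x - y)" by (simp add: P_def algebra_simps inner_diff_left)
    ultimately show ?thesis by (simp add: dist_norm)
  qed
  \<comment> \<open>From \<open>z\<close> to \<open>x\<close> the height
    \<open>x \<bullet> e\<close> changes by at most \<open>norm (x - z)\<close> and the graph
    function by at most \<open>2 * L * norm (x - z)\<close>. A positive gap at \<open>z\<close>
    would thus persist nearby, although \<open>z\<close> is a limit of points of
    \<open>D\<close>.\<close>
  have \<phi>z: "\<phi> (P z) \<le> z \<bullet> e"
  proof (rule ccontr)
    assume "\<not> \<phi> (P z) \<le> z \<bullet> e"
    define \<eta> where "\<eta> = \<phi> (P z) - z \<bullet> e"
    then have \<eta>: "\<eta> > 0" using \<open>\<not> \<phi> (P z) \<le> z \<bullet> e\<close> by simp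
    define d where "d = min r (\<eta> / (1 + 2 * L))"
    have d: "d > 0" using r \<eta> L0 by (simp add: d_def add_pos_nonneg)
    have "z \<in> closure D" using z by (simp add: frontier_def)
    then obtain x where x: "x \<in> D" "dist x z < d" using d by (auto simp: closure_approachable)
    then have "x \<in> D \<inter> ball z r" by (simp add: d_def dist_commute)
    then have 1: "\<phi> (P x) < x \<bullet> e" unfolding D P_def by simp
    have n: "norm (x - z) < \<eta> / (1 + 2 * L)" using x(2) by (simp add: d_def dist_norm)
    then have 2: "norm (x - z) * (1 + 2 * L) < \<eta>" using L0 by (simp add: pos_less_divide_eq)
    have "\<phi> (P z) - \<phi> (P x) \<le> L * norm (P (z - x))" using PL[of z x] by simp
    also have "\<dots> \<le> L * (2 * norm (x - z))" using Pn[of "z - x"] L0 by (intro mult_left_mono) (auto simp: norm_minus_commute)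
    finally have 3: "\<phi> (P z) - \<phi> (P x) \<le> L * (2 * norm (x - z))" .
    have "x \<bullet> e - z \<bullet> e \<le> norm (x - z)" using Cauchy_Schwarz_ineq2[of "x - z" e] e by (simp add: inner_diff_left)
    then have "\<eta> < norm (x - z) + L * (2 * norm (x - z))" using 1 3 unfolding \<eta>_def by linarith
    with 2 show False by (simp add: algebra_simps)
  qed
  \<comment> \<open>Going up by \<open>s\<close> along \<open>e\<close> must pay for a deviation
    \<open>v\<close>: it costs less than \<open>\<kappa> * s\<close> of height and raises the graph
    by at most \<open>2 * L * \<kappa> * s\<close>. These costs add up to exactly
    \<open>s\<close>.\<close>
  define \<kappa> where "\<kappa> = 1 / (1 + 2 * L)"
  have \<kappa>: "0 < \<kappa>" "\<kappa> \<le> 1" "\<kappa> * (1 + 2 * L) = 1" using L0 by (auto simp: \<kappa>_def)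
  \<comment> \<open>As \<open>\<kappa> \<le> 1\<close>, the ball stays within distance
    \<open>2 * s\<close> of \<open>z\<close>; hence \<open>s < r / 2\<close> keeps it in the chart
    \<open>ball z r\<close>.\<close>
  have "ball (z + s *\<^sub>R e) (\<kappa> * s) \<subseteq> D" if s: "0 < s" "s < r / 2" for s
  proof
    fix x assume "x \<in> ball (z + s *\<^sub>R e) (\<kappa> * s)"
    define v where "v = x - (z + s *\<^sub>R e)"
    have v: "norm v < \<kappa> * s" using \<open>x \<in> _\<close> by (simp add: v_def dist_norm norm_minus_commute)
    have x: "x - z = s *\<^sub>R e + v" by (simp add: v_def)
    have "norm (x - z) \<le> s + norm v" unfolding x using norm_triangle_ineq[of "s *\<^sub>R e" v] s e by simp
    also have "\<dots> < s + \<kappa> * s" using v by simp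
    also have "\<dots> \<le> s + 1 * s" using \<kappa>(2) s by (intro add_left_mono mult_right_mono) auto
    also have "\<dots> \<le> r" using s by simp
    finally have xr: "x \<in> ball z r" by (simp add: dist_norm norm_minus_commute)
    have "P (x - z) = P v" unfolding x using ee by (simp add: P_def algebra_simps inner_add_left)
    then have "\<phi> (P x) \<le> \<phi> (P z) + L * norm (P v)" using PL[of x z] by simp
    also have "\<dots> \<le> z \<bullet> e + L * (2 * (\<kappa> * s))"
      using \<phi>z Pn[of v] v L0 by (intro add_mono mult_left_mono) auto
    also have "\<dots> = z \<bullet> e + s * (\<kappa> * (1 + 2 * L)) - \<kappa> * s" by (simp add: algebra_simps)
    also have "\<dots> = z \<bullet> e + s - \<kappa> * s" by (simp add: \<kappa>(3))
    also have "\<dots> < z \<bullet> e + s + v \<bullet> e" using Cauchy_Schwarz_ineq2[of v e] e v by simp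
    also have "\<dots> = x \<bullet> e" using arg_cong[OF x, of "\<lambda>y. y \<bullet> e"] ee by (simp add: inner_add_left inner_diff_left)
    finally have "x \<in> {x \<in> ball z r. \<phi> (x - (x \<bullet> e) *\<^sub>R e) < x \<bullet> e}" using xr by (simp add: P_def)
    then show "x \<in> D" unfolding D[symmetric] by simp
  qed
  with e \<kappa> r that[of e \<kappa> "r / 2"] show thesis by simp
qed

text \<open>The linear function attains its maximum on the compact closure. A maximizer inside the
  open set \<open>D\<close> could be pushed further along \<open>\<rho>\<close>, so it lies on the
  frontier.\<close>

lemma support_fun_attained:
  fixes D :: "'a::euclidean_space set"
  assumes D: "open D" "bounded D" "D \<noteq> {}" and \<rho>: "\<rho> \<noteq> 0"
  shows "\<And>x. x \<in> D \<Longrightarrow> x \<bullet> \<rho> \<le> support_fun D \<rho>"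
    and "\<exists>z\<in>frontier D. z \<bullet> \<rho> = support_fun D \<rho>"
proof -
  have "bounded ((\<lambda>x. x \<bullet> \<rho>) ` D)"
    using D(2) by (rule bounded_linear_image[OF _ bounded_linear_inner_left])
  then have bdd: "bdd_above ((\<lambda>x. x \<bullet> \<rho>) ` D)" by (rule bounded_imp_bdd_above)
  show le: "x \<bullet> \<rho> \<le> support_fun D \<rho>" if "x \<in> D" for x
    unfolding support_fun_def using that by (rule cSUP_upper[OF _ bdd])
  have "compact (closure D)" "closure D \<noteq> {}" using D by auto
  moreover have "continuous_on (closure D) (\<lambda>x. x \<bullet> \<rho>)" by (intro continuous_intros)
  ultimately obtain z where z: "z \<in> closure D" "\<And>x. x \<in> closure D \<Longrightarrow> x \<bullet> \<rho> \<le> z \<bullet> \<rho>"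
    using continuous_attains_sup by metis
  have "closure D \<subseteq> {x. \<rho> \<bullet> x \<le> support_fun D \<rho>}"
    using le by (intro closure_minimal closed_halfspace_le) (auto simp: inner_commute)
  then have 1: "z \<bullet> \<rho> \<le> support_fun D \<rho>" using z(1) by (auto simp: inner_commute)
  have 2: "support_fun D \<rho> \<le> z \<bullet> \<rho>"
    unfolding support_fun_def using D(3) z(2) closure_subset by (intro cSUP_least) auto
  have "z \<notin> D"
  proof
    assume "z \<in> D"
    then obtain r where r: "r > 0" "ball z r \<subseteq> D" using D(1) by (auto simp: open_contains_ball)
    define d where "d = r / (2 * norm \<rho>)"
    have d: "d > 0" "norm (d *\<^sub>R \<rho>) < r" using r(1) \<rho> by (auto simp: d_def)
    then have "z + d *\<^sub>R \<rho> \<in> D" using r(2) by (auto simp: dist_norm)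
    then have "(z + d *\<^sub>R \<rho>) \<bullet> \<rho> \<le> z \<bullet> \<rho>" using z(2) closure_subset by blast
    then have "d * (\<rho> \<bullet> \<rho>) \<le> 0" by (simp add: inner_add_left)
    moreover have "0 < d * (\<rho> \<bullet> \<rho>)" using d(1) \<rho> by simp
    ultimately show False by simp
  qed
  then have "z \<in> frontier D" using z(1) D(1) by (simp add: frontier_def interior_open)
  then show "\<exists>z\<in>frontier D. z \<bullet> \<rho> = support_fun D \<rho>" using 1 2 by (intro bexI[of _ z]) auto
qed

section \<open>Exponential integrals over the inclusion\<close>

definition exp_integral :: "real \<Rightarrow> 'a::euclidean_space set \<Rightarrow> 'a \<Rightarrow> real \<Rightarrow> real" where
  "exp_integral k D \<rho> t = (LINT x|lebesgue_on D. exp (k * (x \<bullet> \<rho> - t)))"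

lemma exp_integrable:
  fixes \<rho> :: "'a::euclidean_space"
  assumes "bounded_open D p"
  shows "integrable (lebesgue_on D) (\<lambda>x. exp (k * (x \<bullet> \<rho> - t)))"
proof -
  interpret bounded_open D p by fact
  show ?thesis by (intro Lp_integrable bounded_continuous_Lp continuous_intros)
qed

lemma exp_integral_nonneg: "0 \<le> exp_integral k D \<rho> t"
  by (simp add: exp_integral_def)

lemma exp_integral_le:
  assumes D: "bounded_open D p" and le: "\<And>x. x \<in> D \<Longrightarrow> x \<bullet> \<rho> - t \<le> m" and k: "0 \<le> k"
  shows "exp_integral k D \<rho> t \<le> exp (k * m) * measure lebesgue D"
proof -
  interpret bounded_open D p by fact
  have "exp_integral k D \<rho> t \<le> (LINT x|M. exp (k * m))"
    unfolding exp_integral_def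
    by (rule integral_mono[OF exp_integrable[OF D]]) (use le k in \<open>auto intro!: mult_left_mono\<close>)
  also have "\<dots> = exp (k * m) * measure lebesgue D"
    by (simp add: measure_restrict_space)
  finally show ?thesis .
qed

lemma exp_integral_ge:
  fixes \<rho> :: "'a::euclidean_space"
  assumes D: "bounded_open D p" and B: "ball y r \<subseteq> D" "0 \<le> r"
    and ge: "\<And>x. x \<in> ball y r \<Longrightarrow> m \<le> x \<bullet> \<rho> - t" and k: "0 \<le> k"
  shows "exp (k * m) * (unit_ball_vol (real DIM('a)) * r ^ DIM('a)) \<le> exp_integral k D \<rho> t"
proof -
  interpret bounded_open D p by fact
  have Bs: "ball y r \<in> sets M" using B(1) by (auto simp: sets_restrict_space)
  have "exp (k * m) * (unit_ball_vol (real DIM('a)) * r ^ DIM('a)) = exp (k * m) * measure M (ball y r)"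
    using content_ball[OF B(2), of y] B(1) by (simp add: measure_restrict_space)
  also have "\<dots> = (LINT x|M. exp (k * m) * indicator (ball y r) x)"
    using Bs Int_absorb2[OF B(1)] by simp
  also have "\<dots> \<le> exp_integral k D \<rho> t"
    unfolding exp_integral_def
  proof (rule integral_mono[OF _ exp_integrable[OF D]])
    show "integrable M (\<lambda>x. exp (k * m) * indicator (ball y r) x)" using Bs by (simp add: M.emeasure_eq_measure)
    fix x
    show "exp (k * m) * indicator (ball y r) x \<le> exp (k * (x \<bullet> \<rho> - t))"
      using ge[of x] k by (auto simp: indicator_def intro: mult_left_mono)
  qed
  finally show ?thesis .
qed

text \<open>Both integrands bounding the difference of the Dirichlet-to-Neumann forms vanish off
  \<open>D\<close>, where \<open>\<sigma>\<close> is 1, and have constant factors on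
  \<open>D\<close>. The constants depend on neither \<open>\<tau>\<close> nor \<open>t\<close>, so
  one pair serves all three regimes.\<close>

lemma indicator_fun_bounds:
  fixes \<Omega> D :: "'a::euclidean_space set"
  assumes p: "1 < p" and \<Omega>: "open \<Omega>" "bounded \<Omega>" and D: "D \<subseteq> \<Omega>" "open D"
    and \<sigma>D: "\<sigma>\<^sub>D \<in> Linfty_pos D" and \<sigma>: "\<forall>x\<in>\<Omega>. \<sigma> x = 1 + \<sigma>\<^sub>D x * indicator D x"
    and \<rho>: "norm \<rho> = 1" "norm \<rho>' = 1" "\<rho> \<bullet> \<rho>' = 0" and a: "wolff_profile p a"
  obtains k K where "0 < k" "0 < K"
    "\<And>\<tau> t. 0 < \<tau> \<Longrightarrow> k * \<tau> ^ DIM('a) * exp_integral (p * \<tau>) D \<rho> t \<le> indicator_fun p \<Omega> \<sigma> a \<rho> \<rho>' \<tau> t"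
    "\<And>\<tau> t. 0 < \<tau> \<Longrightarrow> indicator_fun p \<Omega> \<sigma> a \<rho> \<rho>' \<tau> t \<le> K * \<tau> ^ DIM('a) * exp_integral (p * \<tau>) D \<rho> t"
proof -
  note \<sigma> = \<sigma>[rule_format]
  have bo: "bounded_open \<Omega> p" "bounded_open D p"
    using p \<Omega> D bounded_subset by (auto simp: bounded_open_def)
  interpret bounded_open \<Omega> p by (rule bo)
  obtain c C where "wolff p a (deriv a) \<rho> \<rho>' c C" using wolff_profile_locale[OF p \<rho> a] .
  then interpret w: wolff p a "deriv a" \<rho> \<rho>' c C .
  have Ds: "D \<in> sets lebesgue" "D \<inter> \<Omega> = D" using D by auto
  obtain B \<epsilon> where \<sigma>Dm: "\<sigma>\<^sub>D \<in> borel_measurable (lebesgue_on D)"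
    and B: "AE x in lebesgue_on D. \<bar>\<sigma>\<^sub>D x\<bar> \<le> B" and \<epsilon>: "\<epsilon> > 0" "AE x in lebesgue_on D. \<epsilon> < \<sigma>\<^sub>D x"
    using \<sigma>D unfolding Linfty_pos_def by blast
  have AE_D: "AE x in M. x \<in> D \<longrightarrow> P x" if "AE x in lebesgue_on D. P x" for P
    using that Ds D by (auto simp: AE_restrict_space_iff elim!: eventually_mono)
  have Mspace: "AE x in M. x \<in> \<Omega>" by (rule AE_I2) simp
  \<comment> \<open>The maximum with 1 keeps the upper constant positive and makes
    \<open>\<sigma> x \<le> 1 + b\<close> hold off \<open>D\<close> as well.\<close>
  define b where "b = max B 1"
  have \<sigma>_out: "\<sigma> x = 1" if "x \<in> \<Omega>" "x \<notin> D" for x using \<sigma>[OF that(1)] that(2) by simp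
  have \<sigma>_in: "AE x in M. x \<in> D \<longrightarrow> 1 + \<epsilon> \<le> \<sigma> x \<and> \<sigma> x \<le> 1 + b"
    using AE_D[OF B] AE_D[OF \<epsilon>(2)] Mspace
    by eventually_elim (auto simp: \<sigma> b_def)
  have \<sigma>m: "\<sigma> \<in> borel_measurable M"
  proof -
    have "(\<lambda>x. if x \<in> D then \<sigma>\<^sub>D x else 0) \<in> borel_measurable M"
      using \<sigma>Dm D by (subst borel_measurable_if_lebesgue_on) auto
    then have "(\<lambda>x. 1 + (if x \<in> D then \<sigma>\<^sub>D x else 0)) \<in> borel_measurable M" by measurable
    then show ?thesis by (rule measurable_cong[THEN iffD1, rotated]) (auto simp: \<sigma>)
  qed
  let ?J = "\<lambda>\<tau> t. exp_integral (p * \<tau>) D \<rho> t" and ?I = "indicator_fun p \<Omega> \<sigma> a \<rho> \<rho>'"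
  let ?w = "\<lambda>x. 1 - \<sigma> x powr (- (1 / (p - 1)))"
  have \<sigma>ge: "AE x in M. 1 \<le> \<sigma> x"
    using \<sigma>_in Mspace by eventually_elim (use \<epsilon>(1) \<sigma>_out in force)
  have \<sigma>le: "AE x in M. \<sigma> x \<le> 1 + b"
    using \<sigma>_in Mspace by eventually_elim (use \<sigma>_out in \<open>force simp: b_def\<close>)
  \<comment> \<open>A lower bound on \<open>D\<close> for the integrand factor \<open>?w\<close>,
    positive because a base above 1 is raised to a negative power.\<close>
  define \<kappa> where "\<kappa> = 1 - (1 + \<epsilon>) powr (- (1 / (p - 1)))"
  have \<kappa>: "0 < \<kappa>"
    using powr_less_mono[of "- (1 / (p - 1))" 0 "1 + \<epsilon>"] \<epsilon>(1) p by (simp add: \<kappa>_def)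
  have J: "(LINT x|M. indicator D x * exp (k * (x \<bullet> \<rho> - t))) = exp_integral k D \<rho> t"
    and Ji: "integrable M (\<lambda>x. indicator D x * exp (k * (x \<bullet> \<rho> - t)))" for k t
  proof -
    have r: "restrict_space M D = lebesgue_on D"
      using D by (subst restrict_restrict_space) (auto simp: Int_absorb1)
    have "D \<inter> space M \<in> sets M" using D Ds by (auto simp: sets_restrict_space)
    from integral_restrict_space[OF this, of "\<lambda>x. exp (k * (x \<bullet> \<rho> - t))"]
      integrable_restrict_space[OF this, of "\<lambda>x. exp (k * (x \<bullet> \<rho> - t))"] exp_integrable[OF bo(2), of k \<rho> t]
    show "(LINT x|M. indicator D x * exp (k * (x \<bullet> \<rho> - t))) = exp_integral k D \<rho> t"
      "integrable M (\<lambda>x. indicator D x * exp (k * (x \<bullet> \<rho> - t)))"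
      by (simp_all add: r exp_integral_def)
  qed
  have bounds: "(p - 1) * \<kappa> * c powr (p / 2) * \<tau> ^ DIM('a) * ?J \<tau> t \<le> ?I \<tau> t
     \<and> ?I \<tau> t \<le> b * C powr (p / 2) * \<tau> ^ DIM('a) * ?J \<tau> t"
    if \<tau>: "0 < \<tau>" for \<tau> t
  proof -
    define u where "u = wolff_solution a \<rho> \<rho>' \<tau> t"
    define F where "F = trace_class p \<Omega> u"
    have sol: "weak_solution p \<Omega> (\<lambda>_. 1) u" unfolding u_def using bo(1) \<tau> by (rule w.wolff_weak_solution)
    note DN = DN_difference_bounds[OF \<sigma>m \<sigma>ge \<sigma>le sol, folded F_def]
    define N where "N x = norm (weak_grad \<Omega> u x) powr p" for x
    define X where "X x = exp (p * \<tau> * (x \<bullet> \<rho> - t))" for x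
    have N: "AE x in M. \<tau> powr p * X x * c powr (p / 2) \<le> N x \<and> N x \<le> \<tau> powr p * X x * C powr (p / 2)"
      using W1p_C1(2)[OF w.wolff_C1, of \<tau> t, folded u_def]
    proof eventually_elim
      case (elim x)
      let ?q = "(a (\<tau> * (x \<bullet> \<rho>')))\<^sup>2 + (deriv a (\<tau> * (x \<bullet> \<rho>')))\<^sup>2"
      have "N x = \<tau> powr p * X x * ?q powr (p / 2)"
        using w.norm_grad_wolff[OF \<tau>, of t x p] elim by (simp add: N_def X_def u_def)
      moreover have "c powr (p / 2) \<le> ?q powr (p / 2)" "?q powr (p / 2) \<le> C powr (p / 2)"
        using w.ab[of "\<tau> * (x \<bullet> \<rho>')"] w.c\<^sub>a p by (auto intro!: powr_mono2)
      ultimately show ?case by (auto simp: X_def intro!: mult_left_mono)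
    qed
    \<comment> \<open>The normalization of the indicator function meets the power \<open>p\<close>
      of \<open>\<tau>\<close> coming from the gradient.\<close>
    have \<tau>n: "\<tau> powr (real DIM('a) - p) * \<tau> powr p = \<tau> ^ DIM('a)"
      using \<tau> by (simp add: powr_realpow flip: powr_add)
    define \<Delta> where "\<Delta> = DN_map p \<Omega> \<sigma> F F - DN_map p \<Omega> (\<lambda>x. 1) F F"
    have I: "?I \<tau> t = \<tau> powr (real DIM('a) - p) * \<Delta>"
      by (simp add: indicator_fun_def Let_def \<Delta>_def F_def u_def)
    have J': "(LINT x|M. r * (indicator D x * X x)) = r * ?J \<tau> t"
      "integrable M (\<lambda>x. r * (indicator D x * X x))" for r
      using J[of "p * \<tau>" t] Ji[of "p * \<tau>" t] by (auto simp: X_def)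
    have "\<Delta> \<le> (LINT x|M. (\<sigma> x - 1) * N x)" using DN(1) by (simp add: \<Delta>_def N_def)
    also have "\<dots> \<le> (LINT x|M. b * C powr (p / 2) * \<tau> powr p * (indicator D x * X x))"
    proof (rule integral_mono_AE'[OF J'(2)])
      show "AE x in M. (\<sigma> x - 1) * N x \<le> b * C powr (p / 2) * \<tau> powr p * (indicator D x * X x)"
        using N \<sigma>_in Mspace
      proof eventually_elim
        case (elim x)
        show ?case
        proof (cases "x \<in> D")
          case True
          then have "(\<sigma> x - 1) * N x \<le> b * (\<tau> powr p * X x * C powr (p / 2))"
            using elim \<epsilon>(1) by (intro mult_mono) (auto simp: N_def b_def)
          then show ?thesis using True by (simp add: mult_ac)
        qed (use elim \<sigma>_out in simp)
      qed
      show "AE x in M. 0 \<le> b * C powr (p / 2) * \<tau> powr p * (indicator D x * X x)"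
        by (intro AE_I2) (auto simp: b_def X_def intro!: mult_nonneg_nonneg)
    qed
    finally have up: "\<Delta> \<le> b * C powr (p / 2) * \<tau> powr p * ?J \<tau> t" unfolding J' .
    have "(LINT x|M. \<kappa> * c powr (p / 2) * \<tau> powr p * (indicator D x * X x)) \<le> (LINT x|M. ?w x * N x)"
    proof (rule integral_mono_AE[OF J'(2)])
      show "integrable M (\<lambda>x. ?w x * N x)" using DN(3) by (simp add: N_def)
      show "AE x in M. \<kappa> * c powr (p / 2) * \<tau> powr p * (indicator D x * X x) \<le> ?w x * N x"
        using N \<sigma>_in Mspace
      proof eventually_elim
        case (elim x)
        show ?case
        proof (cases "x \<in> D")
          case True
          have "\<sigma> x powr (- (1 / (p - 1))) \<le> (1 + \<epsilon>) powr (- (1 / (p - 1)))"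
            using elim True \<epsilon>(1) p by (intro powr_mono2') auto
          then have "\<kappa> * (\<tau> powr p * X x * c powr (p / 2)) \<le> ?w x * N x"
            using elim \<kappa> by (intro mult_mono) (auto simp: \<kappa>_def X_def)
          then show ?thesis using True by (simp add: mult_ac)
        qed (use elim \<sigma>_out in simp)
      qed
    qed
    then have "(p - 1) * (\<kappa> * c powr (p / 2) * \<tau> powr p * ?J \<tau> t)
        \<le> (p - 1) * (LINT x|M. ?w x * N x)"
      unfolding J' using p by (intro mult_left_mono) auto
    also have "\<dots> \<le> \<Delta>" using DN(2) by (simp add: \<Delta>_def N_def)
    finally have low: "(p - 1) * (\<kappa> * c powr (p / 2) * \<tau> powr p * ?J \<tau> t) \<le> \<Delta>" .
    have T: "0 \<le> \<tau> powr (real DIM('a) - p)" by simp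
    show ?thesis
      using mult_left_mono[OF up T] mult_left_mono[OF low T]
      unfolding I \<tau>n[symmetric] by (simp add: mult_ac)
  qed
  have "0 < C" using w.ab(2)[of 0] w.ab_pos[of 0] by linarith
  show thesis
  proof (rule that)
    show "0 < (p - 1) * \<kappa> * c powr (p / 2)" using p \<kappa> w.c\<^sub>a by simp
    show "0 < b * C powr (p / 2)" using \<open>0 < C\<close> by (simp add: b_def)
  qed (use bounds in blast)+
qed

text \<open>The inequality \<open>x \<le> exp x\<close> at \<open>x = c * \<tau> / n\<close>, raised
  to the power \<open>n\<close>.\<close>

lemma power_le_exp:
  fixes c \<tau> :: real
  assumes "0 < c" "0 \<le> \<tau>" "0 < n"
  shows "\<tau> ^ n \<le> (real n / c) ^ n * exp (c * \<tau>)"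
proof -
  have "c * \<tau> / real n \<le> exp (c * \<tau> / real n)" using exp_ge_add_one_self[of "c * \<tau> / real n"] by linarith
  then have "real n / c * (c * \<tau> / real n) \<le> real n / c * exp (c * \<tau> / real n)"
    using assms by (intro mult_left_mono) auto
  then have "\<tau> \<le> real n / c * exp (c * \<tau> / real n)" using assms by simp
  then have "\<tau> ^ n \<le> (real n / c * exp (c * \<tau> / real n)) ^ n" using assms by (intro power_mono)
  also have "\<dots> = (real n / c) ^ n * exp (c * \<tau>)"
    unfolding power_mult_distrib exp_of_nat_mult[symmetric] using assms by simp
  finally show ?thesis .
qed

text \<open>Away from \<open>t = h\<close> an exponential in \<open>\<tau>\<close> outweighs the
  power of \<open>\<tau>\<close>: its rate is \<open>p * (h - t)\<close> for the decay and half of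
  this for the growth. At \<open>t = h\<close> the power is balanced by the volume of a ball with
  radius of order 1 / \<open>\<tau>\<close>.\<close>

theorem enclosure_indicator:
  fixes \<Omega> D :: "'a::euclidean_space set"
  assumes p: "1 < p" and \<Omega>: "open \<Omega>" "bounded \<Omega>" and D: "D \<subseteq> \<Omega>" "open D" "D \<noteq> {}" "lipschitz_boundary D"
    and \<sigma>D: "\<sigma>\<^sub>D \<in> Linfty_pos D" and \<sigma>: "\<forall>x\<in>\<Omega>. \<sigma> x = 1 + \<sigma>\<^sub>D x * indicator D x"
    and \<rho>: "norm \<rho> = 1" "norm \<rho>' = 1" "\<rho> \<bullet> \<rho>' = 0" and a: "wolff_profile p a"
  defines "I \<equiv> \<lambda>t \<tau>. \<bar>indicator_fun p \<Omega> \<sigma> a \<rho> \<rho>' \<tau> t\<bar>"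
  defines "h \<equiv> support_fun D \<rho>"
  shows "\<And>t. h < t \<Longrightarrow> \<exists>C>0. \<exists>c>0. \<forall>\<tau>>0. I t \<tau> \<le> C * exp (- c * \<tau>)"
    and "\<exists>C>0. \<forall>\<tau>>0. I h \<tau> \<le> C * \<tau> ^ DIM('a)"
    and "\<exists>c>0. \<forall>\<^sub>F \<tau> in at_top. c \<le> I h \<tau>"
    and "\<And>t. t < h \<Longrightarrow> \<exists>c>0. \<forall>\<^sub>F \<tau> in at_top. c * exp (c * \<tau>) \<le> I t \<tau>"
proof -
  let ?n = "DIM('a)"
  let ?J = "\<lambda>\<tau> t. exp_integral (p * \<tau>) D \<rho> t" and ?I = "indicator_fun p \<Omega> \<sigma> a \<rho> \<rho>'"
  have bo: "bounded_open D p"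
    using p \<Omega> D bounded_subset by (auto simp: bounded_open_def)
  obtain k K where k: "0 < k" "0 < K"
    and low: "\<And>\<tau> t. 0 < \<tau> \<Longrightarrow> k * \<tau> ^ ?n * ?J \<tau> t \<le> ?I \<tau> t"
    and up: "\<And>\<tau> t. 0 < \<tau> \<Longrightarrow> ?I \<tau> t \<le> K * \<tau> ^ ?n * ?J \<tau> t"
    using indicator_fun_bounds[OF p \<Omega> D(1,2) \<sigma>D \<sigma> \<rho> a] by blast
  have nonneg: "0 \<le> ?I \<tau> t" if "0 < \<tau>" for \<tau> t
    using low[OF that, of t] k that exp_integral_nonneg[of "p * \<tau>" D \<rho> t]
    by (meson mult_nonneg_nonneg less_imp_le order_trans zero_le_power)
  have I: "k * \<tau> ^ ?n * ?J \<tau> t \<le> I t \<tau>" "I t \<tau> \<le> K * \<tau> ^ ?n * ?J \<tau> t"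
    if "0 < \<tau>" for \<tau> t
    using low[OF that, of t] up[OF that, of t] nonneg[OF that, of t] by (auto simp: I_def)
  have "\<rho> \<noteq> 0" "bounded D" using \<rho>(1) \<Omega>(2) D(1) bounded_subset by auto
  note sup = support_fun_attained[OF D(2) this(2) D(3) this(1), folded h_def]
  define d where "d = measure lebesgue D"
  have d: "0 \<le> d" by (simp add: d_def)
  \<comment> \<open>The measure \<open>d\<close> is only known to be nonnegative here;
    \<open>d + 1\<close> makes the resulting constants positive.\<close>
  have upper: "I t \<tau> \<le> K * (d + 1) * (\<tau> ^ ?n * exp (- (p * (t - h)) * \<tau>))" if \<tau>: "0 < \<tau>" for t \<tau>
  proof -
    have "?J \<tau> t \<le> exp ((p * \<tau>) * (h - t)) * d"
      unfolding d_def using sup(1) \<tau> p by (intro exp_integral_le[OF bo]) auto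
    also have "\<dots> \<le> exp ((p * \<tau>) * (h - t)) * (d + 1)" by simp
    finally have "K * \<tau> ^ ?n * ?J \<tau> t \<le> K * \<tau> ^ ?n * (exp ((p * \<tau>) * (h - t)) * (d + 1))"
      using k \<tau> by (intro mult_left_mono) auto
    also have "(p * \<tau>) * (h - t) = - (p * (t - h)) * \<tau>" by (simp add: algebra_simps)
    finally show ?thesis using I(2)[OF \<tau>, of t] by (simp add: mult_ac)
  qed
  show "\<exists>C>0. \<exists>c>0. \<forall>\<tau>>0. I t \<tau> \<le> C * exp (- c * \<tau>)" if t: "h < t" for t
  proof -
    \<comment> \<open>Half of the rate \<open>p * (t - h)\<close> is spent on dominating the power
      of \<open>\<tau>\<close>; the other half remains as decay.\<close>
    define c where "c = p * (t - h) / 2"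
    have c: "0 < c" using t p by (simp add: c_def)
    define C where "C = K * (d + 1) * (real ?n / c) ^ ?n"
    have C: "0 < C" using k d c by (simp add: C_def)
    have "I t \<tau> \<le> C * exp (- c * \<tau>)" if \<tau>: "0 < \<tau>" for \<tau>
    proof -
      have "I t \<tau> \<le> K * (d + 1) * (\<tau> ^ ?n * exp (- (p * (t - h)) * \<tau>))" by (rule upper[OF \<tau>])
      also have "\<dots> \<le> K * (d + 1) * (((real ?n / c) ^ ?n * exp (c * \<tau>)) * exp (- (p * (t - h)) * \<tau>))"
        using k d \<tau> c by (intro mult_left_mono mult_right_mono power_le_exp) auto
      also have "\<dots> = C * (exp (c * \<tau>) * exp (- (p * (t - h)) * \<tau>))" by (simp add: C_def)
      also have "exp (c * \<tau>) * exp (- (p * (t - h)) * \<tau>) = exp (- c * \<tau>)"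
        unfolding exp_add[symmetric] c_def by (simp add: algebra_simps)
      finally show ?thesis .
    qed
    with c C show ?thesis by blast
  qed
  show "\<exists>C>0. \<forall>\<tau>>0. I h \<tau> \<le> C * \<tau> ^ ?n"
    using upper[of _ h] k d by (intro exI[of _ "K * (d + 1)"]) auto
  define \<omega> where "\<omega> = unit_ball_vol (real ?n)"
  have \<omega>: "0 < \<omega>" by (simp add: \<omega>_def)
  show "\<exists>c>0. \<forall>\<^sub>F \<tau> in at_top. c \<le> I h \<tau>"
  proof -
    obtain z where z: "z \<in> frontier D" "z \<bullet> \<rho> = h" using sup(2) by blast
    obtain e \<kappa> s0 where e: "norm e = 1" and \<kappa>: "0 < \<kappa>" "\<kappa> \<le> 1" and s0: "0 < s0"
      and ball: "\<And>s. 0 < s \<Longrightarrow> s < s0 \<Longrightarrow> ball (z + s *\<^sub>R e) (\<kappa> * s) \<subseteq> D"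
      using lipschitz_boundary_interior_balls[OF D(4) z(1)] by metis
    \<comment> \<open>The contribution of the interior ball at \<open>s = 1 / \<tau>\<close>. There
      \<open>x \<bullet> \<rho> - h\<close> is at least \<open>- (2 / \<tau>)\<close>, so the
      exponential with rate \<open>p * \<tau>\<close> is at least \<open>exp (- (2 * p))\<close>,
      and the volume cancels the power of \<open>\<tau>\<close>.\<close>
    define c where "c = k * (exp (- (2 * p)) * (\<omega> * \<kappa> ^ ?n))"
    have c: "0 < c" using k \<omega> \<kappa> by (simp add: c_def)
    have "c \<le> I h \<tau>" if \<tau>: "\<tau> > 1 / s0" "\<tau> > 0" for \<tau>
    proof -
      have s: "0 < 1 / \<tau>" "1 / \<tau> < s0" using \<tau> s0 by (auto simp: field_simps)
      have ge: "- (2 / \<tau>) \<le> x \<bullet> \<rho> - h" if x: "x \<in> ball (z + (1 / \<tau>) *\<^sub>R e) (\<kappa> * (1 / \<tau>))" for x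
      proof -
        have "norm (x - (z + (1 / \<tau>) *\<^sub>R e)) \<le> \<kappa> * (1 / \<tau>)" using x by (simp add: dist_norm norm_minus_commute)
        also have "\<dots> \<le> 1 / \<tau>" using \<kappa>(2) \<tau>(2) by (simp add: divide_right_mono)
        finally have "norm (x - z) \<le> 1 / \<tau> + norm ((1 / \<tau>) *\<^sub>R e)"
          using norm_triangle_ineq[of "x - (z + (1 / \<tau>) *\<^sub>R e)" "(1 / \<tau>) *\<^sub>R e"] by simp
        then have "norm (x - z) \<le> 2 / \<tau>" using e \<tau>(2) by simp
        moreover have "\<bar>(x - z) \<bullet> \<rho>\<bar> \<le> norm (x - z)" using Cauchy_Schwarz_ineq2[of "x - z" \<rho>] \<rho>(1) by simp
        ultimately show ?thesis using z(2) by (simp add: inner_diff_left)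
      qed
      let ?v = "exp ((p * \<tau>) * - (2 / \<tau>)) * (\<omega> * (\<kappa> * (1 / \<tau>)) ^ ?n)"
      have "?v \<le> ?J \<tau> h"
        unfolding \<omega>_def using \<kappa> \<tau>(2) p by (intro exp_integral_ge[OF bo ball[OF s]] ge) auto
      then have "k * \<tau> ^ ?n * ?v \<le> k * \<tau> ^ ?n * ?J \<tau> h"
        using k \<tau>(2) by (intro mult_left_mono) auto
      also have "\<dots> \<le> I h \<tau>" using I(1)[OF \<tau>(2)] .
      also have "k * \<tau> ^ ?n * ?v = c"
      proof -
        have "(p * \<tau>) * - (2 / \<tau>) = - (2 * p)" using \<tau>(2) by simp
        moreover have "(\<kappa> * (1 / \<tau>)) ^ ?n * \<tau> ^ ?n = \<kappa> ^ ?n" using \<tau>(2) by (simp flip: power_mult_distrib)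
        ultimately show ?thesis by (simp add: c_def) (simp add: mult_ac)
      qed
      finally show ?thesis .
    qed
    then have "\<forall>\<^sub>F \<tau> in at_top. c \<le> I h \<tau>"
      by (intro eventually_mono[OF eventually_conj[OF eventually_gt_at_top[of "1 / s0"] eventually_gt_at_top[of 0]]]) auto
    with c show ?thesis by blast
  qed
  show "\<exists>c>0. \<forall>\<^sub>F \<tau> in at_top. c * exp (c * \<tau>) \<le> I t \<tau>" if t: "t < h" for t
  proof -
    \<comment> \<open>Half of the gap leaves room for a fixed ball in \<open>D\<close> above the
      level \<open>t + \<delta>\<close>, which gives growth with rate
      \<open>p * \<delta>\<close>.\<close>
    define \<delta> where "\<delta> = (h - t) / 2"
    have \<delta>: "0 < \<delta>" using t by (simp add: \<delta>_def)
    have "\<exists>y\<in>D. t + \<delta> < y \<bullet> \<rho>"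
    proof -
      have "t + \<delta> < h" using t by (simp add: \<delta>_def field_simps)
      then show ?thesis unfolding h_def support_fun_def
        using less_cSUP_iff[of D "\<lambda>x. x \<bullet> \<rho>" "t + \<delta>"] D(3) sup(1) by (auto simp: bdd_above_def)
    qed
    then obtain y where y: "y \<in> D \<inter> {x. t + \<delta> < \<rho> \<bullet> x}" by (auto simp: inner_commute)
    have "open (D \<inter> {x. t + \<delta> < \<rho> \<bullet> x})" using D(2) open_halfspace_gt[of "t + \<delta>" \<rho>] by auto
    then obtain r where r: "r > 0" "ball y r \<subseteq> D \<inter> {x. t + \<delta> < \<rho> \<bullet> x}"
      using y open_contains_ball by metis
    define \<mu> where "\<mu> = \<omega> * r ^ ?n"
    have \<mu>: "0 < \<mu>" using \<omega> r by (simp add: \<mu>_def)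
    \<comment> \<open>The same constant must serve as prefactor and as rate, hence the minimum. The
      restriction to \<open>1 \<le> \<tau>\<close> below allows the power of \<open>\<tau>\<close>
      to be bounded below by 1.\<close>
    define c where "c = min (k * \<mu>) (p * \<delta>)"
    have c: "0 < c" using k \<mu> p \<delta> by (simp add: c_def)
    have "c * exp (c * \<tau>) \<le> I t \<tau>" if \<tau>: "1 \<le> \<tau>" for \<tau>
    proof -
      have b: "exp ((p * \<tau>) * \<delta>) * \<mu> \<le> ?J \<tau> t"
        unfolding \<mu>_def \<omega>_def
        using r p \<tau> by (intro exp_integral_ge[OF bo]) (auto simp: subset_iff inner_commute less_imp_le)
      have "c * exp (c * \<tau>) \<le> (k * \<mu>) * exp (p * \<delta> * \<tau>)"
        using \<tau> c k \<mu> by (intro mult_mono) (auto simp: c_def intro!: mult_right_mono)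
      also have "\<dots> = k * 1 * (exp ((p * \<tau>) * \<delta>) * \<mu>)" by (simp add: mult_ac)
      also have "\<dots> \<le> k * \<tau> ^ ?n * ?J \<tau> t"
        using k \<mu> \<tau> b by (intro mult_mono mult_left_mono) auto
      also have "\<dots> \<le> I t \<tau>" using \<tau> by (intro I(1)) auto
      finally show ?thesis .
    qed
    then have "\<forall>\<^sub>F \<tau> in at_top. c * exp (c * \<tau>) \<le> I t \<tau>"
      by (rule eventually_at_top_linorderI)
    with c show ?thesis by blast
  qed
qed

text \<open>Each qualitative limit follows by comparison from the quantitative bound that
  accompanies it.\<close>

theorem theorem4p1:
  fixes p :: real
    and \<Omega> D :: "(real ^ 'n) set"
    and \<sigma>\<^sub>D \<sigma> :: "real ^ 'n \<Rightarrow> real"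
    and \<rho> \<rho>' :: "real ^ 'n"
    and a :: "real \<Rightarrow> real"
  assumes "CARD('n) \<ge> 2"
    and "1 < p"
    and "open \<Omega>" and "connected \<Omega>" and "bounded \<Omega>"
    and "D \<subseteq> \<Omega>" and "open D" and "D \<noteq> {}" and "lipschitz_boundary D"
    and "\<sigma>\<^sub>D \<in> Linfty_pos D"
    and "\<And>x. x \<in> \<Omega> \<Longrightarrow> \<sigma> x = 1 + \<sigma>\<^sub>D x * indicator D x"
    and "norm \<rho> = 1" and "norm \<rho>' = 1" and "\<rho> \<bullet> \<rho>' = 0"
    and "wolff_profile p a"
  shows
    "(\<forall>t > support_fun D \<rho>.
        ((\<lambda>\<tau>. \<bar>indicator_fun p \<Omega> \<sigma> a \<rho> \<rho>' \<tau> t\<bar>) \<longlongrightarrow> 0) at_top \<and>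
        (\<exists>C>0. \<exists>c>0. \<forall>\<tau>>0. \<bar>indicator_fun p \<Omega> \<sigma> a \<rho> \<rho>' \<tau> t\<bar> \<le> C * exp (- c * \<tau>))) \<and>
     (0 < Liminf at_top (\<lambda>\<tau>. ereal \<bar>indicator_fun p \<Omega> \<sigma> a \<rho> \<rho>' \<tau> (support_fun D \<rho>)\<bar>) \<and>
        (\<exists>c>0. \<exists>C>0.
          (\<forall>\<tau>>0. \<bar>indicator_fun p \<Omega> \<sigma> a \<rho> \<rho>' \<tau> (support_fun D \<rho>)\<bar> \<le> C * \<tau> ^ CARD('n)) \<and>
          (\<forall>\<^sub>F \<tau> in at_top. c \<le> \<bar>indicator_fun p \<Omega> \<sigma> a \<rho> \<rho>' \<tau> (support_fun D \<rho>)\<bar>))) \<and>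
     (\<forall>t < support_fun D \<rho>.
        filterlim (\<lambda>\<tau>. \<bar>indicator_fun p \<Omega> \<sigma> a \<rho> \<rho>' \<tau> t\<bar>) at_top at_top \<and>
        (\<exists>c>0. \<forall>\<^sub>F \<tau> in at_top. c * exp (c * \<tau>) \<le> \<bar>indicator_fun p \<Omega> \<sigma> a \<rho> \<rho>' \<tau> t\<bar>))"
proof -
  define I where "I t \<tau> = \<bar>indicator_fun p \<Omega> \<sigma> a \<rho> \<rho>' \<tau> t\<bar>" for t \<tau>
  define h where "h = support_fun D \<rho>"
  have \<sigma>: "\<forall>x\<in>\<Omega>. \<sigma> x = 1 + \<sigma>\<^sub>D x * indicator D x" using assms(11) by blast
  note main = enclosure_indicator[OF assms(2,3,5-10) \<sigma> assms(12-15), folded I_def h_def]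
  have 1: "(I t \<longlongrightarrow> 0) at_top" if t: "t > h" for t
  proof -
    obtain C c where "C > 0" "c > 0" and le: "\<And>\<tau>. \<tau> > 0 \<Longrightarrow> I t \<tau> \<le> C * exp (- c * \<tau>)"
      using main(1)[OF t] by blast
    show ?thesis
    proof (rule tendsto_sandwich[OF _ _ tendsto_const])
      show "((\<lambda>\<tau>. C * exp (- c * \<tau>)) \<longlongrightarrow> 0) at_top" using \<open>c > 0\<close> by real_asymp
      show "\<forall>\<^sub>F \<tau> in at_top. I t \<tau> \<le> C * exp (- c * \<tau>)"
        using eventually_gt_at_top[of 0] by eventually_elim (rule le)
    qed (simp add: I_def)
  qed
  obtain c where c: "c > 0" "\<forall>\<^sub>F \<tau> in at_top. c \<le> I h \<tau>" using main(3) by blast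
  have "ereal c \<le> Liminf at_top (\<lambda>\<tau>. ereal (I h \<tau>))"
    using c(2) by (intro Liminf_bounded) simp
  then have 2: "0 < Liminf at_top (\<lambda>\<tau>. ereal (I h \<tau>))"
    using c(1) by (meson ereal_less(2) less_le_trans)
  have 3: "filterlim (I t) at_top at_top" if t: "t < h" for t
  proof -
    obtain c where "c > 0" and ge: "\<forall>\<^sub>F \<tau> in at_top. c * exp (c * \<tau>) \<le> I t \<tau>" using main(4)[OF t] by blast
    have "filterlim (\<lambda>\<tau>. c * exp (c * \<tau>)) at_top at_top" using \<open>c > 0\<close> by real_asymp
    then show ?thesis using ge by (rule filterlim_at_top_mono)
  qed
  have "\<exists>c>0. \<exists>C>0. (\<forall>\<tau>>0. I h \<tau> \<le> C * \<tau> ^ CARD('n)) \<and> (\<forall>\<^sub>F \<tau> in at_top. c \<le> I h \<tau>)"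
    using main(2) c by auto
  with 1 2 3 main(1,4) show ?thesis unfolding I_def h_def by blast
qed

end
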